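(* Let $L$ be an oriented link and let $\gamma\in\{0,1\}$ be the number of components of $L$ modulo 2. There is a spectral sequence $(E_r^{k,l},d_r)$, with $d_r\colon E_r^{k,l}\to E_r^{k+r,l-r+1}$, arising from the filtration $F^k$ of the filtered Bar-Natan complex, whose $E_1$-page is the $\mathbb{F}_2$-Khovanov homology, $$E_1^{k,l}=\mathrm{KH}_{\mathbb{F}_2}^{k+l,\,2k+\gamma}(L),$$ and which converges to the filtered Bar-Natan homology $\mathrm{BN}^{*}(L)'$. Its $E_2$-page is given by the secondary groups, $$E_2^{k,l}=\mathbb{K}^{k+l,\,2k+\gamma}(L).$$
   Context: Let $D$ be a diagram of $L$ with $n$ ordered crossings, $n_+$ positive and $n_-$ negative. For $\alpha\in\{0,1\}^n$ let $D_\alpha$ be the complete smoothing in which the $r$-th crossing receives its $\alpha_r$-smoothing (the oriented smoothing of a positive crossing is its 0-smoothing and of a negative crossing its 1-smoothing). Let $A=\mathbb{F}_2\{1,x\}$ with $\deg 1=1$, $\deg x=-1$, and $V_\alpha=A^{\otimes(\text{circles of }D_\alpha)}$. Set $\overline{\mathcal C}^{i}(D)=\bigoplus_{|\alpha|-n_-=i}V_\alpha$, where $|\alpha|$ is the number of 1's in $\alpha$, and give homogeneous $v\in V_\alpha\subset\overline{\mathcal C}^{i}(D)$ the $q$-grading $q(v)=\deg(v)+i+n_+-n_-$. Write $\overline{\mathcal C}^{i,j}(D)$ for the part of $\overline{\mathcal C}^i(D)$ of $q$-grading $j$; it vanishes unless $j\equiv\gamma$ mod 2. Given a pair of maps (merge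 map $A\otimes A\to A$, split map $A\to A\otimes A$), the associated cube map sends $v\in V_\alpha$ to the sum, over all edges $\alpha\to\alpha'$ of the cube (one entry changed from 0 to 1), of the result of applying the merge or split map to the circles that merge or split and the identity to the other tensor factors. - Khovanov's differential $\partial$ (bidegree $(1,0)$) is the cube map of $\overline m(1,1)=1$, $\overline m(1,x)=\overline m(x,1)=x$, $\overline m(x,x)=0$; $\overline\Delta(1)=1\otimes x+x\otimes1$, $\overline\Delta(x)=x\otimes x$. Its homology is $\mathrm{KH}_{\mathbb{F}_2}^{*,*}(L)$. - $\beta$ (bidegree $(1,2)$) is the cube map of $\tilde m(1,1)=\tilde m(1,x)=\tilde m(x,1)=0$, $\tilde m(x,x)=x$; $\tilde\Delta(1)=1\otimes1$, $\tilde\Delta(x)=0$. It commutes with $\partial$ and satisfies $\beta^2=0$, so it induces $\beta_*\colon\mathrm{KH}_{\mathbb{F}_2}^{i,j}(L)\to\mathrm{KH}_{\mathbb{F}_2}^{i+1,j+2}(L)$ with $\beta_*^2=0$. - The secondary groups are $$\mathbb{K}^{i,j}(L)=\frac{\ker(\beta_*\colon\mathrm{KH}_{\mathbb{F}_2}^{i,j}(L)\to\mathrm{KH}_{\mathbb{F}_2}^{i+1,j+2}(L))}{\mathrm{im}(\beta_*\colon\mathrm{KH}_{\mathbb{F}_2}^{i-1,j-2}(L)\to\mathrm{KH}_{\mathbb{F}_2}^{i,j}(L))}.$$ - The filtered Bar-Natan homology $\mathrm{BN}^*(L)'$ is the homology of $(\overline{\mathcal C}^*(D),d)$, where $d$ is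 the cube map of $m=\overline m+\tilde m$ and $\Delta=\overline\Delta+\tilde\Delta$, i.e. $d=\partial+\beta$ (Bar-Natan's theory over $\mathbb{F}_2[u]$ with $u$ set to 1). - The (bounded) filtration is $F^k\overline{\mathcal C}^i(D)=\bigoplus_{j\ge 2k+\gamma}\overline{\mathcal C}^{i,j}(D)$, preserved by $d$. *)

theory Defs
  imports "HOL-Library.Z2" "HOL-Library.Function_Algebras" "HOL-Library.FuncSet"
    "HOL-Algebra.Coset"
begin

section \<open>Oriented link diagrams\<close>

text \<open>
  A diagram is given by its planar diagram code. The arcs are the pieces into which the crossings
  cut the diagram, each running from one crossing passage to the next; a component without
  crossings is a single arc that is incident to no crossing. Every arc is oriented by the
  orientation of the link, so a crossing has an incoming and an outgoing under-arc and an incoming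
  and an outgoing over-arc. The link itself is not a separate object: everything below is defined, as
  for Khovanov homology in general, from a diagram of it. How the connected components of the diagram
  lie relative to each other in the plane is not recorded, as the complex does not depend on it.
\<close>

record crossing =
  positive :: bool
  under_in :: nat
  under_out :: nat
  over_in :: nat
  over_out :: nat

record diagram =
  crossings :: "crossing list"
  arcs :: "nat set"

text \<open>The four arc ends at a crossing in counterclockwise order, beginning with the incoming
  under-arc.\<close>

definition ccw :: "crossing \<Rightarrow> nat list" where
  "ccw x = (if positive x then [under_in x, over_out x, under_out x, over_in x]
            else [under_in x, over_in x, under_out x, over_out x])"

definition generated_classes :: "'a set \<Rightarrow> ('a \<times> 'a) set \<Rightarrow> 'a set set" where
  "generated_classes A R = A // (R \<union> R\<inverse>)\<^sup>*"

definition darts :: "diagram \<Rightarrow> (nat \<times> nat) set" where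
  "darts D = {..<length (crossings D)} \<times> {..<4}"

definition dart_arc :: "diagram \<Rightarrow> nat \<times> nat \<Rightarrow> nat" where
  "dart_arc D = (\<lambda>(r, p). ccw (crossings D ! r) ! p)"

text \<open>Walking along the boundary of a face: follow the arc of a dart to its other end, then turn to
  the next dart at the crossing reached.\<close>

definition face_step :: "diagram \<Rightarrow> ((nat \<times> nat) \<times> (nat \<times> nat)) set" where
  "face_step D = {((r, p), (r', Suc p' mod 4)) | r p r' p'.
     (r, p) \<in> darts D \<and> (r', p') \<in> darts D \<and> (r, p) \<noteq> (r', p') \<and>
     dart_arc D (r, p) = dart_arc D (r', p')}"

definition adjacent :: "diagram \<Rightarrow> (nat \<times> nat) set" where
  "adjacent D = {(r, r') | r p r' p'. (r, p) \<in> darts D \<and> (r', p') \<in> darts D \<and>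
     dart_arc D (r, p) = dart_arc D (r', p')}"

text \<open>
  The closed surface obtained by gluing discs to the 4-valent graph of crossings along its faces has
  Euler characteristic at most 2 on each connected component, with equality exactly for a sphere.
  So the equation says that the code is realised by a diagram in the plane.
\<close>

definition planar :: "diagram \<Rightarrow> bool" where
  "planar D \<longleftrightarrow>
     int (length (crossings D)) - int (card (dart_arc D ` darts D))
       + int (card (generated_classes (darts D) (face_step D)))
     = 2 * int (card (generated_classes {..<length (crossings D)} (adjacent D)))"

definition link_diagram :: "diagram \<Rightarrow> bool" where
  "link_diagram D \<longleftrightarrow>
     (let ins = concat (map (\<lambda>x. [under_in x, over_in x]) (crossings D));
          outs = concat (map (\<lambda>x. [under_out x, over_out x]) (crossings D))
      in distinct ins \<and> distinct outs \<and> set ins = set outs \<and>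
         set ins \<subseteq> arcs D \<and> finite (arcs D) \<and> planar D)"

definition components :: "diagram \<Rightarrow> nat set set" where
  "components D = generated_classes (arcs D)
     (\<Union>x \<in> set (crossings D). {(under_in x, under_out x), (over_in x, over_out x)})"

definition gamma :: "diagram \<Rightarrow> int" where
  "gamma D = int (card (components D) mod 2)"

definition n_plus :: "diagram \<Rightarrow> nat" where
  "n_plus D = length (filter positive (crossings D))"

definition n_minus :: "diagram \<Rightarrow> nat" where
  "n_minus D = length (filter (\<lambda>x. \<not> positive x) (crossings D))"


section \<open>The cube of resolutions\<close>

text \<open>A vertex \<open>\<alpha>\<close> of the cube is a list of booleans, \<open>True\<close> standing for 1. The smoothing of
  a crossing is given by the two pairs of arcs that it joins; the first of the two possibilities
  is the oriented smoothing.\<close>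

definition smoothing :: "bool \<Rightarrow> crossing \<Rightarrow> (nat \<times> nat) set" where
  "smoothing a x =
     (if a = (\<not> positive x) then {(under_in x, over_out x), (over_in x, under_out x)}
      else {(under_in x, over_in x), (under_out x, over_out x)})"

text \<open>A circle of a complete smoothing is identified with the set of arcs it runs through.\<close>

definition circles :: "diagram \<Rightarrow> bool list \<Rightarrow> nat set set" where
  "circles D \<alpha> = generated_classes (arcs D)
     (\<Union>r < length (crossings D). smoothing (\<alpha> ! r) (crossings D ! r))"

definition cube_edge :: "bool list \<Rightarrow> bool list \<Rightarrow> bool" where
  "cube_edge \<alpha> \<alpha>' \<longleftrightarrow> (\<exists>r < length \<alpha>. \<not> \<alpha> ! r \<and> \<alpha>' = \<alpha>[r := True])"

definition weight :: "bool list \<Rightarrow> nat" where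
  "weight \<alpha> = length (filter (\<lambda>a. a) \<alpha>)"


section \<open>Chains\<close>

text \<open>
  The basis \<open>1, x\<close> of the algebra \<open>A\<close>. For a set \<open>S\<close> of basis elements the vector space with basis
  \<open>S\<close> over the field with two elements is the space of functions to \<^typ>\<open>bit\<close> supported in \<open>S\<close>; thus
  \<open>A\<close> is \<open>gen \<Rightarrow> bit\<close> and \<open>A \<otimes> A\<close> is \<open>gen \<times> gen \<Rightarrow> bit\<close>. The tensor power of
  \<open>A\<close> indexed by the circles of a smoothing has the labellings of these circles by \<open>1, x\<close> as basis.
\<close>

datatype gen = One_A | X_A

fun deg :: "gen \<Rightarrow> int" where
  "deg One_A = 1"
| "deg X_A = -1"

definition basis :: "'a \<Rightarrow> 'a \<Rightarrow> bit" where
  "basis s = (\<lambda>t. of_bool (s = t))"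

type_synonym state = "bool list \<times> (nat set \<Rightarrow> gen)"
type_synonym chain = "state \<Rightarrow> bit"

definition states :: "diagram \<Rightarrow> state set" where
  "states D = {(\<alpha>, v). length \<alpha> = length (crossings D) \<and> v \<in> circles D \<alpha> \<rightarrow>\<^sub>E UNIV}"

definition hdeg :: "diagram \<Rightarrow> state \<Rightarrow> int" where
  "hdeg D = (\<lambda>(\<alpha>, v). int (weight \<alpha>) - int (n_minus D))"

definition qdeg :: "diagram \<Rightarrow> state \<Rightarrow> int" where
  "qdeg D = (\<lambda>(\<alpha>, v).
     (\<Sum>c \<in> circles D \<alpha>. deg (v c)) + hdeg D (\<alpha>, v) + int (n_plus D) - int (n_minus D))"

definition span_on :: "'a set \<Rightarrow> ('a \<Rightarrow> bit) set" where
  "span_on S = {c. \<forall>s. c s \<noteq> 0 \<longrightarrow> s \<in> S}"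

definition C :: "diagram \<Rightarrow> int \<Rightarrow> chain set" where
  "C D i = span_on {s \<in> states D. hdeg D s = i}"

definition Cq :: "diagram \<Rightarrow> int \<Rightarrow> int \<Rightarrow> chain set" where
  "Cq D i j = span_on {s \<in> states D. hdeg D s = i \<and> qdeg D s = j}"

definition filt :: "diagram \<Rightarrow> int \<Rightarrow> int \<Rightarrow> chain set" where
  "filt D k i = span_on {s \<in> states D. hdeg D s = i \<and> qdeg D s \<ge> 2 * k + gamma D}"


section \<open>Cube maps\<close>

type_synonym merge_map = "gen \<Rightarrow> gen \<Rightarrow> (gen \<Rightarrow> bit)"
type_synonym split_map = "gen \<Rightarrow> (gen \<times> gen \<Rightarrow> bit)"

text \<open>
  The coefficient of the basis element \<open>(\<alpha>', v')\<close> in the image of the basis element \<open>(\<alpha>, v)\<close>. The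
  circles of \<open>\<alpha>\<close> that are not circles of \<open>\<alpha>'\<close> are those that merge or split. The choice of names
  for the two merging circles (or the two new ones) is immaterial for a commutative merge map and a
  cocommutative split map, and all the maps below are of this kind.
\<close>

definition cube_coeff :: "merge_map \<Rightarrow> split_map \<Rightarrow> diagram \<Rightarrow> state \<Rightarrow> state \<Rightarrow> bit" where
  "cube_coeff m \<Delta> D = (\<lambda>(\<alpha>, v) (\<alpha>', v').
     let S = circles D \<alpha>; S' = circles D \<alpha>' in
     of_bool (cube_edge \<alpha> \<alpha>' \<and> (\<forall>c \<in> S \<inter> S'. v' c = v c) \<and>
       ((\<exists>a b c. a \<noteq> b \<and> S - S' = {a, b} \<and> S' - S = {c} \<and> m (v a) (v b) (v' c) = 1) \<or>
        (\<exists>a b c. b \<noteq> c \<and> S - S' = {a} \<and> S' - S = {b, c} \<and> \<Delta> (v a) (v' b, v' c) = 1))))"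

definition cube_map :: "merge_map \<Rightarrow> split_map \<Rightarrow> diagram \<Rightarrow> chain \<Rightarrow> chain" where
  "cube_map m \<Delta> D c =
     (\<lambda>t. if t \<in> states D then \<Sum>s \<in> states D. c s * cube_coeff m \<Delta> D s t else 0)"

fun m_Kh :: merge_map where
  "m_Kh One_A One_A = basis One_A"
| "m_Kh One_A X_A = basis X_A"
| "m_Kh X_A One_A = basis X_A"
| "m_Kh X_A X_A = 0"

fun \<Delta>_Kh :: split_map where
  "\<Delta>_Kh One_A = basis (One_A, X_A) + basis (X_A, One_A)"
| "\<Delta>_Kh X_A = basis (X_A, X_A)"

fun m_tilde :: merge_map where
  "m_tilde One_A One_A = 0"
| "m_tilde One_A X_A = 0"
| "m_tilde X_A One_A = 0"
| "m_tilde X_A X_A = basis X_A"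

fun \<Delta>_tilde :: split_map where
  "\<Delta>_tilde One_A = basis (One_A, One_A)"
| "\<Delta>_tilde X_A = 0"

definition d_Kh :: "diagram \<Rightarrow> chain \<Rightarrow> chain" where
  "d_Kh D = cube_map m_Kh \<Delta>_Kh D"

definition beta :: "diagram \<Rightarrow> chain \<Rightarrow> chain" where
  "beta D = cube_map m_tilde \<Delta>_tilde D"

definition d_BN :: "diagram \<Rightarrow> chain \<Rightarrow> chain" where
  "d_BN D = cube_map (m_Kh + m_tilde) (\<Delta>_Kh + \<Delta>_tilde) D"


section \<open>Homology\<close>

text \<open>Vector spaces over the field with two elements are groups of exponent 2; every group
  homomorphism between them is linear.\<close>

definition F2_space :: "('a, 'b) monoid_scheme \<Rightarrow> bool" where
  "F2_space G \<longleftrightarrow> comm_group G \<and> (\<forall>x \<in> carrier G. x \<otimes>\<^bsub>G\<^esub> x = \<one>\<^bsub>G\<^esub>)"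

definition add_grp :: "'a::ab_group_add set \<Rightarrow> 'a monoid" where
  "add_grp S = \<lparr>carrier = S, mult = (+), one = 0\<rparr>"

text \<open>The homology at the middle term of \<open>G \<rightarrow> H \<rightarrow> K\<close> with maps \<open>f\<close> and \<open>g\<close>.\<close>

definition homology ::
  "('a, 'u) monoid_scheme \<Rightarrow> ('a \<Rightarrow> 'b) \<Rightarrow> 'b monoid \<Rightarrow> ('b \<Rightarrow> 'c) \<Rightarrow> ('c, 'w) monoid_scheme
   \<Rightarrow> 'b set monoid" where
  "homology G f H g K = H\<lparr>carrier := kernel H K g\<rparr> Mod (f ` carrier G)"

text \<open>The map on cosets induced by an additive map \<open>f\<close>, where \<open>B\<close> is the subspace divided out in the
  target.\<close>

definition induced :: "('a \<Rightarrow> 'b::ab_group_add) \<Rightarrow> 'b set \<Rightarrow> 'a set \<Rightarrow> 'b set" where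
  "induced f B X = {f x + b | x b. x \<in> X \<and> b \<in> B}"

definition KH :: "diagram \<Rightarrow> int \<Rightarrow> int \<Rightarrow> chain set monoid" where
  "KH D i j =
     homology (add_grp (Cq D (i - 1) j)) (d_Kh D) (add_grp (Cq D i j)) (d_Kh D)
       (add_grp (Cq D (i + 1) j))"

text \<open>\<open>beta_star D i j\<close> is the map from \<open>KH D i j\<close> to \<open>KH D (i + 1) (j + 2)\<close>.\<close>

definition beta_star :: "diagram \<Rightarrow> int \<Rightarrow> int \<Rightarrow> chain set \<Rightarrow> chain set" where
  "beta_star D i j = induced (beta D) (d_Kh D ` Cq D i (j + 2))"

definition secondary :: "diagram \<Rightarrow> int \<Rightarrow> int \<Rightarrow> chain set set monoid" where
  "secondary D i j =
     homology (KH D (i - 1) (j - 2)) (beta_star D (i - 1) (j - 2)) (KH D i j) (beta_star D i j)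
       (KH D (i + 1) (j + 2))"

definition BN :: "diagram \<Rightarrow> int \<Rightarrow> chain set monoid" where
  "BN D i =
     homology (add_grp (C D (i - 1))) (d_BN D) (add_grp (C D i)) (d_BN D) (add_grp (C D (i + 1)))"

text \<open>The filtration induced on homology: the image of the homology of \<open>F\<^sup>k\<close>.\<close>

definition BN_filt :: "diagram \<Rightarrow> int \<Rightarrow> int \<Rightarrow> chain set set" where
  "BN_filt D k i =
     induced (\<lambda>z. z) (d_BN D ` C D (i - 1)) `
       carrier (homology (add_grp (filt D k (i - 1))) (d_BN D) (add_grp (filt D k i)) (d_BN D)
         (add_grp (filt D k (i + 1))))"


section \<open>Spectral sequences\<close>

text \<open>Pages are indexed by \<open>r \<ge> 1\<close>; \<open>\<delta> r k l\<close> is the differential leaving \<open>E r k l\<close>.\<close>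

definition spectral_sequence ::
  "(int \<Rightarrow> int \<Rightarrow> int \<Rightarrow> 'a monoid) \<Rightarrow> (int \<Rightarrow> int \<Rightarrow> int \<Rightarrow> 'a \<Rightarrow> 'a) \<Rightarrow> bool" where
  "spectral_sequence E \<delta> \<longleftrightarrow> (\<forall>r \<ge> 1. \<forall>k l.
     F2_space (E r k l) \<and>
     \<delta> r k l \<in> hom (E r k l) (E r (k + r) (l - r + 1)) \<and>
     (\<forall>x \<in> carrier (E r k l). 
        \<delta> r (k + r) (l - r + 1) (\<delta> r k l x) = \<one>\<^bsub>E r (k + 2 * r) (l - 2 * r + 2)\<^esub>) \<and>
     E (r + 1) k l \<cong>
       homology (E r (k - r) (l + r - 1)) (\<delta> r (k - r) (l + r - 1)) (E r k l) (\<delta> r k l)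
         (E r (k + r) (l - r + 1)))"

text \<open>The spectral sequence of a filtered cochain complex, \<open>F k i\<close> being the \<open>k\<close>-th filtration step
  in cohomological degree \<open>i\<close>.\<close>

definition filt_Z ::
  "(int \<Rightarrow> int \<Rightarrow> 'a set) \<Rightarrow> ('a \<Rightarrow> 'a) \<Rightarrow> int \<Rightarrow> int \<Rightarrow> int \<Rightarrow> 'a set" where
  "filt_Z F d r k l = {z \<in> F k (k + l). d z \<in> F (k + r) (k + l + 1)}"

definition filt_B ::
  "(int \<Rightarrow> int \<Rightarrow> 'a::ab_group_add set) \<Rightarrow> ('a \<Rightarrow> 'a) \<Rightarrow> int \<Rightarrow> int \<Rightarrow> int \<Rightarrow> 'a set" where
  "filt_B F d r k l = {a + d b | a b.
     a \<in> filt_Z F d (r - 1) (k + 1) (l - 1) \<and> b \<in> filt_Z F d (r - 1) (k - r + 1) (l + r - 2)}"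

definition arises_from ::
  "(int \<Rightarrow> int \<Rightarrow> int \<Rightarrow> 'a::ab_group_add set monoid) \<Rightarrow> (int \<Rightarrow> int \<Rightarrow> int \<Rightarrow> 'a set \<Rightarrow> 'a set) \<Rightarrow>
   (int \<Rightarrow> int \<Rightarrow> 'a set) \<Rightarrow> ('a \<Rightarrow> 'a) \<Rightarrow> bool" where
  "arises_from E \<delta> F d \<longleftrightarrow> (\<forall>r \<ge> 1. \<forall>k l.
     E r k l = add_grp (filt_Z F d r k l) Mod filt_B F d r k l \<and>
     (\<forall>X \<in> carrier (E r k l). \<delta> r k l X = induced d (filt_B F d r (k + r) (l - r + 1)) X))"

text \<open>
  Convergence to \<open>H\<close> with respect to a finite filtration \<open>\<Phi>\<close>, \<open>\<Phi> k i\<close> being the \<open>k\<close>-th step in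
  \<open>H i\<close>: at each position the differentials eventually vanish, so that the pages become constant,
  and this \<open>E\<^sub>\<infinity>\<close>-term is the associated graded group.
\<close>

definition converges_to ::
  "(int \<Rightarrow> int \<Rightarrow> int \<Rightarrow> 'a monoid) \<Rightarrow> (int \<Rightarrow> int \<Rightarrow> int \<Rightarrow> 'a \<Rightarrow> 'a) \<Rightarrow>
   (int \<Rightarrow> 'b monoid) \<Rightarrow> (int \<Rightarrow> int \<Rightarrow> 'b set) \<Rightarrow> bool" where
  "converges_to E \<delta> H \<Phi> \<longleftrightarrow>
     (\<forall>i. F2_space (H i)) \<and>
     (\<forall>k i. subgroup (\<Phi> k i) (H i) \<and> \<Phi> (k + 1) i \<subseteq> \<Phi> k i) \<and>
     (\<forall>i. (\<exists>k. \<Phi> k i = carrier (H i)) \<and> (\<exists>k. \<Phi> k i = {\<one>\<^bsub>H i\<^esub>})) \<and>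
     (\<forall>k l. \<exists>r\<^sub>0 \<ge> 1. \<forall>r \<ge> r\<^sub>0.
        (\<forall>x \<in> carrier (E r k l). \<delta> r k l x = \<one>\<^bsub>E r (k + r) (l - r + 1)\<^esub>) \<and>
        (\<forall>x \<in> carrier (E r (k - r) (l + r - 1)). \<delta> r (k - r) (l + r - 1) x = \<one>\<^bsub>E r k l\<^esub>) \<and>
        E r k l \<cong> (H (k + l))\<lparr>carrier := \<Phi> k (k + l)\<rparr> Mod \<Phi> (k + 1) (k + l))"

end

theory Submission
  imports Defs
begin

text \<open>
  The filtration is by the \<open>q\<close>-grading in steps of 2, and \<open>d = \<partial> + \<beta>\<close>, where \<open>\<partial>\<close> keeps the
  \<open>q\<close>-grading and \<open>\<beta>\<close> raises it by 2, that is, by one filtration step. The associated graded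
  complex is therefore the Khovanov complex, \<open>E\<^sub>1\<close> is its homology, the differential \<open>d\<^sub>1\<close> is induced
  by \<open>\<beta>\<close>, and \<open>E\<^sub>2\<close> is the homology of \<open>\<beta>\<^sub>*\<close>. Convergence holds because the \<open>q\<close>-grading is
  bounded. This part is homological algebra. Each group that occurs is a subquotient \<open>Z / N\<close> of the
  chains, and \<open>presents\<close> records such a description; an isomorphism between two of them is then a
  statement about representatives (\<open>presents_iso\<close>). The inputs from topology are \<open>d\<^sup>2 = 0\<close> and the
  congruence of the \<open>q\<close>-grading with \<open>\<gamma>\<close> modulo 2, without which a quotient of consecutive
  filtration steps would consist of two gradings. The identities \<open>\<partial>\<^sup>2 = 0\<close>, \<open>\<partial>\<beta> + \<beta>\<partial> = 0\<close> and
  \<open>\<beta>\<^sup>2 = 0\<close> are the homogeneous parts of \<open>d\<^sup>2 = 0\<close>.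

  Both inputs depend on the fact that a change of one smoothing merges two circles or splits one. On
  a surface of positive genus it may also replace one circle by one other, so planarity is essential
  here. It enters through a source-sink orientation of the diagram: an orientation of the arcs for
  which incoming and outgoing ends alternate around each crossing. The obstruction to its existence is
  a class in the first cohomology with coefficients \<open>F\<^sub>2\<close>, and this group vanishes for a sphere; with
  the Euler characteristic as the definition of planarity, the vanishing is a dimension count
  (\<open>twist_is_coboundary\<close>). Both smoothings of a crossing respect a source-sink orientation, so the
  circles of each resolution are the cycles of a permutation of the arcs, and a change of smoothing
  multiplies it by a transposition (\<open>surgery\<close>). The same argument with the orientation of the link
  compares the components with the Seifert circles, which gives the parity of the \<open>q\<close>-grading.

  For \<open>d\<^sup>2 = 0\<close>, note that with \<open>u = 1\<close> the algebra has the orthogonal idempotents \<open>x\<close> and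
  \<open>1 + x\<close>, and \<open>\<Delta>\<close> sends each idempotent \<open>e\<close> to \<open>e \<otimes> e\<close>. A tensor product of idempotents
  over the circles of \<open>D\<^sub>\<alpha>\<close> is a function \<open>f\<close> on arcs which is constant on the circles, and the
  edge map to \<open>\<alpha>'\<close> keeps \<open>f\<close> if \<open>f\<close> is constant on the circles of \<open>D\<^sub>\<alpha>'\<close> too and kills it
  otherwise (\<open>edge_sum\<close>). If \<open>f\<close> is constant on circles at two opposite corners of a square of the
  cube, it is so at the other two corners, hence the two paths along the square cancel.
\<close>

section \<open>Subquotients and their presentations\<close>

definition add_subgroup :: "'a::ab_group_add set \<Rightarrow> bool" where
  "add_subgroup S \<longleftrightarrow> 0 \<in> S \<and> (\<forall>x\<in>S. \<forall>y\<in>S. x - y \<in> S)"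

lemma add_subgroup_zero: "add_subgroup S \<Longrightarrow> 0 \<in> S"
  by (simp add: add_subgroup_def)

lemma add_subgroup_diff: "add_subgroup S \<Longrightarrow> x \<in> S \<Longrightarrow> y \<in> S \<Longrightarrow> x - y \<in> S"
  by (simp add: add_subgroup_def)

lemma add_subgroup_uminus: "add_subgroup S \<Longrightarrow> x \<in> S \<Longrightarrow> - x \<in> S"
  using add_subgroup_diff[of S 0 x] add_subgroup_zero[of S] by simp

lemma add_subgroup_add: "add_subgroup S \<Longrightarrow> x \<in> S \<Longrightarrow> y \<in> S \<Longrightarrow> x + y \<in> S"
  using add_subgroup_diff[of S x "- y"] add_subgroup_uminus[of S y] by simp

lemma add_subgroup_image:
  assumes U: "add_subgroup U" and h: "\<And>x y. h (x + y) = h x + h y"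
  shows "add_subgroup (h ` U)"
  unfolding add_subgroup_def
proof (intro conjI ballI)
  have "h 0 = 0" using h[of 0 0] by simp
  then show "0 \<in> h ` U" using add_subgroup_zero[OF U] by (metis image_eqI)
  fix x y assume "x \<in> h ` U" "y \<in> h ` U"
  then obtain u v where uv: "u \<in> U" "v \<in> U" "x = h u" "y = h v" by blast
  have "h u = h (u - v) + h v" using h[of "u - v" v] by simp
  then have "x - y = h (u - v)" using uv by simp
  then show "x - y \<in> h ` U" using add_subgroup_diff[OF U uv(1,2)] by blast
qed

lemma comm_group_add_grp:
  assumes "add_subgroup S"
  shows "comm_group (add_grp S)"
proof (rule comm_groupI)
  fix x assume "x \<in> carrier (add_grp S)"
  then show "\<exists>y\<in>carrier (add_grp S). y \<otimes>\<^bsub>add_grp S\<^esub> x = \<one>\<^bsub>add_grp S\<^esub>"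
    using add_subgroup_uminus[OF assms, of x]
    by (auto simp: add_grp_def intro!: bexI[of _ "- x"])
qed (use assms in \<open>auto simp: add_grp_def algebra_simps add_subgroup_zero intro: add_subgroup_add\<close>)

text \<open>
  The group \<open>G\<close> is the subquotient \<open>Z / N\<close> of an ambient additive group, by the projection
  \<open>p\<close>. Representatives stay in the ambient group however often subquotients are formed; the
  secondary groups, for instance, consist of cosets of cosets of chains.
\<close>

definition presents ::
  "('a::ab_group_add \<Rightarrow> 'b) \<Rightarrow> 'a set \<Rightarrow> 'a set \<Rightarrow> ('b, 'c) monoid_scheme \<Rightarrow> bool" where
  "presents p Z N G \<longleftrightarrow> add_subgroup Z \<and> comm_group G \<and> p \<in> hom (add_grp Z) G \<and>
     p ` Z = carrier G \<and> N = {z \<in> Z. p z = \<one>\<^bsub>G\<^esub>}"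

lemma presents_group_hom: "presents p Z N G \<Longrightarrow> group_hom (add_grp Z) G p"
  by (simp add: presents_def group_hom_def group_hom_axioms_def comm_group_add_grp
      comm_group.axioms(2))

lemma presents_comm_group: "presents p Z N G \<Longrightarrow> comm_group G"
  by (simp add: presents_def)

lemma presents_carrier: "presents p Z N G \<Longrightarrow> carrier G = p ` Z"
  by (simp add: presents_def)

lemma presents_closed: "presents p Z N G \<Longrightarrow> z \<in> Z \<Longrightarrow> p z \<in> carrier G"
  by (auto simp: presents_def)

lemma presents_one_iff: "presents p Z N G \<Longrightarrow> z \<in> Z \<Longrightarrow> p z = \<one>\<^bsub>G\<^esub> \<longleftrightarrow> z \<in> N"
  by (auto simp: presents_def)

lemma presents_add:
  "presents p Z N G \<Longrightarrow> x \<in> Z \<Longrightarrow> y \<in> Z \<Longrightarrow> p (x + y) = p x \<otimes>\<^bsub>G\<^esub> p y"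
  by (auto simp: presents_def hom_def add_grp_def)

lemma presents_inv:
  assumes p: "presents p Z N G" and x: "x \<in> Z"
  shows "p (- x) = inv\<^bsub>G\<^esub> p x"
proof -
  interpret G: comm_group G using p by (rule presents_comm_group)
  have Z: "add_subgroup Z" using p by (simp add: presents_def)
  have "0 \<in> N"
    using group_hom.hom_one[OF presents_group_hom[OF p]] add_subgroup_zero[OF Z] p
    by (auto simp: add_grp_def presents_def)
  then have "p (- x) \<otimes>\<^bsub>G\<^esub> p x = \<one>\<^bsub>G\<^esub>"
    using presents_add[OF p add_subgroup_uminus[OF Z x] x] presents_one_iff[OF p, of 0]
      add_subgroup_zero[OF Z] by simp
  then show ?thesis
    using G.inv_equality presents_closed[OF p] x add_subgroup_uminus[OF Z x] by metis
qed

lemma presents_diff: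
  assumes p: "presents p Z N G" and x: "x \<in> Z" and y: "y \<in> Z"
  shows "p (x - y) = p x \<otimes>\<^bsub>G\<^esub> inv\<^bsub>G\<^esub> p y"
proof -
  have Z: "add_subgroup Z" using p by (simp add: presents_def)
  show ?thesis
    using presents_add[OF p x add_subgroup_uminus[OF Z y]] presents_inv[OF p y] by simp
qed

lemma presents_eq_iff:
  assumes p: "presents p Z N G" and x: "x \<in> Z" and y: "y \<in> Z"
  shows "p x = p y \<longleftrightarrow> x - y \<in> N"
proof -
  interpret G: comm_group G using p by (rule presents_comm_group)
  have Z: "add_subgroup Z" using p by (simp add: presents_def)
  have "x - y \<in> N \<longleftrightarrow> p x \<otimes>\<^bsub>G\<^esub> inv\<^bsub>G\<^esub> p y = \<one>\<^bsub>G\<^esub>"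
    using presents_one_iff[OF p add_subgroup_diff[OF Z x y]] presents_diff[OF p x y] by simp
  also have "\<dots> \<longleftrightarrow> p x = p y"
    using presents_closed[OF p x] presents_closed[OF p y]
    by (metis G.inv_closed G.inv_equality G.inv_inv G.r_inv)
  finally show ?thesis ..
qed

lemma presents_add_grp: "add_subgroup Z \<Longrightarrow> presents (\<lambda>z. z) Z {0} (add_grp Z)"
  using comm_group_add_grp[of Z]
  by (auto simp: presents_def add_grp_def hom_def add_subgroup_zero)

lemma presents_F2_space:
  assumes p: "presents p Z N G" and "\<And>z. z \<in> Z \<Longrightarrow> z + z = 0"
  shows "F2_space G"
  unfolding F2_space_def
proof (intro conjI ballI)
  show "comm_group G" using p by (rule presents_comm_group)
  have Z: "add_subgroup Z" using p by (simp add: presents_def)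
  fix x assume "x \<in> carrier G"
  then obtain z where z: "z \<in> Z" "x = p z" using presents_carrier[OF p] by auto
  have "p 0 = \<one>\<^bsub>G\<^esub>"
    using group_hom.hom_one[OF presents_group_hom[OF p]] by (simp add: add_grp_def)
  then show "x \<otimes>\<^bsub>G\<^esub> x = \<one>\<^bsub>G\<^esub>"
    using presents_add[OF p z(1) z(1)] assms(2)[OF z(1)] z(2) by simp
qed

text \<open>
  Subquotients of \<open>Z / N\<close> are subquotients of the ambient group: both subgroups are pulled back
  along \<open>p\<close>.
\<close>

lemma presents_subquotient:
  assumes p: "presents p Z N G" and H: "subgroup H G" and K: "subgroup K G" and HK: "H \<subseteq> K"
  shows "presents (\<lambda>z. H #>\<^bsub>G\<^esub> p z) {z \<in> Z. p z \<in> K} {z \<in> Z. p z \<in> H}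
    (G\<lparr>carrier := K\<rparr> Mod H)"
proof -
  interpret G: comm_group G using p by (rule presents_comm_group)
  have Z: "add_subgroup Z" using p by (simp add: presents_def)
  have GK: "comm_group (G\<lparr>carrier := K\<rparr>)"
    by (rule group.group_comm_groupI[OF G.subgroup_imp_group[OF K]])
      (use K in \<open>auto simp: G.m_comm subgroup.mem_carrier\<close>)
  interpret K: comm_group "G\<lparr>carrier := K\<rparr>" by (rule GK)
  have HsK: "subgroup H (G\<lparr>carrier := K\<rparr>)"
    using H HK K G.subgroup_incl by blast
  then have nH: "H \<lhd> G\<lparr>carrier := K\<rparr>" by (rule K.subgroup_imp_normal)
  have rc: "H #>\<^bsub>G\<lparr>carrier := K\<rparr>\<^esub> a = H #>\<^bsub>G\<^esub> a" for a by (simp add: r_coset_def)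
  have sub: "add_subgroup {z \<in> Z. p z \<in> K}"
    unfolding add_subgroup_def
  proof (intro conjI ballI)
    have "p 0 = \<one>\<^bsub>G\<^esub>"
      using group_hom.hom_one[OF presents_group_hom[OF p]] by (simp add: add_grp_def)
    then show "0 \<in> {z \<in> Z. p z \<in> K}"
      using K Z by (auto simp: add_subgroup_zero subgroup.one_closed)
    fix x y assume "x \<in> {z \<in> Z. p z \<in> K}" "y \<in> {z \<in> Z. p z \<in> K}"
    then show "x - y \<in> {z \<in> Z. p z \<in> K}"
      using presents_diff[OF p, of x y] K Z
      by (auto simp: add_subgroup_diff subgroup.m_closed subgroup.m_inv_closed)
  qed
  have hom: "(\<lambda>a. H #>\<^bsub>G\<^esub> a) \<in> hom (G\<lparr>carrier := K\<rparr>) (G\<lparr>carrier := K\<rparr> Mod H)"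
    using normal.r_coset_hom_Mod[OF nH] by (simp add: rc)
  have one: "(H #>\<^bsub>G\<^esub> a = H) = (a \<in> H)" if "a \<in> K" for a
    using K.coset_join1[of H a] K.coset_join2[of a H] HsK that by (auto simp: rc subgroup.subset)
  have img: "p ` {z \<in> Z. p z \<in> K} = K"
    using presents_carrier[OF p] subgroup.subset[OF K] by auto
  show ?thesis
    unfolding presents_def
  proof (intro conjI)
    show "(\<lambda>z. H #>\<^bsub>G\<^esub> p z) \<in> hom (add_grp {z \<in> Z. p z \<in> K}) (G\<lparr>carrier := K\<rparr> Mod H)"
    proof (rule homI)
      fix x assume "x \<in> carrier (add_grp {z \<in> Z. p z \<in> K})"
      then show "H #>\<^bsub>G\<^esub> p x \<in> carrier (G\<lparr>carrier := K\<rparr> Mod H)"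
        using hom_in_carrier[OF hom, of "p x"] by (simp add: add_grp_def)
    next
      fix x y assume "x \<in> carrier (add_grp {z \<in> Z. p z \<in> K})"
        "y \<in> carrier (add_grp {z \<in> Z. p z \<in> K})"
      then show "H #>\<^bsub>G\<^esub> p (x \<otimes>\<^bsub>add_grp {z \<in> Z. p z \<in> K}\<^esub> y) =
          (H #>\<^bsub>G\<^esub> p x) \<otimes>\<^bsub>G\<lparr>carrier := K\<rparr> Mod H\<^esub> (H #>\<^bsub>G\<^esub> p y)"
        using hom_mult[OF hom, of "p x" "p y"] presents_add[OF p, of x y]
        by (simp add: add_grp_def)
    qed
    show "(\<lambda>z. H #>\<^bsub>G\<^esub> p z) ` {z \<in> Z. p z \<in> K} = carrier (G\<lparr>carrier := K\<rparr> Mod H)"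
      using img by (simp add: carrier_FactGroup rc flip: image_image)
    show "{z \<in> Z. p z \<in> H} =
        {z \<in> {z \<in> Z. p z \<in> K}. H #>\<^bsub>G\<^esub> p z = \<one>\<^bsub>G\<lparr>carrier := K\<rparr> Mod H\<^esub>}"
      using one HK by auto
  qed (use sub K.abelian_FactGroup[OF HsK] in auto)
qed

lemma presents_Mod:
  assumes Z: "add_subgroup Z" and N: "add_subgroup N" and "N \<subseteq> Z"
  shows "presents (\<lambda>z. N #>\<^bsub>add_grp Z\<^esub> z) Z N (add_grp Z Mod N)"
proof -
  interpret Z: comm_group "add_grp Z" using Z by (rule comm_group_add_grp)
  have inv: "inv\<^bsub>add_grp Z\<^esub> x = - x" if "x \<in> Z" for x
    using presents_inv[OF presents_add_grp[OF Z] that] by simp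
  have "subgroup N (add_grp Z)"
    by (rule Z.subgroupI)
      (use assms inv in \<open>auto simp: add_grp_def subset_iff
        intro: add_subgroup_zero add_subgroup_uminus add_subgroup_add\<close>)
  moreover have "subgroup Z (add_grp Z)"
    using Z.subgroup_self by (simp add: add_grp_def)
  ultimately have "presents (\<lambda>z. N #>\<^bsub>add_grp Z\<^esub> z) {z \<in> Z. z \<in> Z} {z \<in> Z. z \<in> N}
      ((add_grp Z)\<lparr>carrier := Z\<rparr> Mod N)"
    using presents_subquotient[OF presents_add_grp[OF Z]] assms(3) by blast
  moreover have "(add_grp Z)\<lparr>carrier := Z\<rparr> = add_grp Z" by (simp add: add_grp_def)
  moreover have "{z \<in> Z. z \<in> N} = N" using assms(3) by auto
  ultimately show ?thesis by simp
qed

lemma presents_induced_hom: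
  assumes p: "presents p Z N G" and p': "presents p' Z' N' G'"
    and f: "\<And>x. x \<in> Z \<Longrightarrow> f x \<in> Z'" "\<And>x. x \<in> Z \<Longrightarrow> F (p x) = p' (f x)"
      "\<And>x y. f (x + y) = f x + f y"
  shows "F \<in> hom G G'"
proof (rule homI)
  fix a assume "a \<in> carrier G"
  then show "F a \<in> carrier G'"
    using presents_carrier[OF p] f presents_closed[OF p'] by auto
next
  fix a b assume "a \<in> carrier G" "b \<in> carrier G"
  then obtain x y where *: "x \<in> Z" "y \<in> Z" "a = p x" "b = p y"
    using presents_carrier[OF p] by auto
  have "x + y \<in> Z" using * p by (simp add: presents_def add_subgroup_add)
  then show "F (a \<otimes>\<^bsub>G\<^esub> b) = F a \<otimes>\<^bsub>G'\<^esub> F b"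
    using * f presents_add[OF p *(1,2)] presents_add[OF p', of "f x" "f y"] by metis
qed

text \<open>
  Representatives of a homology group are the \<open>z\<close> whose image \<open>g z\<close> is trivial in the target,
  and such a \<open>z\<close> represents zero if it comes from \<open>Z0\<close> up to an element of \<open>N1\<close>.
\<close>

lemma presents_homology:
  assumes p0: "presents p0 Z0 N0 G0" and p1: "presents p1 Z1 N1 G1"
    and p2: "presents p2 Z2 N2 G2"
    and f: "\<And>x. x \<in> Z0 \<Longrightarrow> f x \<in> Z1" "\<And>x. x \<in> Z0 \<Longrightarrow> F (p0 x) = p1 (f x)"
      "\<And>x y. f (x + y) = f x + f y"
    and g: "\<And>x. x \<in> Z1 \<Longrightarrow> g x \<in> Z2" "\<And>x. x \<in> Z1 \<Longrightarrow> Gm (p1 x) = p2 (g x)"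
      "\<And>x y. g (x + y) = g x + g y"
    and gf: "\<And>x. x \<in> Z0 \<Longrightarrow> g (f x) \<in> N2"
  shows "presents (\<lambda>z. (F ` carrier G0) #>\<^bsub>G1\<^esub> p1 z) {z \<in> Z1. g z \<in> N2}
    {z \<in> Z1. \<exists>y\<in>Z0. z - f y \<in> N1} (homology G0 F G1 Gm G2)"
proof -
  interpret G1: comm_group G1 using p1 by (rule presents_comm_group)
  interpret G0: comm_group G0 using p0 by (rule presents_comm_group)
  interpret G2: comm_group G2 using p2 by (rule presents_comm_group)
  have homF: "F \<in> hom G0 G1" by (rule presents_induced_hom[OF p0 p1 f])
  have homG: "Gm \<in> hom G1 G2" by (rule presents_induced_hom[OF p1 p2 g])
  interpret F: group_hom G0 G1 F by (unfold_locales) (rule homF)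
  interpret Gm: group_hom G1 G2 Gm by (unfold_locales) (rule homG)
  have sub: "subgroup (F ` carrier G0) G1" by (rule F.img_is_subgroup)
  have ker: "subgroup (kernel G1 G2 Gm) G1" by (rule Gm.subgroup_kernel)
  have 1: "F ` carrier G0 \<subseteq> kernel G1 G2 Gm"
    using presents_carrier[OF p0] f g gf presents_closed[OF p1]
    by (auto simp: kernel_def presents_one_iff[OF p2])
  have 2: "{z \<in> Z1. p1 z \<in> kernel G1 G2 Gm} = {z \<in> Z1. g z \<in> N2}"
    using presents_closed[OF p1] g presents_one_iff[OF p2] by (auto simp: kernel_def)
  have 3: "{z \<in> Z1. p1 z \<in> F ` carrier G0} = {z \<in> Z1. \<exists>y\<in>Z0. z - f y \<in> N1}"
    using presents_carrier[OF p0] f presents_eq_iff[OF p1] by (auto simp: image_iff)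
  show ?thesis
    using presents_subquotient[OF p1 sub ker 1] unfolding homology_def 2 3 .
qed

text \<open>
  Both groups are quotients of \<open>Z\<close> by \<open>N\<close>, the second one by way of \<open>h\<close>. In the
  applications \<open>h\<close> is an inclusion of representatives.
\<close>

lemma presents_iso:
  assumes p: "presents p Z N G" and p': "presents p' Z' N' G'"
    and h: "\<And>z. z \<in> Z \<Longrightarrow> h z \<in> Z'" "\<And>x y. x \<in> Z \<Longrightarrow> y \<in> Z \<Longrightarrow> h (x + y) = h x + h y"
    and ker: "\<And>z. z \<in> Z \<Longrightarrow> h z \<in> N' \<longleftrightarrow> z \<in> N"
    and surj: "\<And>z'. z' \<in> Z' \<Longrightarrow> \<exists>z\<in>Z. z' - h z \<in> N'"
  shows "G \<cong> G'"
proof -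
  interpret p: group_hom "add_grp Z" G p using p by (rule presents_group_hom)
  interpret p': group_hom "add_grp Z'" G' p' using p' by (rule presents_group_hom)
  have "p ` carrier (add_grp Z) = carrier G"
    using presents_carrier[OF p] by (simp add: add_grp_def)
  moreover have "kernel (add_grp Z) G p = N"
    using presents_one_iff[OF p] p by (auto simp: kernel_def add_grp_def presents_def)
  ultimately have 1: "add_grp Z Mod N \<cong> G" using p.FactGroup_iso by simp
  interpret q: group_hom "add_grp Z" G' "\<lambda>z. p' (h z)"
    by unfold_locales
      (use presents_add[OF p'] presents_closed[OF p'] h in \<open>auto simp: hom_def add_grp_def\<close>)
  have "(\<lambda>z. p' (h z)) ` carrier (add_grp Z) = carrier G'"
  proof -
    have "p' z' \<in> (\<lambda>z. p' (h z)) ` Z" if z': "z' \<in> Z'" for z'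
    proof -
      obtain z where "z \<in> Z" "z' - h z \<in> N'" using surj[OF z'] by auto
      then show ?thesis using presents_eq_iff[OF p' z' h(1)] by auto
    qed
    then show ?thesis
      using presents_carrier[OF p'] h(1) by (auto simp: add_grp_def)
  qed
  moreover have "kernel (add_grp Z) G' (\<lambda>z. p' (h z)) = N"
    using ker presents_one_iff[OF p'] h(1) p
    by (auto simp: kernel_def add_grp_def presents_def)
  ultimately have 2: "add_grp Z Mod N \<cong> G'" using q.FactGroup_iso by simp
  have "group (add_grp Z Mod N)"
    using p presents_Mod[of Z N] p.normal_kernel \<open>kernel (add_grp Z) G p = N\<close>
    by (metis normal.factorgroup_is_group)
  then show ?thesis using 1 2 by (metis group.iso_sym iso_trans)
qed

lemma induced_coset:
  assumes d: "\<And>x y. d (x + y) = d x + d y" and B: "add_subgroup B" and B': "add_subgroup B'"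
    and dB: "\<And>b. b \<in> B \<Longrightarrow> d b \<in> B'"
  shows "induced d B' (B #>\<^bsub>add_grp Z\<^esub> z) = B' #>\<^bsub>add_grp Z'\<^esub> d z"
proof -
  have "\<exists>b'\<in>B'. d (b + z) + c = b' + d z" if "b \<in> B" "c \<in> B'" for b c
    using that dB[of b] add_subgroup_add[OF B', of "d b" c]
    by (intro bexI[of _ "d b + c"]) (auto simp: d algebra_simps)
  moreover have "\<exists>x b. c + d z = d x + b \<and> (\<exists>h\<in>B. x = h + z) \<and> b \<in> B'" if "c \<in> B'" for c
    by (rule exI[of _ z], rule exI[of _ c])
      (use that add_subgroup_zero[OF B] in \<open>auto simp: algebra_simps intro!: bexI[of _ 0]\<close>)
  ultimately show ?thesis
    unfolding induced_def r_coset_def add_grp_def by auto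
qed

section \<open>The spectral sequence of a filtered complex\<close>

locale filtered_complex =
  fixes F :: "int \<Rightarrow> int \<Rightarrow> 'a::ab_group_add set" and d :: "'a \<Rightarrow> 'a"
  assumes d_add: "d (x + y) = d x + d y"
    and F_subgroup: "add_subgroup (F k i)"
    and F_step: "F (k + 1) i \<subseteq> F k i"
    and d_F: "x \<in> F k i \<Longrightarrow> d x \<in> F k (i + 1)"
    and d_d: "d (d x) = 0"
    and char_2: "x + x = (0::'a)"
begin

abbreviation Z where "Z \<equiv> filt_Z F d"
abbreviation B where "B \<equiv> filt_B F d"

lemma d_0: "d 0 = 0"
  using d_add[of 0 0] by simp

lemma d_diff: "d (x - y) = d x - d y"
  using d_add[of "x - y" y] by (simp add: algebra_simps)

lemma F_antimono: "k \<le> k' \<Longrightarrow> F k' i \<subseteq> F k i"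
proof (induction k' rule: int_ge_induct)
  case (step k')
  then show ?case using F_step[of k' i] by auto
qed auto

lemma F_mono: "x \<in> F k' i \<Longrightarrow> k \<le> k' \<Longrightarrow> x \<in> F k i"
  using F_antimono by blast

lemma Z_subgroup: "add_subgroup (Z r k l)"
  using F_subgroup by (auto simp: add_subgroup_def filt_Z_def d_0 d_diff)

lemma B_subgroup: "add_subgroup (B r k l)"
  unfolding add_subgroup_def
proof (intro conjI ballI)
  show "0 \<in> B r k l"
    using add_subgroup_zero[OF Z_subgroup] by (force simp: filt_B_def d_0 intro: exI[of _ 0])
  fix x y assume "x \<in> B r k l" "y \<in> B r k l"
  then obtain a b a' b' where "x = a + d b" "y = a' + d b'"
    and ab: "a \<in> Z (r - 1) (k + 1) (l - 1)" "b \<in> Z (r - 1) (k - r + 1) (l + r - 2)"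
      "a' \<in> Z (r - 1) (k + 1) (l - 1)" "b' \<in> Z (r - 1) (k - r + 1) (l + r - 2)"
    unfolding filt_B_def by blast
  then have "x - y = (a - a') + d (b - b')" by (simp add: d_diff)
  then show "x - y \<in> B r k l"
    unfolding filt_B_def using ab add_subgroup_diff[OF Z_subgroup] by blast
qed

lemma mem_Z: "z \<in> Z r k l \<longleftrightarrow> z \<in> F k (k + l) \<and> d z \<in> F (k + r) (k + l + 1)"
  by (simp add: filt_Z_def)

lemma mem_B: "z \<in> B r k l \<longleftrightarrow> (\<exists>a b. z = a + d b \<and> a \<in> F (k + 1) (k + l) \<and>
    d a \<in> F (k + r) (k + l + 1) \<and> b \<in> F (k - r + 1) (k + l - 1) \<and> d b \<in> F k (k + l))"
  unfolding filt_B_def filt_Z_def by (auto simp: algebra_simps)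

lemma B_subset_Z: "r \<ge> 1 \<Longrightarrow> B r k l \<subseteq> Z r k l"
  using F_mono[of _ "k + 1" "k + l" k]
  by (auto simp: mem_B mem_Z d_add d_d intro!: add_subgroup_add[OF F_subgroup])

lemma d_Z: "r \<ge> 1 \<Longrightarrow> z \<in> Z r k l \<Longrightarrow> d z \<in> Z r (k + r) (l - r + 1)"
  by (auto simp: mem_Z d_d algebra_simps intro: add_subgroup_zero[OF F_subgroup])

lemma d_B:
  assumes "r \<ge> 1" "z \<in> B r k l" shows "d z \<in> B r (k + r) (l - r + 1)"
proof -
  obtain a b where "z = a + d b" "a \<in> F (k + 1) (k + l)" "d a \<in> F (k + r) (k + l + 1)"
    using assms(2) by (auto simp: mem_B)
  then show ?thesis
    unfolding mem_B
    by (intro exI[of _ 0] exI[of _ a])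
      (auto simp: d_add d_d d_0 algebra_simps add_subgroup_zero[OF F_subgroup])
qed

definition E :: "int \<Rightarrow> int \<Rightarrow> int \<Rightarrow> 'a set monoid" where
  "E r k l = add_grp (Z r k l) Mod B r k l"

definition \<delta> :: "int \<Rightarrow> int \<Rightarrow> int \<Rightarrow> 'a set \<Rightarrow> 'a set" where
  "\<delta> r k l = induced d (B r (k + r) (l - r + 1))"

definition cls :: "int \<Rightarrow> int \<Rightarrow> int \<Rightarrow> 'a \<Rightarrow> 'a set" where
  "cls r k l z = B r k l #>\<^bsub>add_grp (Z r k l)\<^esub> z"

lemma E_presents: "r \<ge> 1 \<Longrightarrow> presents (cls r k l) (Z r k l) (B r k l) (E r k l)"
  unfolding E_def cls_def by (rule presents_Mod[OF Z_subgroup B_subgroup B_subset_Z])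

lemma \<delta>_cls: "r \<ge> 1 \<Longrightarrow> \<delta> r k l (cls r k l z) = cls r (k + r) (l - r + 1) (d z)"
  unfolding \<delta>_def cls_def by (rule induced_coset[OF d_add B_subgroup B_subgroup d_B])

lemma \<delta>_cls':
  assumes "r \<ge> 1"
  shows "\<delta> r (k - r) (l + r - 1) (cls r (k - r) (l + r - 1) z) = cls r k l (d z)"
  using \<delta>_cls[OF assms, of "k - r" "l + r - 1" z] by (simp add: algebra_simps)

lemma d_Z':
  assumes "r \<ge> 1" "z \<in> Z r (k - r) (l + r - 1)" shows "d z \<in> Z r k l"
  using d_Z[OF assms] by (simp add: algebra_simps)

lemma zero_in_B: "0 \<in> B r k l"
  by (rule add_subgroup_zero[OF B_subgroup])

lemma homology_E_presents:
  assumes r: "r \<ge> 1"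
  shows "presents
    (\<lambda>z. (\<delta> r (k - r) (l + r - 1) ` carrier (E r (k - r) (l + r - 1))) #>\<^bsub>E r k l\<^esub> cls r k l z)
    {z \<in> Z r k l. d z \<in> B r (k + r) (l - r + 1)}
    {z \<in> Z r k l. \<exists>y\<in>Z r (k - r) (l + r - 1). z - d y \<in> B r k l}
    (homology (E r (k - r) (l + r - 1)) (\<delta> r (k - r) (l + r - 1)) (E r k l) (\<delta> r k l)
         (E r (k + r) (l - r + 1)))"
  by (rule presents_homology[OF E_presents[OF r] E_presents[OF r] E_presents[OF r]
        d_Z'[OF r] \<delta>_cls'[OF r] d_add d_Z[OF r] \<delta>_cls[OF r] d_add])
    (simp_all add: d_d zero_in_B)

text \<open>
  The inclusion of \<open>Z\<^sub>r\<^sub>+\<^sub>1\<close> in \<open>Z\<^sub>r\<close> induces the isomorphism. It is onto: if \<open>d z\<close> lies in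
  \<open>B\<^sub>r\<close>, say \<open>d z = a + d b\<close>, then \<open>z - b\<close> is in \<open>Z\<^sub>r\<^sub>+\<^sub>1\<close> because \<open>d (z - b) = a\<close> has
  filtration \<open>k + r + 1\<close>, and \<open>b\<close> is in \<open>B\<^sub>r\<close>.
\<close>

lemma E_Suc_iso:
  assumes r: "r \<ge> 1"
  shows "E (r + 1) k l \<cong>
    homology (E r (k - r) (l + r - 1)) (\<delta> r (k - r) (l + r - 1)) (E r k l) (\<delta> r k l)
         (E r (k + r) (l - r + 1))"
proof -
  let ?Z = "{z \<in> Z r k l. d z \<in> B r (k + r) (l - r + 1)}"
  let ?N = "{z \<in> Z r k l. \<exists>y\<in>Z r (k - r) (l + r - 1). z - d y \<in> B r k l}"
  show ?thesis
  proof (rule presents_iso[OF E_presents homology_E_presents[OF r], where h = "\<lambda>z. z"])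
    show "r + 1 \<ge> 1" using r by simp
  next
    fix z assume z: "z \<in> Z (r + 1) k l"
    have "d z \<in> B r (k + r) (l - r + 1)"
      unfolding mem_B using z
      by (intro exI[of _ "d z"] exI[of _ 0])
        (auto simp: mem_Z d_0 d_d algebra_simps add_subgroup_zero[OF F_subgroup])
    moreover have "z \<in> Z r k l" using z by (auto simp: mem_Z intro: F_mono)
    ultimately show "z \<in> ?Z" by simp
    show "z \<in> ?N \<longleftrightarrow>
      z \<in> B (r + 1) k l"
    proof
      assume "z \<in> ?N"
      then obtain y a b where y: "y \<in> Z r (k - r) (l + r - 1)"
        and zy: "z - d y = a + d b" and ab: "a \<in> F (k + 1) (k + l)"
          "b \<in> F (k - r + 1) (k + l - 1)" "d b \<in> F k (k + l)"
        by (auto simp: mem_B)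
      have z': "z = a + d (b + y)" using zy by (simp add: d_add algebra_simps)
      have "d a = d z" by (simp add: z' d_add d_d)
      moreover have "b \<in> F (k - r) (k + l - 1)" using ab F_mono by simp
      moreover have "d y \<in> F k (k + l)" "y \<in> F (k - r) (k + l - 1)"
        using y by (auto simp: mem_Z algebra_simps)
      ultimately show "z \<in> B (r + 1) k l"
        unfolding mem_B using z ab
        by (intro exI[of _ a] exI[of _ "b + y"])
          (auto simp: z' mem_Z d_add algebra_simps intro: add_subgroup_add[OF F_subgroup])
    next
      assume "z \<in> B (r + 1) k l"
      then obtain a b where zab: "z = a + d b" and ab: "a \<in> F (k + 1) (k + l)"
        "d a \<in> F (k + (r + 1)) (k + l + 1)" "b \<in> F (k - (r + 1) + 1) (k + l - 1)"
        "d b \<in> F k (k + l)"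
        unfolding mem_B by blast
      have "b \<in> Z r (k - r) (l + r - 1)" using ab by (simp add: mem_Z algebra_simps)
      moreover have "z - d b \<in> B r k l"
        unfolding mem_B
        by (rule exI[of _ a], rule exI[of _ 0])
          (use ab in \<open>auto simp: zab d_0 add_subgroup_zero[OF F_subgroup] intro: F_mono\<close>)
      ultimately show "z \<in> ?N"
        using \<open>z \<in> Z r k l\<close> by blast
    qed
  next
    fix z assume "z \<in> ?Z"
    then obtain a b where z: "z \<in> Z r k l" and dz: "d z = a + d b"
      and ab: "a \<in> F (k + r + 1) (k + l + 1)" "b \<in> F (k + 1) (k + l)"
        "d b \<in> F (k + r) (k + l + 1)"
      by (auto simp: mem_B algebra_simps)
    have "d (z - b) = a" by (simp add: d_diff dz)
    then have 1: "z - b \<in> Z (r + 1) k l"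
      using z ab F_mono[OF ab(2)] by (auto simp: mem_Z algebra_simps add_subgroup_diff[OF F_subgroup])
    have b: "b \<in> B r k l"
      unfolding mem_B
      by (rule exI[of _ b], rule exI[of _ 0])
        (use ab in \<open>auto simp: d_0 add_subgroup_zero[OF F_subgroup] intro: F_mono\<close>)
    then have "b \<in> Z r k l" using B_subset_Z[OF r] by blast
    then show "\<exists>w\<in>Z (r + 1) k l.
        z - w \<in> ?N"
      using 1 b
      by (intro bexI[of _ "z - b"]) (auto simp: d_0 intro!: bexI[of _ 0] add_subgroup_zero[OF Z_subgroup])
  qed auto
qed

lemma spectral_sequence_E: "spectral_sequence E \<delta>"
  unfolding spectral_sequence_def
proof (intro allI impI conjI ballI)
  fix r k l :: int assume r: "r \<ge> 1"
  note P = E_presents[OF r]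
  show "F2_space (E r k l)" by (rule presents_F2_space[OF P char_2])
  show "\<delta> r k l \<in> hom (E r k l) (E r (k + r) (l - r + 1))"
  proof (rule homI)
    fix x assume "x \<in> carrier (E r k l)"
    then show "\<delta> r k l x \<in> carrier (E r (k + r) (l - r + 1))"
      using d_Z[OF r] by (auto simp: presents_carrier[OF P] \<delta>_cls[OF r])
  next
    fix x y assume "x \<in> carrier (E r k l)" "y \<in> carrier (E r k l)"
    then obtain a b where "x = cls r k l a" "y = cls r k l b" "a \<in> Z r k l" "b \<in> Z r k l"
      by (auto simp: presents_carrier[OF P])
    then show "\<delta> r k l (x \<otimes>\<^bsub>E r k l\<^esub> y) = \<delta> r k l x \<otimes>\<^bsub>E r (k + r) (l - r + 1)\<^esub> \<delta> r k l y"
      using d_Z[OF r] by (simp add: \<delta>_cls[OF r] d_add presents_add[OF P] flip: presents_add[OF P])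
  qed
  show "\<delta> r (k + r) (l - r + 1) (\<delta> r k l x) = \<one>\<^bsub>E r (k + 2 * r) (l - 2 * r + 2)\<^esub>"
    if x: "x \<in> carrier (E r k l)" for x
  proof -
    have eq: "k + r + r = k + 2 * r" "l - r + 1 - r + 1 = 2 + (l - 2 * r)"
      "l - 2 * r + 2 = 2 + (l - 2 * r)" by simp_all
    obtain z where "z \<in> Z r k l" "x = cls r k l z" using x by (auto simp: presents_carrier[OF P])
    then show ?thesis
      using presents_one_iff[OF P, of 0] zero_in_B add_subgroup_zero[OF Z_subgroup]
      by (simp add: \<delta>_cls[OF r] d_d eq del: one_FactGroup)
  qed
  show "E (r + 1) k l \<cong>
       homology (E r (k - r) (l + r - 1)) (\<delta> r (k - r) (l + r - 1)) (E r k l) (\<delta> r k l)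
         (E r (k + r) (l - r + 1))"
    by (rule E_Suc_iso[OF r])
qed

lemma arises_from_E: "arises_from E \<delta> F d"
  by (simp add: arises_from_def E_def \<delta>_def)

end

section \<open>Convergence\<close>

locale bounded_filtered_complex = filtered_complex F d
  for F :: "int \<Rightarrow> int \<Rightarrow> 'a::ab_group_add set" and d :: "'a \<Rightarrow> 'a" +
  fixes C :: "int \<Rightarrow> 'a set" and lo hi :: int
  assumes F_low: "k \<le> lo \<Longrightarrow> F k i = C i"
    and F_high: "k \<ge> hi \<Longrightarrow> F k i = {0}"
begin

definition H :: "int \<Rightarrow> 'a set monoid" where
  "H i = homology (add_grp (C (i - 1))) d (add_grp (C i)) d (add_grp (C (i + 1)))"

definition H_filt :: "int \<Rightarrow> int \<Rightarrow> 'a set set" where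
  "H_filt k i = induced (\<lambda>z. z) (d ` C (i - 1)) `
     carrier (homology (add_grp (F k (i - 1))) d (add_grp (F k i)) d (add_grp (F k (i + 1))))"

lemma C_subgroup: "add_subgroup (C i)"
  using F_subgroup[of lo i] F_low[of lo i] by simp

lemma d_C: "x \<in> C i \<Longrightarrow> d x \<in> C (i + 1)"
  using d_F[of x lo i] F_low[of lo] by simp

lemma F_subset_C: "F k i \<subseteq> C i"
  using F_antimono[of "min k lo" k i] F_low[of "min k lo" i] by simp

lemma boundaries_subgroup: "add_subgroup (d ` C i)"
  using C_subgroup d_add by (rule add_subgroup_image)

definition hcls :: "int \<Rightarrow> 'a \<Rightarrow> 'a set" where
  "hcls i z = (d ` C (i - 1)) #>\<^bsub>add_grp (C i)\<^esub> z"

lemma H_presents: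
  "presents (hcls i) {z \<in> C i. d z = 0} (d ` C (i - 1)) (H i)"
proof -
  have "presents (\<lambda>z. (d ` carrier (add_grp (C (i - 1)))) #>\<^bsub>add_grp (C i)\<^esub> z)
    {z \<in> C i. d z \<in> {0}} {z \<in> C i. \<exists>y\<in>C (i - 1). z - d y \<in> {0}} (H i)"
    unfolding H_def
    by (rule presents_homology[OF presents_add_grp presents_add_grp presents_add_grp])
      (use C_subgroup d_C[of _ "i - 1"] d_C[of _ i] d_d d_add in auto)
  moreover have "{z \<in> C i. \<exists>y\<in>C (i - 1). z - d y \<in> {0}} = d ` C (i - 1)"
    using d_C[of _ "i - 1"] by auto
  ultimately show ?thesis unfolding hcls_def[abs_def] by (simp add: add_grp_def)
qed

text \<open>
  The map from the homology of \<open>F k\<close> enlarges cosets of \<open>d (F k)\<close> to cosets of \<open>d C\<close>, so its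
  image consists of the classes of cycles in \<open>F k\<close>.
\<close>

lemma H_filt_eq: "H_filt k i = hcls i ` {z \<in> F k i. d z = 0}"
proof -
  have P: "presents (\<lambda>z. (d ` carrier (add_grp (F k (i - 1)))) #>\<^bsub>add_grp (F k i)\<^esub> z)
    {z \<in> F k i. d z \<in> {0}} {z \<in> F k i. \<exists>y\<in>F k (i - 1). z - d y \<in> {0}}
    (homology (add_grp (F k (i - 1))) d (add_grp (F k i)) d (add_grp (F k (i + 1))))"
    by (rule presents_homology[OF presents_add_grp presents_add_grp presents_add_grp])
      (use F_subgroup d_F[of _ k "i - 1"] d_F[of _ k i] d_d d_add in auto)
  have sub: "add_subgroup (d ` F k (i - 1))"
    using F_subgroup d_add by (rule add_subgroup_image)
  have "induced (\<lambda>z. z) (d ` C (i - 1)) ((d ` F k (i - 1)) #>\<^bsub>add_grp (F k i)\<^esub> z) = hcls i z" for z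
    unfolding hcls_def
    by (rule induced_coset[where d = "\<lambda>z. z"])
      (use sub boundaries_subgroup F_subset_C[of k "i - 1"] in auto)
  then show ?thesis
    unfolding H_filt_def presents_carrier[OF P] by (simp add: image_image add_grp_def)
qed

lemma H_filt_subgroup: "subgroup (H_filt k i) (H i)"
proof -
  interpret group_hom "add_grp {z \<in> C i. d z = 0}" "H i" "hcls i"
    by (rule presents_group_hom[OF H_presents])
  have "subgroup {z \<in> F k i. d z = 0} (add_grp {z \<in> C i. d z = 0})"
  proof (rule G.subgroupI)
    fix a assume a: "a \<in> {z \<in> F k i. d z = 0}"
    have "a \<in> {z \<in> C i. d z = 0}" using a F_subset_C by blast
    moreover have "add_subgroup {z \<in> C i. d z = 0}"
      using H_presents[of i] by (simp add: presents_def)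
    ultimately have "inv\<^bsub>add_grp {z \<in> C i. d z = 0}\<^esub> a = - a"
      using presents_inv[OF presents_add_grp] by metis
    then show "inv\<^bsub>add_grp {z \<in> C i. d z = 0}\<^esub> a \<in> {z \<in> F k i. d z = 0}"
      using a add_subgroup_uminus[OF F_subgroup, of a k i] d_diff[of 0 a] by (simp add: d_0)
  qed (use F_subset_C F_subgroup in \<open>auto simp: add_grp_def d_add d_0 
      intro: add_subgroup_zero add_subgroup_add intro!: exI[of _ 0]\<close>)
  then show ?thesis unfolding H_filt_eq by (rule subgroup_img_is_subgroup)
qed

lemma H_filt_decreasing: "H_filt (k + 1) i \<subseteq> H_filt k i"
  unfolding H_filt_eq using F_step by blast

lemma in_H_filt_iff:
  assumes "z \<in> C i" "d z = 0"
  shows "hcls i z \<in> H_filt k i \<longleftrightarrow> (\<exists>y\<in>C (i - 1). z - d y \<in> F k i)"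
proof
  assume "hcls i z \<in> H_filt k i"
  then obtain w where w: "w \<in> F k i" "d w = 0" "hcls i z = hcls i w"
    by (auto simp: H_filt_eq)
  then have "z - w \<in> d ` C (i - 1)"
    using assms F_subset_C by (subst presents_eq_iff[OF H_presents, symmetric]) auto
  then obtain y where "y \<in> C (i - 1)" "z - w = d y" by auto
  moreover from this have "z - d y = w" by (simp add: algebra_simps)
  ultimately show "\<exists>y\<in>C (i - 1). z - d y \<in> F k i" using w by blast
next
  assume "\<exists>y\<in>C (i - 1). z - d y \<in> F k i"
  then obtain y where y: "y \<in> C (i - 1)" "z - d y \<in> F k i" by blast
  have "hcls i z = hcls i (z - d y)"
    using assms y F_subset_C by (subst presents_eq_iff[OF H_presents]) (auto simp: d_diff d_d)
  then show "hcls i z \<in> H_filt k i" using y assms by (auto simp: H_filt_eq d_diff d_d)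
qed

lemma graded_H_presents:
  "presents (\<lambda>z. H_filt (k + 1) i #>\<^bsub>H i\<^esub> hcls i z)
    {z \<in> C i. d z = 0 \<and> (\<exists>y\<in>C (i - 1). z - d y \<in> F k i)}
    {z \<in> C i. d z = 0 \<and> (\<exists>y\<in>C (i - 1). z - d y \<in> F (k + 1) i)}
    ((H i)\<lparr>carrier := H_filt k i\<rparr> Mod H_filt (k + 1) i)"
proof -
  have eq: "{z \<in> {z \<in> C i. d z = 0}. hcls i z \<in> H_filt k i} =
      {z \<in> C i. d z = 0 \<and> (\<exists>y\<in>C (i - 1). z - d y \<in> F k i)}" for k
    using in_H_filt_iff by blast
  show ?thesis
    using presents_subquotient[OF H_presents[of i] H_filt_subgroup H_filt_subgroup H_filt_decreasing, of k]
    unfolding eq .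
qed

text \<open>
  For large \<open>r\<close>, boundedness turns the condition \<open>d z \<in> F (k + r)\<close> into \<open>d z = 0\<close> and
  removes the filtration condition on the chain \<open>b\<close> in \<open>a + d b \<in> B\<^sub>r\<close>. So \<open>Z\<^sub>r\<close> consists of
  the cycles in \<open>F k\<close>, and \<open>B\<^sub>r\<close> of those homologous to a cycle in \<open>F (k + 1)\<close>.
\<close>

lemma converges_to_H: "converges_to E \<delta> H H_filt"
  unfolding converges_to_def
proof (intro conjI allI)
  show "F2_space (H i)" for i by (rule presents_F2_space[OF H_presents char_2])
  show "subgroup (H_filt k i) (H i)" "H_filt (k + 1) i \<subseteq> H_filt k i" for k i
    by (rule H_filt_subgroup, rule H_filt_decreasing)
  show "\<exists>k. H_filt k i = carrier (H i)" for i
    by (rule exI[of _ lo]) (simp add: H_filt_eq F_low presents_carrier[OF H_presents])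
  show "\<exists>k. H_filt k i = {\<one>\<^bsub>H i\<^esub>}" for i
  proof (rule exI[of _ hi])
    have "hcls i 0 = \<one>\<^bsub>H i\<^esub>"
      using presents_one_iff[OF H_presents, of 0 i] add_subgroup_zero[OF C_subgroup]
        add_subgroup_zero[OF boundaries_subgroup] by (simp add: d_0)
    moreover have "{z \<in> F hi i. d z = 0} = {0}" by (auto simp: F_high d_0)
    ultimately show "H_filt hi i = {\<one>\<^bsub>H i\<^esub>}" by (simp add: H_filt_eq)
  qed
next
  fix k l
  let ?A = "{z \<in> C (k + l). d z = 0 \<and> (\<exists>y\<in>C (k + l - 1). z - d y \<in> F k (k + l))}"
  let ?B = "{z \<in> C (k + l). d z = 0 \<and> (\<exists>y\<in>C (k + l - 1). z - d y \<in> F (k + 1) (k + l))}"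
  \<comment> \<open>From here on \<open>F (k + r)\<close> is zero and \<open>F (k - r + 1)\<close> is everything.\<close>
  define r0 where "r0 = max 1 (max (hi - k) (k + 1 - lo))"
  show "\<exists>r\<^sub>0\<ge>1. \<forall>r\<ge>r\<^sub>0.
      (\<forall>x\<in>carrier (E r k l). \<delta> r k l x = \<one>\<^bsub>E r (k + r) (l - r + 1)\<^esub>) \<and>
      (\<forall>x\<in>carrier (E r (k - r) (l + r - 1)). \<delta> r (k - r) (l + r - 1) x = \<one>\<^bsub>E r k l\<^esub>) \<and>
      E r k l \<cong> (H (k + l))\<lparr>carrier := H_filt k (k + l)\<rparr> Mod H_filt (k + 1) (k + l)"
  proof (intro exI[of _ r0] conjI allI impI ballI)
    show "1 \<le> r0" by (simp add: r0_def)
    fix r assume "r0 \<le> r"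
    then have r: "r \<ge> 1" and high: "k + r \<ge> hi" and low: "k - r + 1 \<le> lo"
      by (auto simp: r0_def)
    note P = E_presents[OF r]
    have Zr: "Z r k l = {z \<in> F k (k + l). d z = 0}"
      using high by (auto simp: mem_Z F_high)
    have Br: "z \<in> B r k l \<longleftrightarrow> (\<exists>a b. z = a + d b \<and> a \<in> F (k + 1) (k + l) \<and> d a = 0 \<and>
        b \<in> C (k + l - 1) \<and> d b \<in> F k (k + l))" for z
      using high low by (simp add: mem_B F_high F_low)
    show "\<delta> r k l x = \<one>\<^bsub>E r (k + r) (l - r + 1)\<^esub>" if "x \<in> carrier (E r k l)" for x
    proof -
      obtain z where z: "z \<in> Z r k l" "x = cls r k l z"
        using \<open>x \<in> carrier (E r k l)\<close> by (auto simp: presents_carrier[OF P])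
      then show ?thesis
        using presents_one_iff[OF P, of 0] zero_in_B add_subgroup_zero[OF Z_subgroup] Zr
        by (simp add: \<delta>_cls[OF r])
    qed
    show "\<delta> r (k - r) (l + r - 1) x = \<one>\<^bsub>E r k l\<^esub>"
      if x: "x \<in> carrier (E r (k - r) (l + r - 1))" for x
    proof -
      obtain z where z: "z \<in> Z r (k - r) (l + r - 1)" "x = cls r (k - r) (l + r - 1) z"
        using x by (auto simp: presents_carrier[OF P])
      have "z \<in> C (k + l - 1)" "d z \<in> F k (k + l)"
        using z(1) F_subset_C by (auto simp: mem_Z algebra_simps)
      then have "d z \<in> B r k l"
        unfolding Br by (intro exI[of _ 0] exI[of _ z]) (auto simp: d_0 add_subgroup_zero[OF F_subgroup])
      then show ?thesis
        using presents_one_iff[OF P, of "d z"] d_Z'[OF r z(1)]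
        by (simp add: z(2) \<delta>_cls'[OF r])
    qed
    show "E r k l \<cong> (H (k + l))\<lparr>carrier := H_filt k (k + l)\<rparr> Mod H_filt (k + 1) (k + l)"
    proof (rule presents_iso[OF P graded_H_presents, where h = "\<lambda>z. z"])
      fix z assume z: "z \<in> Z r k l"
      have zC: "z \<in> C (k + l)" "d z = 0" "z \<in> F k (k + l)" using z Zr F_subset_C by auto
      then show "z \<in> ?A"
        using add_subgroup_zero[OF C_subgroup] by (auto simp: d_0 intro!: bexI[of _ 0])
      show "z \<in> ?B
          \<longleftrightarrow> z \<in> B r k l" (is "?L \<longleftrightarrow> ?R")
      proof
        assume ?L
        then obtain y where y: "y \<in> C (k + l - 1)" "z - d y \<in> F (k + 1) (k + l)" by auto
        have "d y = z - (z - d y)" by simp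
        then have "d y \<in> F k (k + l)"
          using add_subgroup_diff[OF F_subgroup zC(3) F_mono[OF y(2)]] by simp
        then show ?R
          unfolding Br using y zC
          by (intro exI[of _ "z - d y"] exI[of _ y]) (auto simp: d_diff d_d)
      next
        assume ?R
        then obtain a b where "z = a + d b" "a \<in> F (k + 1) (k + l)" "b \<in> C (k + l - 1)"
          unfolding Br by blast
        then show ?L using zC by (auto intro!: bexI[of _ b])
      qed
    next
      fix z assume "z \<in> ?A"
      then obtain y where z: "z \<in> C (k + l)" "d z = 0"
        and y: "y \<in> C (k + l - 1)" "z - d y \<in> F k (k + l)" by auto
      have "d y \<in> C (k + l)" using d_C[OF y(1)] by simp
      then show "\<exists>w\<in>Z r k l. z - w \<in>
          ?B"
        using z y add_subgroup_zero[OF F_subgroup]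
        by (intro bexI[of _ "z - d y"]) (auto simp: Zr d_diff d_d intro!: bexI[of _ y])
    qed simp
  qed
qed

end

section \<open>Splittings of the filtration\<close>

text \<open>
  Here \<open>G k\<close> is a complement of \<open>F (k + 1)\<close> in \<open>F k\<close>, and \<open>d\<close> is the sum of a map \<open>d0\<close> of
  degree 0 and a map \<open>b\<close> of degree 1 for the resulting grading.
\<close>

locale split_filtered_complex = filtered_complex F d
  for F :: "int \<Rightarrow> int \<Rightarrow> 'a::ab_group_add set" and d :: "'a \<Rightarrow> 'a" +
  fixes G :: "int \<Rightarrow> int \<Rightarrow> 'a set" and d0 b :: "'a \<Rightarrow> 'a"
  assumes G_subgroup: "add_subgroup (G k i)"
    and G_subset: "G k i \<subseteq> F k i"
    and G_disjoint: "x \<in> G k i \<Longrightarrow> x \<in> F (k + 1) i \<Longrightarrow> x = 0"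
    and F_split: "x \<in> F k i \<Longrightarrow> \<exists>q\<in>G k i. x - q \<in> F (k + 1) i"
    and d_split: "d x = d0 x + b x"
    and d0_add: "d0 (x + y) = d0 x + d0 y"
    and d0_G: "x \<in> G k i \<Longrightarrow> d0 x \<in> G k (i + 1)"
    and b_G: "x \<in> G k i \<Longrightarrow> b x \<in> G (k + 1) (i + 1)"
begin

lemma b_add: "b (x + y) = b x + b y"
proof -
  have "d0 x + d0 y + b (x + y) = d0 x + d0 y + (b x + b y)"
    using d_add[of x y] d_split d0_add by (metis add.assoc add.left_commute)
  then show ?thesis by simp
qed

lemma b_0: "b 0 = 0"
  using b_add[of 0 0] by simp

lemma G_split_unique:
  assumes "x \<in> G k i" "y \<in> G k i" "x - y \<in> F (k + 1) i"
  shows "x = y"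
  using G_disjoint[OF add_subgroup_diff[OF G_subgroup assms(1,2)] assms(3)] by simp

text \<open>
  The three terms are the components of \<open>d (d x)\<close> in the degrees \<open>k\<close>, \<open>k + 1\<close> and
  \<open>k + 2\<close>; each vanishes since it also lies in the next filtration step.
\<close>

lemma homogeneous_d_d:
  assumes x: "x \<in> G k i"
  shows "d0 (d0 x) = 0" "b (d0 x) + d0 (b x) = 0" "b (b x) = 0"
proof -
  have mem: "d0 (d0 x) \<in> G k (i + 1 + 1)" "b (d0 x) \<in> G (k + 1) (i + 1 + 1)"
    "d0 (b x) \<in> G (k + 1) (i + 1 + 1)" "b (b x) \<in> G (k + 1 + 1) (i + 1 + 1)"
    by (intro d0_G b_G x)+
  have sum: "d0 (d0 x) + (b (d0 x) + d0 (b x)) + b (b x) = 0"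
    using d_d[of x] by (simp add: d_split d0_add b_add algebra_simps)
  have 1: "b (d0 x) + d0 (b x) \<in> G (k + 1) (i + 1 + 1)"
    using mem add_subgroup_add[OF G_subgroup] by auto
  have "(b (d0 x) + d0 (b x)) + b (b x) \<in> F (k + 1) (i + 1 + 1)"
    using 1 mem(4) G_subset F_step[of "k + 1"] add_subgroup_add[OF F_subgroup] by blast
  moreover have "d0 (d0 x) = - ((b (d0 x) + d0 (b x)) + b (b x))"
    using sum by (simp only: eq_neg_iff_add_eq_0 add.assoc)
  ultimately show z: "d0 (d0 x) = 0"
    using G_disjoint[OF mem(1)] add_subgroup_uminus[OF F_subgroup] by metis
  have "b (d0 x) + d0 (b x) = - b (b x)"
    using sum z by (simp add: eq_neg_iff_add_eq_0)
  moreover have "b (b x) \<in> F (k + 1 + 1) (i + 1 + 1)"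
    using mem(4) G_subset by blast
  ultimately show z': "b (d0 x) + d0 (b x) = 0"
    using G_disjoint[OF 1] add_subgroup_uminus[OF F_subgroup] by metis
  show "b (b x) = 0" using sum z z' by simp
qed

definition K :: "int \<Rightarrow> int \<Rightarrow> 'a set monoid" where
  "K k i = homology (add_grp (G k (i - 1))) d0 (add_grp (G k i)) d0 (add_grp (G k (i + 1)))"

definition kcls :: "int \<Rightarrow> int \<Rightarrow> 'a \<Rightarrow> 'a set" where
  "kcls k i z = (d0 ` G k (i - 1)) #>\<^bsub>add_grp (G k i)\<^esub> z"

definition b_star :: "int \<Rightarrow> int \<Rightarrow> 'a set \<Rightarrow> 'a set" where
  "b_star k i = induced b (d0 ` G (k + 1) i)"

lemma K_presents:
  "presents (kcls k i) {z \<in> G k i. d0 z = 0} (d0 ` G k (i - 1)) (K k i)"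
proof -
  have "presents (\<lambda>z. (d0 ` carrier (add_grp (G k (i - 1)))) #>\<^bsub>add_grp (G k i)\<^esub> z)
    {z \<in> G k i. d0 z \<in> {0}} {z \<in> G k i. \<exists>y\<in>G k (i - 1). z - d0 y \<in> {0}} (K k i)"
    unfolding K_def
    by (rule presents_homology[OF presents_add_grp presents_add_grp presents_add_grp])
      (use G_subgroup d0_G[of _ k "i - 1"] d0_G[of _ k i] homogeneous_d_d(1)[of _ k "i - 1"]
        d0_add in auto)
  moreover have "{z \<in> G k i. \<exists>y\<in>G k (i - 1). z - d0 y \<in> {0}} = d0 ` G k (i - 1)"
    using d0_G[of _ k "i - 1"] by auto
  ultimately show ?thesis unfolding kcls_def[abs_def] by (simp add: add_grp_def)
qed

lemma d0_image_subgroup: "add_subgroup (d0 ` G k i)"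
  using G_subgroup d0_add by (rule add_subgroup_image)

lemma b_cycle:
  assumes "x \<in> G k i" "d0 x = 0" shows "d0 (b x) = 0"
  using homogeneous_d_d(2)[OF assms(1)] by (simp add: assms b_0)

lemma b_boundary:
  assumes "x \<in> d0 ` G k (i - 1)" shows "b x \<in> d0 ` G (k + 1) i"
proof -
  obtain y where y: "y \<in> G k (i - 1)" "x = d0 y" using assms by auto
  have "b x = - d0 (b y)"
    using homogeneous_d_d(2)[OF y(1)] y(2) by (simp add: eq_neg_iff_add_eq_0)
  moreover have "b y \<in> G (k + 1) i" using b_G[OF y(1)] by simp
  ultimately show ?thesis using add_subgroup_uminus[OF d0_image_subgroup] by auto
qed

lemma b_star_kcls: "b_star k i (kcls k i z) = kcls (k + 1) (i + 1) (b z)"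
  using induced_coset[of b "d0 ` G k (i - 1)" "d0 ` G (k + 1) i"] b_add d0_image_subgroup b_boundary
  unfolding b_star_def kcls_def by simp

definition K2 :: "int \<Rightarrow> int \<Rightarrow> 'a set set monoid" where
  "K2 k i = homology (K (k - 1) (i - 1)) (b_star (k - 1) (i - 1)) (K k i) (b_star k i)
     (K (k + 1) (i + 1))"

lemma K2_presents:
  "presents (\<lambda>z. (b_star (k - 1) (i - 1) ` carrier (K (k - 1) (i - 1))) #>\<^bsub>K k i\<^esub> kcls k i z)
    {z \<in> {z \<in> G k i. d0 z = 0}. b z \<in> d0 ` G (k + 1) i}
    {z \<in> {z \<in> G k i. d0 z = 0}. \<exists>y\<in>{z \<in> G (k - 1) (i - 1). d0 z = 0}. z - b y \<in> d0 ` G k (i - 1)}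
    (K2 k i)"
  unfolding K2_def
proof (rule presents_homology[OF K_presents K_presents, where f = b and g = b])
  show "presents (kcls (k + 1) (i + 1)) {z \<in> G (k + 1) (i + 1). d0 z = 0} (d0 ` G (k + 1) i)
     (K (k + 1) (i + 1))"
    using K_presents[of "k + 1" "i + 1"] by simp
  show "b_star (k - 1) (i - 1) (kcls (k - 1) (i - 1) x) = kcls k i (b x)" for x
    using b_star_kcls[of "k - 1" "i - 1" x] by simp
  fix x assume "x \<in> {z \<in> G (k - 1) (i - 1). d0 z = 0}"
  then show "b x \<in> {z \<in> G k i. d0 z = 0}" "b (b x) \<in> d0 ` G (k + 1) i"
    using b_G[of x "k - 1" "i - 1"] b_cycle[of x "k - 1" "i - 1"]
      homogeneous_d_d(3)[of x "k - 1" "i - 1"] add_subgroup_zero[OF d0_image_subgroup] by auto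
qed (use b_star_kcls b_add b_G b_cycle in auto)

lemma cycle_in_Z1: "q \<in> G k (k + l) \<Longrightarrow> d0 q = 0 \<Longrightarrow> q \<in> Z 1 k l"
  using b_G[of q k "k + l"] G_subset by (auto simp: mem_Z d_split)

lemma B1_iff:
  "z \<in> B 1 k l \<longleftrightarrow> (\<exists>a c. z = a + d c \<and> a \<in> F (k + 1) (k + l) \<and> c \<in> F k (k + l - 1))"
  using d_F[of _ "k + 1" "k + l"] d_F[of _ k "k + l - 1"] by (auto simp: mem_B)

lemma F_in_B1: "a \<in> F (k + 1) (k + l) \<Longrightarrow> a \<in> B 1 k l"
  unfolding B1_iff by (metis add.right_neutral d_0 add_subgroup_zero[OF F_subgroup])

text \<open>
  Among homogeneous elements, modulo higher filtration \<open>d\<close> is \<open>d0\<close>, so the boundaries of the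
  first page are those of \<open>d0\<close>.
\<close>

lemma homogeneous_B1_iff:
  assumes q: "q \<in> G k (k + l)"
  shows "q \<in> B 1 k l \<longleftrightarrow> q \<in> d0 ` G k (k + l - 1)"
proof
  assume "q \<in> B 1 k l"
  then obtain a c where ac: "q = a + d c" "a \<in> F (k + 1) (k + l)" "c \<in> F k (k + l - 1)"
    unfolding B1_iff by blast
  obtain c0 where c0: "c0 \<in> G k (k + l - 1)" "c - c0 \<in> F (k + 1) (k + l - 1)"
    using F_split[OF ac(3)] by blast
  have "q - d0 c0 = a + d (c - c0) + b c0"
    using ac by (simp add: d_diff d_split[of c0] algebra_simps)
  moreover have "b c0 \<in> F (k + 1) (k + l)" using b_G[OF c0(1)] G_subset by auto
  moreover have "d (c - c0) \<in> F (k + 1) (k + l)" using d_F[OF c0(2)] by simp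
  ultimately have "q - d0 c0 \<in> F (k + 1) (k + l)"
    using ac(2) add_subgroup_add[OF F_subgroup] by metis
  then have "q = d0 c0" using G_split_unique[OF q] d0_G[OF c0(1)] by simp
  then show "q \<in> d0 ` G k (k + l - 1)" using c0 by blast
next
  assume "q \<in> d0 ` G k (k + l - 1)"
  then obtain c where c: "c \<in> G k (k + l - 1)" "q = d0 c" by auto
  have "q = - b c + d c" by (simp add: d_split c)
  moreover have "b c \<in> F (k + 1) (k + l)" using b_G[OF c(1)] G_subset by auto
  ultimately show "q \<in> B 1 k l"
    unfolding B1_iff using c(1) G_subset add_subgroup_uminus[OF F_subgroup] by blast
qed

lemma Z1_split:
  assumes z: "z \<in> Z 1 k l"
  obtains q where "q \<in> G k (k + l)" "d0 q = 0" "z - q \<in> F (k + 1) (k + l)"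
proof -
  obtain q where q: "q \<in> G k (k + l)" "z - q \<in> F (k + 1) (k + l)"
    using F_split[of z k "k + l"] z by (auto simp: mem_Z)
  have "d0 q = d z - d (z - q) - b q" by (simp add: d_diff d_split[of q])
  moreover have "d z \<in> F (k + 1) (k + l + 1)" using z by (simp add: mem_Z)
  moreover have "b q \<in> F (k + 1) (k + l + 1)" using b_G[OF q(1)] G_subset by auto
  ultimately have "d0 q \<in> F (k + 1) (k + l + 1)"
    using d_F[OF q(2)] add_subgroup_diff[OF F_subgroup] by metis
  then have "d0 q = 0" using G_disjoint[OF d0_G[OF q(1)]] by simp
  then show thesis using that q by blast
qed

lemma E1_iso: "E 1 k l \<cong> K k (k + l)"
proof -
  have "K k (k + l) \<cong> E 1 k l"
  proof (rule presents_iso[OF K_presents E_presents, where h = "\<lambda>z. z"])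
    fix z assume "z \<in> Z 1 k l"
    then obtain q where "q \<in> G k (k + l)" "d0 q = 0" "z - q \<in> F (k + 1) (k + l)"
      by (rule Z1_split)
    then show "\<exists>w\<in>{z \<in> G k (k + l). d0 z = 0}. z - w \<in> B 1 k l"
      using F_in_B1 by blast
  qed (use cycle_in_Z1 homogeneous_B1_iff in auto)
  moreover have "group (K k (k + l))"
    using presents_comm_group[OF K_presents] by (rule comm_group.axioms(2))
  ultimately show ?thesis by (metis group.iso_sym)
qed

text \<open>
  Both sides are homology groups, of \<open>E\<^sub>1\<close> with the differential induced by \<open>d\<close> and of \<open>K\<close>
  with the one induced by \<open>b\<close>. On a homogeneous cycle \<open>q\<close> of \<open>d0\<close> the two agree,
  \<open>d q = b q\<close>, so the inclusion of homogeneous cycles that identifies \<open>K\<close> with \<open>E\<^sub>1\<close> also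
  identifies the homology groups.
\<close>

lemma E2_iso: "E 2 k l \<cong> K2 k (k + l)"
proof -
  let ?Z = "{z \<in> Z 1 k l. d z \<in> B 1 (k + 1) l}"
  let ?N = "{z \<in> Z 1 k l. \<exists>y\<in>Z 1 (k - 1) l. z - d y \<in> B 1 k l}"
  let ?Zk = "{z \<in> {z \<in> G k (k + l). d0 z = 0}. b z \<in> d0 ` G (k + 1) (k + l)}"
  let ?H = "homology (E 1 (k - 1) l) (\<delta> 1 (k - 1) l) (E 1 k l) (\<delta> 1 k l) (E 1 (k + 1) l)"
  have H: "presents
    (\<lambda>z. (\<delta> 1 (k - 1) l ` carrier (E 1 (k - 1) l)) #>\<^bsub>E 1 k l\<^esub> cls 1 k l z)
    ?Z ?N
    ?H"
    using homology_E_presents[of 1 k l] by simp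
  have dB: "d c \<in> B 1 (k + 1) l" if "c \<in> B 1 k l" for k c
    using d_B[of 1 c k l] that by simp
  have b_iff: "b q \<in> B 1 (k + 1) l \<longleftrightarrow> b q \<in> d0 ` G (k + 1) (k + l)" if "q \<in> G k (k + l)" for q
    using homogeneous_B1_iff[of "b q" "k + 1" l] b_G[OF that] by (simp add: add.commute add.left_commute)
  have iso: "K2 k (k + l) \<cong>
    ?H"
  proof (rule presents_iso[OF K2_presents H, where h = "\<lambda>z. z"])
    fix z assume "z \<in> ?Zk"
    then have z: "z \<in> G k (k + l)" "d0 z = 0" "b z \<in> d0 ` G (k + 1) (k + l)" by auto
    then show zZ: "z \<in> ?Z"
      using cycle_in_Z1 b_iff by (simp add: d_split)
    show "z \<in> ?N \<longleftrightarrow>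
       z \<in> {z \<in> {z \<in> G k (k + l). d0 z = 0}.
         \<exists>y\<in>{z \<in> G (k - 1) (k + l - 1). d0 z = 0}. z - b y \<in> d0 ` G k (k + l - 1)}"
      (is "?L \<longleftrightarrow> ?R")
    proof
      assume ?L
      then obtain y where y: "y \<in> Z 1 (k - 1) l" "z - d y \<in> B 1 k l" by auto
      obtain q where q: "q \<in> G (k - 1) (k - 1 + l)" "d0 q = 0"
        "y - q \<in> F (k - 1 + 1) (k - 1 + l)"
        by (rule Z1_split[OF y(1)])
      have "d (y - q) \<in> B 1 k l" using dB[OF F_in_B1[OF q(3)]] by simp
      then have "(z - d y) + d (y - q) \<in> B 1 k l"
        using y(2) add_subgroup_add[OF B_subgroup] by metis
      moreover have "(z - d y) + d (y - q) = z - b q"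
        using q(2) by (simp add: d_diff d_split[of q])
      moreover have "z - b q \<in> G k (k + l)"
        using z b_G[OF q(1)] add_subgroup_diff[OF G_subgroup] by (simp add: algebra_simps)
      ultimately have "z - b q \<in> d0 ` G k (k + l - 1)" using homogeneous_B1_iff by simp
      then show ?R using q z by (auto simp: algebra_simps)
    next
      assume ?R
      then obtain q where q: "q \<in> G (k - 1) (k - 1 + l)" "d0 q = 0"
          "z - b q \<in> d0 ` G k (k + l - 1)" by (auto simp: algebra_simps)
      have "z - b q \<in> G k (k + l)"
        using z b_G[OF q(1)] add_subgroup_diff[OF G_subgroup] by (simp add: algebra_simps)
      then have "z - d q \<in> B 1 k l"
        using homogeneous_B1_iff q by (simp add: d_split)
      then show ?L using cycle_in_Z1[OF q(1,2)] zZ by auto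
    qed
  next
    fix z assume z: "z \<in> ?Z"
    then obtain q where q: "q \<in> G k (k + l)" "d0 q = 0" "z - q \<in> F (k + 1) (k + l)"
      using Z1_split by blast
    have zq: "z - q \<in> B 1 k l" by (rule F_in_B1[OF q(3)])
    have "b q = d z - d (z - q)" using q(2) by (simp add: d_diff d_split[of q])
    then have "b q \<in> B 1 (k + 1) l"
      using z dB[OF zq] add_subgroup_diff[OF B_subgroup] by auto
    then have "b q \<in> d0 ` G (k + 1) (k + l)" using b_iff q by simp
    moreover have "z - q \<in> ?N"
      using zq B_subset_Z[of 1 k l] add_subgroup_zero[OF Z_subgroup]
      by (auto simp: d_0 intro!: bexI[of _ 0])
    ultimately show "\<exists>w\<in>?Zk.
        z - w \<in> ?N"
      using q by blast
  qed auto
  have "group (K2 k (k + l))"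
    using presents_comm_group[OF K2_presents] by (rule comm_group.axioms(2))
  then show ?thesis
    using E_Suc_iso[of 1 k l] iso by (simp add: group.iso_sym iso_trans)
qed

end

section \<open>Linear algebra over the field with two elements\<close>

(* Calculations are done in the additive group of bits; rewriting the ring operations to bitwise ones
   would hide its structure from the simplifier. *)
declare add_bit_eq_xor [simp del] mult_bit_eq_and [simp del]

lemma bit_add_self [simp]: "a + a = (0::bit)"
  by (cases a) simp_all

lemma bit_add_eq_0_iff: "a + b = 0 \<longleftrightarrow> a = b" for a b :: bit
  by (cases a; cases b) simp_all

lemma bit_fun_add_self: "f + f = 0" for f :: "'a \<Rightarrow> bit"
  by (simp add: fun_eq_iff)

lemma bit_fun_diff: "f - g = f + g" for f g :: "'a \<Rightarrow> bit"
  by (simp add: fun_eq_iff)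

lemma span_on_0: "f \<in> span_on S \<Longrightarrow> s \<notin> S \<Longrightarrow> f s = 0"
  unfolding span_on_def by blast

lemma span_onI: "(\<And>s. s \<notin> S \<Longrightarrow> f s = 0) \<Longrightarrow> f \<in> span_on S"
  unfolding span_on_def by blast

lemma span_on_subgroup: "add_subgroup (span_on S)"
  unfolding add_subgroup_def
proof (intro conjI ballI)
  show "0 \<in> span_on S" by (rule span_onI) simp
  show "f - g \<in> span_on S" if "f \<in> span_on S" "g \<in> span_on S" for f g
    by (rule span_onI) (simp add: span_on_0[OF that(1)] span_on_0[OF that(2)])
qed

lemma bij_betw_span_on_Pow: "bij_betw (\<lambda>f. {s. f s = 1}) (span_on S) (Pow S)"
proof (rule bij_betw_byWitness[where f' = "\<lambda>T s. of_bool (s \<in> T)"])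
  show "\<forall>f\<in>span_on S. (\<lambda>s. of_bool (s \<in> {s. f s = 1})) = f"
    by (auto simp: fun_eq_iff)
qed (auto simp: span_on_def)

lemma card_span_on: "finite S \<Longrightarrow> card (span_on S) = 2 ^ card S"
  using bij_betw_same_card[OF bij_betw_span_on_Pow[of S]] by (simp add: card_Pow)

lemma finite_span_on: "finite S \<Longrightarrow> finite (span_on S)"
  using bij_betw_finite[OF bij_betw_span_on_Pow[of S]] by simp

text \<open>
  The fibres over the image are cosets of the kernel.
\<close>

lemma card_image_kernel:
  fixes h :: "'a::ab_group_add \<Rightarrow> 'b::ab_group_add"
  assumes U: "add_subgroup U" "finite U" and h: "\<And>x y. h (x + y) = h x + h y"
  shows "card U = card (h ` U) * card {u \<in> U. h u = 0}"
proof -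
  have hd: "h (x - y) = h x - h y" for x y
    using h[of "x - y" y] by (simp add: algebra_simps)
  have fibre: "card {u \<in> U. h u = y} = card {u \<in> U. h u = 0}" if y: "y \<in> h ` U" for y
  proof -
    obtain v where v: "v \<in> U" "y = h v" using y by auto
    have "bij_betw (\<lambda>u. u - v) {u \<in> U. h u = y} {u \<in> U. h u = 0}"
      by (rule bij_betw_byWitness[where f' = "\<lambda>u. u + v"])
        (use v U in \<open>auto simp: hd h intro: add_subgroup_diff add_subgroup_add\<close>)
    then show ?thesis by (rule bij_betw_same_card)
  qed
  have "card U = (\<Sum>y\<in>h ` U. card {u \<in> U. h u = y})"
    using sum.image_gen[OF U(2), of "\<lambda>_. 1 :: nat" h] by simp
  also have "\<dots> = card (h ` U) * card {u \<in> U. h u = 0}"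
    using fibre by simp
  finally show ?thesis .
qed

lemma add_subgroup_extend:
  fixes t :: "'a \<Rightarrow> bit"
  assumes U: "add_subgroup U"
  shows "add_subgroup (U \<union> (+) t ` U)"
  unfolding add_subgroup_def
proof (intro conjI ballI)
  show "0 \<in> U \<union> (+) t ` U" using add_subgroup_zero[OF U] by blast
  fix x y assume x: "x \<in> U \<union> (+) t ` U" and y: "y \<in> U \<union> (+) t ` U"
  have eq: "(t + u) - (t + v) = u - v" "(t + u) - v = t + (u - v)" for u v
    by (rule add_diff_cancel_left, rule add_diff_eq[symmetric])
  have eq': "u - (t + v) = t + (u - v)" for u v
    unfolding bit_fun_diff by (rule add.left_commute)
  note diff = add_subgroup_diff[OF U]
  have 1: "x - y \<in> U \<union> (+) t ` U" if "x \<in> U" "y \<in> U"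
    by (rule UnI1, rule diff[OF that])
  have 2: "x - y \<in> U \<union> (+) t ` U" if "x \<in> U" "y = t + v" "v \<in> U" for v
    by (rule UnI2, rule image_eqI[OF _ diff[OF that(1,3)]], subst that(2), rule eq')
  have 3: "x - y \<in> U \<union> (+) t ` U" if "x = t + u" "u \<in> U" "y \<in> U" for u
    by (rule UnI2, rule image_eqI[OF _ diff[OF that(2,3)]], subst that(1), rule eq(2))
  have 4: "x - y \<in> U \<union> (+) t ` U" if "x = t + u" "u \<in> U" "y = t + v" "v \<in> U" for u v
    by (rule UnI1, subst that(1), subst that(3), subst eq(1), rule diff[OF that(2,4)])
  from x consider "x \<in> U" | u where "x = t + u" "u \<in> U" by blast
  then show "x - y \<in> U \<union> (+) t ` U"
  proof cases
    case x: 1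
    from y consider "y \<in> U" | v where "y = t + v" "v \<in> U" by blast
    then show ?thesis by cases (rule 1[OF x], assumption, rule 2[OF x])
  next
    case x: 2
    from y consider "y \<in> U" | v where "y = t + v" "v \<in> U" by blast
    then show ?thesis by cases (rule 3[OF x], assumption, rule 4[OF x])
  qed
qed

lemma card_extend:
  fixes t :: "'a \<Rightarrow> bit"
  assumes U: "add_subgroup U" "finite U" and t: "t \<notin> U"
  shows "card (U \<union> (+) t ` U) = 2 * card U"
proof -
  have False if "u \<in> U" "t + u \<in> U" for u
    using add_subgroup_diff[OF U(1) that(2,1)] t by simp
  then have "U \<inter> (+) t ` U = {}" by blast
  moreover have "card ((+) t ` U) = card U" by (rule card_image) (simp add: inj_on_def)
  ultimately show ?thesis using U(2) by (simp add: card_Un_disjoint)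
qed

definition sign_char :: "bit \<Rightarrow> int" where
  "sign_char b = (if b = 0 then 1 else -1)"

lemma sign_char_add: "sign_char (a + b) = sign_char a * sign_char b"
  by (cases a; cases b) (simp_all add: sign_char_def)

lemma sum_sign_char:
  fixes \<psi> :: "'a::ab_group_add \<Rightarrow> bit"
  assumes U: "add_subgroup U" and \<psi>: "\<And>x y. \<psi> (x + y) = \<psi> x + \<psi> y"
  shows "(\<Sum>u\<in>U. sign_char (\<psi> u)) = (if \<forall>u\<in>U. \<psi> u = 0 then int (card U) else 0)"
proof (cases "\<forall>u\<in>U. \<psi> u = 0")
  case False
  then obtain v where v: "v \<in> U" "\<psi> v = 1" by auto
  have "bij_betw (\<lambda>u. u + v) U U"
    by (rule bij_betw_byWitness[where f' = "\<lambda>u. u - v"])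
      (use v U in \<open>auto intro: add_subgroup_diff add_subgroup_add\<close>)
  then have "(\<Sum>u\<in>U. sign_char (\<psi> u)) = (\<Sum>u\<in>U. sign_char (\<psi> (u + v)))"
    by (rule sum.reindex_bij_betw[symmetric])
  also have "\<dots> = - (\<Sum>u\<in>U. sign_char (\<psi> u))"
    by (simp add: \<psi> sign_char_add v sign_char_def[of 1] sum_negf)
  finally have "(\<Sum>u\<in>U. sign_char (\<psi> u)) = 0" by simp
  then show ?thesis by (simp only: False if_False)
qed (simp add: sign_char_def)

text \<open>
  The dimensions of orthogonal subspaces add up to at most the dimension of the whole space. Let the
  sign of a pair of vectors be 1 if they are orthogonal and -1 otherwise. The sum of the signs over
  all \<open>u \<in> U\<close> and all vectors \<open>x\<close> is computed twice: for fixed \<open>x\<close> the sum over \<open>u\<close>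
  is \<open>|U|\<close> if \<open>x\<close> is orthogonal to \<open>U\<close> and 0 otherwise, while for fixed \<open>u\<close> only
  \<open>u = 0\<close> contributes.
\<close>

lemma card_orthogonal_le:
  assumes E: "finite E" and U: "add_subgroup U" "U \<subseteq> span_on E" and W: "W \<subseteq> span_on E"
    and orth: "\<And>u w. u \<in> U \<Longrightarrow> w \<in> W \<Longrightarrow> (\<Sum>e\<in>E. u e * w e) = 0"
  shows "card U * card W \<le> 2 ^ card E"
proof -
  define pair :: "('a \<Rightarrow> bit) \<Rightarrow> ('a \<Rightarrow> bit) \<Rightarrow> bit" where "pair u x = (\<Sum>e\<in>E. u e * x e)" for u x
  have add1: "pair (u + v) x = pair u x + pair v x" for u v x
    by (simp add: pair_def algebra_simps sum.distrib)
  have add2: "pair u (x + y) = pair u x + pair u y" for u x y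
    by (simp add: pair_def algebra_simps sum.distrib)
  have char1: "(\<Sum>u\<in>U. sign_char (pair u x)) = (if \<forall>u\<in>U. pair u x = 0 then int (card U) else 0)"
    for x by (rule sum_sign_char[OF U(1)]) (rule add1)
  have char2: "(\<Sum>x\<in>span_on E. sign_char (pair u x)) =
      (if \<forall>x\<in>span_on E. pair u x = 0 then int (card (span_on E :: ('a \<Rightarrow> bit) set)) else 0)" for u
    by (rule sum_sign_char[OF span_on_subgroup]) (rule add2)
  have fin: "finite (span_on E :: ('a \<Rightarrow> bit) set)" by (rule finite_span_on[OF E])
  have nondeg: "(\<forall>x\<in>span_on E. pair u x = 0) \<longleftrightarrow> u = 0" if u: "u \<in> U" for u
  proof
    assume *: "\<forall>x\<in>span_on E. pair u x = 0"
    show "u = 0"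
    proof (rule ext)
      fix e
      show "u e = 0 e"
      proof (cases "e \<in> E")
        case True
        have "pair u (\<lambda>e'. of_bool (e' = e)) = u e"
          using E True by (simp add: pair_def of_bool_def if_distrib cong: if_cong)
        moreover have "(\<lambda>e'. of_bool (e' = e)) \<in> span_on E" using True by (auto intro: span_onI)
        ultimately show ?thesis using * by auto
      next
        case False
        then show ?thesis using u U span_on_0[of u E e] by auto
      qed
    qed
  qed (simp add: pair_def)
  have "int (card W * card U) = (\<Sum>x\<in>W. int (card U))" by simp
  also have "\<dots> = (\<Sum>x\<in>W. \<Sum>u\<in>U. sign_char (pair u x))"
    using orth by (intro sum.cong refl) (simp add: char1 pair_def sign_char_def)
  also have "\<dots> \<le> (\<Sum>x\<in>span_on E. \<Sum>u\<in>U. sign_char (pair u x))"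
    by (rule sum_mono2[OF fin W]) (simp add: char1)
  also have "\<dots> = (\<Sum>u\<in>U. \<Sum>x\<in>span_on E. sign_char (pair u x))" by (rule sum.swap)
  also have "\<dots> = (\<Sum>u\<in>U. if u = 0 then 2 ^ card E else 0)"
    by (intro sum.cong refl)
      (simp add: char2 nondeg card_span_on[OF E])
  also have "\<dots> = 2 ^ card E"
    using finite_subset[OF U(2) fin] add_subgroup_zero[OF U(1)] by simp
  finally have "int (card U * card W) \<le> int (2 ^ card E)" by (simp add: mult.commute)
  then show ?thesis by (simp only: of_nat_le_iff)
qed

section \<open>Equivalence relations generated by pairs\<close>

abbreviation eqcl :: "('a \<times> 'a) set \<Rightarrow> ('a \<times> 'a) set" where
  "eqcl R \<equiv> (R \<union> R\<inverse>)\<^sup>*"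

lemma eqcl_sym: "(a, b) \<in> eqcl R \<Longrightarrow> (b, a) \<in> eqcl R"
  using sym_rtrancl[OF sym_Un_converse, of R] by (auto dest: symD)

lemma eqcl_trans:
  "(a, b) \<in> eqcl R \<Longrightarrow> (b, c) \<in> eqcl R \<Longrightarrow> (a, c) \<in> eqcl R"
  by (rule rtrancl_trans)

lemma eqcl_class_eq: "(a, b) \<in> eqcl R \<Longrightarrow> eqcl R `` {a} = eqcl R `` {b}"
  by (auto intro: eqcl_trans dest: eqcl_sym)

lemma eqcl_const:
  assumes "(a, b) \<in> eqcl R" "\<And>x y. (x, y) \<in> R \<Longrightarrow> f x = f y"
  shows "f a = f b"
  using assms(1) by induction (use assms(2) in auto)

lemma eqcl_subset:
  assumes "R \<subseteq> A \<times> A" "(a, b) \<in> eqcl R" "a \<in> A"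
  shows "b \<in> A"
  using assms(2,3) by induction (use assms(1) in auto)

lemma generated_classes_eq: "generated_classes A R = (\<lambda>a. eqcl R `` {a}) ` A"
  by (auto simp: generated_classes_def quotient_def)

definition constant_functions :: "'a set \<Rightarrow> ('a \<times> 'a) set \<Rightarrow> ('a \<Rightarrow> bit) set" where
  "constant_functions A R = {f \<in> span_on A. \<forall>(a, b) \<in> R. f a = f b}"

lemma constant_functions_subgroup: "add_subgroup (constant_functions A R)"
  using span_on_subgroup[of A] by (fastforce simp: constant_functions_def add_subgroup_def)

lemma finite_constant_functions: "finite A \<Longrightarrow> finite (constant_functions A R)"
  using finite_span_on[of A] by (simp add: constant_functions_def)

text \<open>
  Numbers of equivalence classes become dimensions, which is how the Euler characteristic enters the
  linear algebra.
\<close>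

lemma card_constant_functions:
  assumes A: "finite A" and R: "R \<subseteq> A \<times> A"
  shows "card (constant_functions A R) = 2 ^ card (generated_classes A R)"
proof -
  let ?K = "generated_classes A R" and ?F = "constant_functions A R"
  let ?cl = "\<lambda>a. eqcl R `` {a}"
  define \<Phi> where "\<Phi> g = (\<lambda>a. if a \<in> A then g (?cl a) else 0)" for g :: "'a set \<Rightarrow> bit"
  have "inj_on \<Phi> (span_on (?K))"
  proof (rule inj_onI, rule ext)
    fix g h X assume g: "g \<in> span_on (?K)"
      and h: "h \<in> span_on (?K)" and eq: "\<Phi> g = \<Phi> h"
    show "g X = h X"
    proof (cases "X \<in> ?K")
      case True
      then obtain a where "a \<in> A" "X = ?cl a" by (auto simp: generated_classes_eq)
      then show ?thesis using fun_cong[OF eq, of a] by (simp add: \<Phi>_def)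
    qed (use g h span_on_0 in metis)
  qed
  moreover have "\<Phi> ` span_on (?K) = ?F"
  proof (intro equalityI subsetI)
    fix f assume "f \<in> \<Phi> ` span_on (?K)"
    then obtain g where f: "f = \<Phi> g" by auto
    show "f \<in> ?F"
      unfolding constant_functions_def
    proof (intro CollectI conjI ballI)
      show "f \<in> span_on A" by (auto simp: f \<Phi>_def intro: span_onI)
      fix x assume "x \<in> R"
      then obtain a b where x: "x = (a, b)" "(a, b) \<in> R" "a \<in> A" "b \<in> A" using R by auto
      then have "?cl a = ?cl b" by (intro eqcl_class_eq) auto
      then show "case x of (a, b) \<Rightarrow> f a = f b" using x by (simp add: f \<Phi>_def)
    qed
  next
    fix f assume f: "f \<in> ?F"
    define g where "g X = (if X \<in> ?K then f (SOME a. a \<in> X) else 0)" for X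
    have "f = \<Phi> g"
    proof
      fix a
      show "f a = \<Phi> g a"
      proof (cases "a \<in> A")
        case True
        have "(SOME b. b \<in> ?cl a) \<in> ?cl a" by (rule someI[of _ a]) auto
        then have "f a = f (SOME b. b \<in> ?cl a)"
          using f by (intro eqcl_const[of a _ R f]) (auto simp: constant_functions_def)
        then show ?thesis using True by (auto simp: \<Phi>_def g_def generated_classes_eq)
      qed (use f in \<open>auto simp: \<Phi>_def constant_functions_def span_on_0\<close>)
    qed
    moreover have "g \<in> span_on (?K)" by (rule span_onI) (simp add: g_def)
    ultimately show "f \<in> \<Phi> ` span_on (?K)" by blast
  qed
  ultimately have "card (?F) = card (span_on (?K) :: ('a set \<Rightarrow> bit) set)"
    by (metis card_image)
  then show ?thesis using A by (simp add: card_span_on generated_classes_eq)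
qed

section \<open>Arcs and darts of a link diagram\<close>

lemma length_concat_pairs: "length (concat (map (\<lambda>x. [f x, g x]) xs)) = 2 * length xs"
  by (induction xs) auto

lemma nth_concat_pairs:
  assumes "r < length xs"
  shows "concat (map (\<lambda>x. [f x, g x]) xs) ! (2 * r) = f (xs ! r)"
    "concat (map (\<lambda>x. [f x, g x]) xs) ! (2 * r + 1) = g (xs ! r)"
  using assms by (induction xs arbitrary: r) (auto simp: nth_Cons split: nat.splits)

lemma distinct_concat_pairs:
  assumes "distinct (concat (map (\<lambda>x. [f x, g x]) xs))" "r < length xs" "s < length xs"
  shows "f (xs ! r) = f (xs ! s) \<longleftrightarrow> r = s" "g (xs ! r) = g (xs ! s) \<longleftrightarrow> r = s"
    "f (xs ! r) \<noteq> g (xs ! s)"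
proof -
  let ?l = "concat (map (\<lambda>x. [f x, g x]) xs)"
  have eq: "?l ! i = ?l ! j \<longleftrightarrow> i = j" if "i < 2 * length xs" "j < 2 * length xs" for i j
    using nth_eq_iff_index_eq[OF assms(1)] that by (simp add: length_concat_pairs)
  show "f (xs ! r) = f (xs ! s) \<longleftrightarrow> r = s"
    using eq[of "2 * r" "2 * s"] assms by (simp add: nth_concat_pairs)
  show "g (xs ! r) = g (xs ! s) \<longleftrightarrow> r = s"
    using eq[of "2 * r + 1" "2 * s + 1"] assms nth_concat_pairs(2)[of _ xs f g] by simp
  have "2 * r \<noteq> 2 * s + 1" by presburger
  then show "f (xs ! r) \<noteq> g (xs ! s)"
    using eq[of "2 * r" "2 * s + 1"] assms nth_concat_pairs[of _ xs f g] by simp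
qed

locale link_diag =
  fixes D :: diagram
  assumes link_diagram: "link_diagram D"
begin

abbreviation n where "n \<equiv> length (crossings D)"
abbreviation X where "X r \<equiv> crossings D ! r"
abbreviation ins where "ins \<equiv> concat (map (\<lambda>x. [under_in x, over_in x]) (crossings D))"
abbreviation outs where "outs \<equiv> concat (map (\<lambda>x. [under_out x, over_out x]) (crossings D))"

lemma distinct_ins: "distinct ins" and distinct_outs: "distinct outs"
  and ins_outs: "set ins = set outs" and ins_arcs: "set ins \<subseteq> arcs D"
  and finite_arcs: "finite (arcs D)" and planar: "planar D"
  using link_diagram unfolding link_diagram_def Let_def by blast+

lemma ins_eq:
  assumes "r < n" "s < n"
  shows "under_in (X r) = under_in (X s) \<longleftrightarrow> r = s" "over_in (X r) = over_in (X s) \<longleftrightarrow> r = s"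
    "under_in (X r) \<noteq> over_in (X s)" "over_in (X r) \<noteq> under_in (X s)"
  using distinct_concat_pairs[OF distinct_ins assms]
    distinct_concat_pairs(3)[OF distinct_ins assms(2,1)] by simp_all

lemma outs_eq:
  assumes "r < n" "s < n"
  shows "under_out (X r) = under_out (X s) \<longleftrightarrow> r = s" "over_out (X r) = over_out (X s) \<longleftrightarrow> r = s"
    "under_out (X r) \<noteq> over_out (X s)" "over_out (X r) \<noteq> under_out (X s)"
  using distinct_concat_pairs[OF distinct_outs assms]
    distinct_concat_pairs(3)[OF distinct_outs assms(2,1)] by simp_all

lemma set_ins: "set ins = (\<Union>r<n. {under_in (X r), over_in (X r)})"
  by (force simp: in_set_conv_nth image_iff)

lemma set_outs: "set outs = (\<Union>r<n. {under_out (X r), over_out (X r)})"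
  by (force simp: in_set_conv_nth image_iff)

abbreviation arc where "arc \<equiv> dart_arc D"

definition incoming :: "nat \<times> nat \<Rightarrow> bool" where
  "incoming = (\<lambda>(r, p). p = 0 \<or> p = (if positive (X r) then 3 else 1))"

lemma less_4_cases: "p < 4 \<Longrightarrow> p = 0 \<or> p = Suc 0 \<or> p = 2 \<or> p = (3::nat)"
  by auto

lemma arc_simps:
  "arc (r, 0) = under_in (X r)"
  "arc (r, Suc 0) = (if positive (X r) then over_out (X r) else over_in (X r))"
  "arc (r, 2) = under_out (X r)"
  "arc (r, 3) = (if positive (X r) then over_in (X r) else over_out (X r))"
  by (simp_all add: dart_arc_def ccw_def numeral_2_eq_2 numeral_3_eq_3)

lemma arc_of_incoming:
  "incoming (r, p) \<Longrightarrow> arc (r, p) = (if p = 0 then under_in (X r) else over_in (X r))"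
  by (auto simp: incoming_def arc_simps split: if_splits)

lemma arc_of_outgoing:
  assumes "\<not> incoming (r, p)" "p < 4"
  shows "arc (r, p) = (if p = 2 then under_out (X r) else over_out (X r))"
  using assms(1) less_4_cases[OF assms(2)]
  by (elim disjE) (auto simp: incoming_def arc_simps split: if_splits)

lemma arc_inj:
  assumes "d \<in> darts D" "d' \<in> darts D" "arc d = arc d'" "incoming d \<longleftrightarrow> incoming d'"
  shows "d = d'"
proof -
  obtain r p r' p' where d: "d = (r, p)" "d' = (r', p')" by (cases d; cases d')
  have lt: "r < n" "r' < n" "p < 4" "p' < 4" using assms(1,2) d by (auto simp: darts_def)
  show ?thesis
  proof (cases "incoming d")
    case True
    then have inc: "incoming (r, p)" "incoming (r', p')" using assms(4) d by simp_all
    have "r = r' \<and> (p = 0 \<longleftrightarrow> p' = 0)"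
      using assms(3) ins_eq[OF lt(1,2)]
      unfolding d arc_of_incoming[OF inc(1)] arc_of_incoming[OF inc(2)] by presburger
    then show ?thesis using inc unfolding d incoming_def by auto
  next
    case False
    then have out: "\<not> incoming (r, p)" "\<not> incoming (r', p')" using assms(4) d by simp_all
    have "r = r' \<and> (p = 2 \<longleftrightarrow> p' = 2)"
      using assms(3) outs_eq[OF lt(1,2)]
      unfolding d arc_of_outgoing[OF out(1) lt(3)] arc_of_outgoing[OF out(2) lt(4)] by presburger
    then show ?thesis
      using out less_4_cases[OF lt(3)] less_4_cases[OF lt(4)] unfolding d incoming_def
      by (auto split: if_splits)
  qed
qed

lemma arc_incoming_image: "arc ` {d \<in> darts D. incoming d} = set ins"
proof -
  have "{d \<in> darts D. incoming d} = (\<Union>r<n. {(r, 0), (r, if positive (X r) then 3 else Suc 0)})"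
    by (auto simp: darts_def incoming_def split: if_splits)
  moreover have "arc ` {(r, 0), (r, if positive (X r) then 3 else Suc 0)} =
      {under_in (X r), over_in (X r)}" for r
    by (simp add: arc_simps)
  ultimately show ?thesis by (simp only: set_ins image_UN)
qed

lemma arc_outgoing_image: "arc ` {d \<in> darts D. \<not> incoming d} = set outs"
proof -
  have "{d \<in> darts D. \<not> incoming d} = (\<Union>r<n. {(r, 2), (r, if positive (X r) then Suc 0 else 3)})"
    by (auto simp: darts_def incoming_def split: if_splits dest!: less_4_cases)
  moreover have "arc ` {(r, 2), (r, if positive (X r) then Suc 0 else 3)} =
      {under_out (X r), over_out (X r)}" for r
    by (simp add: arc_simps)
  ultimately show ?thesis by (simp only: set_outs image_UN)
qed

text \<open>
  An arc which meets a crossing has exactly two ends, one where it enters a crossing and one where it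
  leaves one.
\<close>

lemma other_dart_unique:
  assumes "d \<in> darts D"
  shows "\<exists>!d'. d' \<in> darts D \<and> d' \<noteq> d \<and> arc d' = arc d"
proof -
  have "\<exists>d'\<in>darts D. (incoming d' \<longleftrightarrow> \<not> incoming d) \<and> arc d' = arc d"
  proof (cases "incoming d")
    case True
    then have "arc d \<in> arc ` {d \<in> darts D. \<not> incoming d}"
      using assms arc_incoming_image arc_outgoing_image ins_outs by blast
    then show ?thesis using True by auto
  next
    case False
    then have "arc d \<in> arc ` {d \<in> darts D. incoming d}"
      using assms arc_incoming_image arc_outgoing_image ins_outs by blast
    then show ?thesis using False by auto
  qed
  then obtain d' where d': "d' \<in> darts D" "incoming d' \<longleftrightarrow> \<not> incoming d" "arc d' = arc d" by auto
  show ?thesis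
  proof (rule ex1I[of _ d'])
    show "d' \<in> darts D \<and> d' \<noteq> d \<and> arc d' = arc d" using d' by auto
    fix e assume "e \<in> darts D \<and> e \<noteq> d \<and> arc e = arc d"
    then show "e = d'" using d' assms arc_inj[of e d] arc_inj[of e d'] by auto
  qed
qed

definition opp :: "nat \<times> nat \<Rightarrow> nat \<times> nat" where
  "opp d = (THE d'. d' \<in> darts D \<and> d' \<noteq> d \<and> arc d' = arc d)"

lemma opp:
  assumes "d \<in> darts D" shows "opp d \<in> darts D" "opp d \<noteq> d" "arc (opp d) = arc d"
  using theI'[OF other_dart_unique[OF assms]] unfolding opp_def by auto

lemma opp_eq: "d \<in> darts D \<Longrightarrow> d' \<in> darts D \<Longrightarrow> d' \<noteq> d \<Longrightarrow> arc d' = arc d \<Longrightarrow> opp d = d'"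
  unfolding opp_def using other_dart_unique[of d] by (intro the1_equality) auto

lemma opp_opp: "d \<in> darts D \<Longrightarrow> opp (opp d) = d"
  using opp[of d] opp_eq[of "opp d" d] by metis

lemma darts_of_arc: "d \<in> darts D \<Longrightarrow> {d' \<in> darts D. arc d' = arc d} = {d, opp d}"
  using opp opp_eq by blast

lemma finite_darts: "finite (darts D)"
  by (simp add: darts_def)

definition rot :: "nat \<times> nat \<Rightarrow> nat \<times> nat" where
  "rot = (\<lambda>(r, p). (r, Suc p mod 4))"

lemma rot_bij: "bij_betw rot (darts D) (darts D)"
proof (rule bij_betw_byWitness[where f' = "\<lambda>(r, p). (r, (p + 3) mod 4)"])
  show "\<forall>a\<in>darts D. (case rot a of (r, p) \<Rightarrow> (r, (p + 3) mod 4)) = a"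
    by (auto simp: rot_def darts_def dest!: less_4_cases)
  show "\<forall>a'\<in>darts D. rot (case a' of (r, p) \<Rightarrow> (r, (p + 3) mod 4)) = a'"
    by (auto simp: rot_def darts_def dest!: less_4_cases)
qed (auto simp: rot_def darts_def)

lemma opp_bij: "bij_betw opp (darts D) (darts D)"
  by (rule bij_betw_byWitness[where f' = opp]) (auto simp: opp opp_opp)

lemma rot_dart: "d \<in> darts D \<Longrightarrow> rot d \<in> darts D"
  using rot_bij by (auto simp: bij_betw_def)

lemma face_step_eq: "face_step D = (\<lambda>d. (d, rot (opp d))) ` darts D"
proof (intro equalityI subsetI)
  fix x assume "x \<in> face_step D"
  then obtain r p r' p' where x: "x = ((r, p), (r', Suc p' mod 4))"
    and d: "(r, p) \<in> darts D" "(r', p') \<in> darts D" "(r, p) \<noteq> (r', p')" "arc (r, p) = arc (r', p')"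
    unfolding face_step_def by blast
  have "opp (r, p) = (r', p')" using d by (intro opp_eq) auto
  then show "x \<in> (\<lambda>d. (d, rot (opp d))) ` darts D" using x d by (auto simp: rot_def image_iff)
next
  fix x assume "x \<in> (\<lambda>d. (d, rot (opp d))) ` darts D"
  then obtain d where d: "d \<in> darts D" "x = (d, rot (opp d))" by auto
  obtain r p r' p' where "d = (r, p)" "opp d = (r', p')" by (cases d; cases "opp d")
  then show "x \<in> face_step D"
    using d opp[OF d(1)] unfolding face_step_def rot_def by force
qed

lemma face_step_subset: "face_step D \<subseteq> darts D \<times> darts D"
  unfolding face_step_eq using opp(1) rot_dart by blast

lemma adjacent_subset: "adjacent D \<subseteq> {..<n} \<times> {..<n}"
  by (auto simp: adjacent_def darts_def)

lemma adjacentE: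
  assumes "(r, r') \<in> adjacent D"
  obtains "r = r'" | d where "d \<in> darts D" "r = fst d" "r' = fst (opp d)"
proof -
  obtain p p' where d: "(r, p) \<in> darts D" "(r', p') \<in> darts D" "arc (r, p) = arc (r', p')"
    using assms unfolding adjacent_def by blast
  show thesis
  proof (cases "(r, p) = (r', p')")
    case False
    then have "opp (r, p) = (r', p')" using d by (intro opp_eq) auto
    then show thesis using that(2)[of "(r, p)"] d by simp
  qed (use that in auto)
qed

section \<open>Planarity and source-sink orientations\<close>

abbreviation edges where "edges \<equiv> arc ` darts D"

text \<open>
  The sum over the two ends of an arc. If \<open>g\<close> depends on the crossing of a dart only, this is the
  coboundary of a function on crossings. A dart also stands for one of the two sides of its arc,
  namely the face whose boundary walk uses it; if \<open>g\<close> is constant on faces, this is the sum over the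
  faces on the two sides.
\<close>

definition end_sum :: "(nat \<times> nat \<Rightarrow> bit) \<Rightarrow> nat \<Rightarrow> bit" where
  "end_sum g e = (\<Sum>d | d \<in> darts D \<and> arc d = e. g d)"

lemma end_sum_arc: "d \<in> darts D \<Longrightarrow> end_sum g (arc d) = g d + g (opp d)"
  using opp(2)[of d] by (auto simp: end_sum_def darts_of_arc)

lemma end_sum_add: "end_sum (g + h) = end_sum g + end_sum h"
  by (simp add: fun_eq_iff end_sum_def sum.distrib)

lemma end_sum_span: "end_sum g \<in> span_on edges"
proof (rule span_onI)
  fix e assume "e \<notin> edges"
  then have "{d. d \<in> darts D \<and> arc d = e} = {}" by auto
  then show "end_sum g e = 0" unfolding end_sum_def by (simp only: sum.empty)
qed

lemma sum_end_sum: "(\<Sum>e\<in>edges. u e * end_sum g e) = (\<Sum>d\<in>darts D. u (arc d) * g d)"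
proof -
  have "(\<Sum>d\<in>darts D. u (arc d) * g d) =
      (\<Sum>e\<in>edges. \<Sum>d | d \<in> darts D \<and> arc d = e. u (arc d) * g d)"
    by (rule sum.image_gen[OF finite_darts])
  then show ?thesis by (simp add: end_sum_def sum_distrib_left)
qed

abbreviation faces where "faces \<equiv> constant_functions (darts D) (face_step D)"

lemma face_const: "\<phi> \<in> faces \<Longrightarrow> d \<in> darts D \<Longrightarrow> \<phi> (rot (opp d)) = \<phi> d"
  by (auto simp: constant_functions_def face_step_eq)

lemma face_rot: "\<phi> \<in> faces \<Longrightarrow> d \<in> darts D \<Longrightarrow> \<phi> (rot d) = \<phi> (opp d)"
  using face_const[of \<phi> "opp d"] by (simp add: opp opp_opp)

text \<open>
  Since \<open>\<phi>\<close> is constant along face walks, turning at a crossing has the same effect on it as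
  passing to the other end of the arc. This trades the pairs of ends of arcs for pairs of neighbouring
  darts at crossings.
\<close>

lemma pairing_end_sums:
  assumes "\<phi> \<in> faces"
  shows "(\<Sum>e\<in>edges. end_sum g e * end_sum \<phi> e) = (\<Sum>d\<in>darts D. (g d + g (rot d)) * \<phi> (rot d))"
proof -
  have "(\<Sum>e\<in>edges. end_sum g e * end_sum \<phi> e) = (\<Sum>d\<in>darts D. (g d + g (opp d)) * \<phi> d)"
    by (simp add: sum_end_sum end_sum_arc)
  also have "\<dots> = (\<Sum>d\<in>darts D. g d * \<phi> d) + (\<Sum>d\<in>darts D. g (opp d) * \<phi> d)"
    by (simp add: algebra_simps sum.distrib)
  also have "(\<Sum>d\<in>darts D. g d * \<phi> d) = (\<Sum>d\<in>darts D. g (rot d) * \<phi> (rot d))"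
    by (rule sum.reindex_bij_betw[OF rot_bij, symmetric])
  also have "(\<Sum>d\<in>darts D. g (opp d) * \<phi> d) = (\<Sum>d\<in>darts D. g (opp (opp d)) * \<phi> (opp d))"
    by (rule sum.reindex_bij_betw[OF opp_bij, symmetric])
  also have "\<dots> = (\<Sum>d\<in>darts D. g d * \<phi> (rot d))"
    by (intro sum.cong refl) (simp add: opp_opp face_rot[OF assms])
  finally show ?thesis by (simp add: algebra_simps sum.distrib)
qed

lemma card_edges: "card edges = 2 * n"
proof -
  have "edges = arc ` {d \<in> darts D. incoming d} \<union> arc ` {d \<in> darts D. \<not> incoming d}" by auto
  then have "edges = set ins" by (simp only: arc_incoming_image arc_outgoing_image ins_outs Un_absorb)
  then show ?thesis using distinct_card[OF distinct_ins] by (simp only: length_concat_pairs)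
qed

abbreviation n_comp where "n_comp \<equiv> card (generated_classes {..<n} (adjacent D))"
abbreviation n_face where "n_face \<equiv> card (generated_classes (darts D) (face_step D))"

lemma planar_count: "n_face = n + 2 * n_comp"
  using planar card_edges by (simp add: planar_def)

abbreviation adj_const where "adj_const \<equiv> constant_functions {..<n} (adjacent D)"

definition coboundary :: "(nat \<Rightarrow> bit) \<Rightarrow> nat \<Rightarrow> bit" where
  "coboundary \<epsilon> = end_sum (\<lambda>d. \<epsilon> (fst d))"

lemma coboundary_add: "coboundary (\<epsilon> + \<epsilon>') = coboundary \<epsilon> + coboundary \<epsilon>'"
  using end_sum_add[of "\<lambda>d. \<epsilon> (fst d)" "\<lambda>d. \<epsilon>' (fst d)"] by (simp add: coboundary_def plus_fun_def)

lemma coboundary_arc: "d \<in> darts D \<Longrightarrow> coboundary \<epsilon> (arc d) = \<epsilon> (fst d) + \<epsilon> (fst (opp d))"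
  by (simp add: coboundary_def end_sum_arc)

lemma fst_dart: "d \<in> darts D \<Longrightarrow> fst d < n"
  by (auto simp: darts_def)

text \<open>
  The kernel of the coboundary consists of functions that are constant on connected components.
\<close>

lemma card_coboundaries: "2 ^ n \<le> card (coboundary ` span_on {..<n}) * 2 ^ n_comp"
proof -
  have "{\<epsilon> \<in> span_on {..<n}. coboundary \<epsilon> = 0} \<subseteq> adj_const"
  proof
    fix \<epsilon> assume \<epsilon>: "\<epsilon> \<in> {\<epsilon> \<in> span_on {..<n}. coboundary \<epsilon> = 0}"
    have "\<epsilon> r = \<epsilon> r'" if "(r, r') \<in> adjacent D" for r r'
      using that
    proof (cases rule: adjacentE)
      case (2 d)
      then show ?thesis using \<epsilon> coboundary_arc[of d \<epsilon>] by (simp add: bit_add_eq_0_iff)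
    qed simp
    then show "\<epsilon> \<in> adj_const"
      using \<epsilon> by (auto simp: constant_functions_def)
  qed
  then have "card {\<epsilon> \<in> span_on {..<n}. coboundary \<epsilon> = 0} \<le> 2 ^ n_comp"
    using card_mono[OF finite_constant_functions] card_constant_functions[OF _ adjacent_subset]
    by (metis finite_lessThan)
  then show ?thesis
    using card_image_kernel[where h = coboundary, OF span_on_subgroup finite_span_on coboundary_add, of "{..<n}"]
    by (simp add: card_span_on)
qed

lemma dart_const_on_crossing:
  assumes \<phi>: "\<And>d. d \<in> darts D \<Longrightarrow> \<phi> (rot d) = \<phi> d" and d: "(r, p) \<in> darts D"
  shows "\<phi> (r, p) = \<phi> (r, 0)"
proof -
  have "p < 4" "r < n" using d by (auto simp: darts_def)
  have step: "\<phi> (r, Suc q) = \<phi> (r, q)" if "Suc q < 4" for q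
    using \<phi>[of "(r, q)"] that \<open>r < n\<close> by (simp add: rot_def darts_def)
  show ?thesis using \<open>p < 4\<close> by (induction p) (use step in auto)
qed

text \<open>
  Dually, a function on faces with equal values on both sides of each arc does not change under a
  turn at a crossing, hence it is a function on crossings, constant on connected components.
\<close>

lemma card_face_boundaries: "2 ^ n_face \<le> card (end_sum ` faces) * 2 ^ n_comp"
proof -
  let ?K = "{\<phi> \<in> faces. end_sum \<phi> = 0}"
  let ?\<rho> = "\<lambda>\<phi> r. if r < n then \<phi> (r, 0) else (0::bit)"
  have opp_const: "\<phi> (opp d) = \<phi> d" if "\<phi> \<in> ?K" "d \<in> darts D" for \<phi> d
    using that end_sum_arc[of d \<phi>] by (simp add: bit_add_eq_0_iff)
  have const: "\<phi> d = \<phi> (fst d, 0)" if "\<phi> \<in> ?K" "d \<in> darts D" for \<phi> d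
  proof -
    have "\<phi> (rot c) = \<phi> c" if "c \<in> darts D" for c
      using opp_const[of \<phi> c] face_rot[of \<phi> c] that \<open>\<phi> \<in> ?K\<close> by simp
    then show ?thesis using dart_const_on_crossing[of \<phi> "fst d" "snd d"] that by simp
  qed
  have "inj_on ?\<rho> ?K"
  proof (rule inj_onI, rule ext)
    fix \<phi> \<psi> d assume K: "\<phi> \<in> ?K" "\<psi> \<in> ?K" and eq: "?\<rho> \<phi> = ?\<rho> \<psi>"
    show "\<phi> d = \<psi> d"
    proof (cases "d \<in> darts D")
      case True
      then show ?thesis using const[OF K(1) True] const[OF K(2) True] fun_cong[OF eq, of "fst d"]
        by (simp add: fst_dart)
    next
      case False
      then show ?thesis using K by (auto simp: constant_functions_def span_on_0)
    qed
  qed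
  moreover have "?\<rho> ` ?K \<subseteq> adj_const"
  proof
    fix \<epsilon> assume "\<epsilon> \<in> ?\<rho> ` ?K"
    then obtain \<phi> where \<phi>: "\<phi> \<in> ?K" "\<epsilon> = ?\<rho> \<phi>" by blast
    have "\<epsilon> r = \<epsilon> r'" if "(r, r') \<in> adjacent D" for r r'
      using that
    proof (cases rule: adjacentE)
      case (2 d)
      then show ?thesis
        using const[OF \<phi>(1), of d] const[OF \<phi>(1), of "opp d"] opp_const[OF \<phi>(1), of d]
        by (simp add: \<phi>(2) fst_dart opp)
    qed simp
    moreover have "\<epsilon> \<in> span_on {..<n}" by (rule span_onI) (simp add: \<phi>(2))
    ultimately show "\<epsilon> \<in> adj_const"
      by (auto simp: constant_functions_def)
  qed
  ultimately have "card ?K \<le> card (adj_const)"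
    by (meson card_inj_on_le finite_constant_functions finite_lessThan)
  then have "card ?K \<le> 2 ^ n_comp"
    using card_constant_functions[OF _ adjacent_subset] by simp
  then show ?thesis
    using card_image_kernel[where h = end_sum, OF constant_functions_subgroup
        finite_constant_functions[OF finite_darts] end_sum_add, of "face_step D"]
    by (simp add: card_constant_functions[OF finite_darts face_step_subset])
qed

text \<open>
  A source-sink orientation assigns signs to darts which are opposite at the two ends of each arc and
  alternate around each crossing. The sign of the dart \<open>(r, p)\<close> then has the form
  \<open>\<epsilon> r + p\<close>, and the first condition says that the coboundary of \<open>\<epsilon>\<close> is this cochain.
\<close>

definition twist :: "nat \<Rightarrow> bit" where
  "twist e = end_sum (\<lambda>d. of_nat (snd d)) e + of_bool (e \<in> edges)"

lemma coboundary_orthogonal: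
  assumes "\<phi> \<in> faces"
  shows "(\<Sum>e\<in>edges. coboundary \<epsilon> e * end_sum \<phi> e) = 0"
proof -
  have "fst (rot d) = fst d" for d by (simp add: rot_def split: prod.split)
  then show ?thesis unfolding coboundary_def pairing_end_sums[OF assms] by simp
qed

text \<open>
  In a walk around a face the position increases by one at each crossing and so changes parity at
  each step; this cancels the summand 1 that \<open>twist\<close> has on each arc.
\<close>

lemma twist_orthogonal:
  assumes \<phi>: "\<phi> \<in> faces"
  shows "(\<Sum>e\<in>edges. twist e * end_sum \<phi> e) = 0"
proof -
  have 1: "of_nat (snd d) + of_nat (snd (rot d)) = (1::bit)" if "d \<in> darts D" for d
  proof -
    obtain r p where d: "d = (r, p)" "p < 4" using \<open>d \<in> darts D\<close> by (auto simp: darts_def)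
    show ?thesis using less_4_cases[OF d(2)] unfolding d(1)
      by (elim disjE) (simp_all add: rot_def)
  qed
  have "(\<Sum>e\<in>edges. end_sum (\<lambda>d. of_nat (snd d)) e * end_sum \<phi> e) = (\<Sum>d\<in>darts D. \<phi> (rot d))"
    unfolding pairing_end_sums[OF \<phi>] by (intro sum.cong refl) (simp add: 1)
  also have "\<dots> = (\<Sum>d\<in>darts D. \<phi> d)"
    by (rule sum.reindex_bij_betw[OF rot_bij])
  also have "\<dots> = (\<Sum>e\<in>edges. 1 * end_sum \<phi> e)"
    using sum_end_sum[of "\<lambda>_. 1" \<phi>] by simp
  finally have "(\<Sum>e\<in>edges. end_sum (\<lambda>d. of_nat (snd d)) e * end_sum \<phi> e) = (\<Sum>e\<in>edges. end_sum \<phi> e)"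
    by simp
  then show ?thesis by (simp add: twist_def distrib_right sum.distrib)
qed

text \<open>
  This is the vanishing of the first cohomology of the sphere. Coboundaries and boundaries of faces
  are orthogonal. With \<open>V\<close>, \<open>E\<close>, \<open>F\<close> and \<open>c\<close> the numbers of crossings, arcs, faces and
  components, their dimensions are at least \<open>V - c\<close> and \<open>F - c\<close>, which add up to \<open>E\<close> by
  planarity. A further cochain orthogonal to the boundaries of faces would exceed this.
\<close>

lemma twist_is_coboundary: "twist \<in> coboundary ` span_on {..<n}"
proof (rule ccontr)
  define U where "U = coboundary ` span_on {..<n}"
  define W where "W = end_sum ` faces"
  assume "twist \<notin> coboundary ` span_on {..<n}"
  then have notin: "twist \<notin> U" by (simp add: U_def)
  have U: "add_subgroup U"
    unfolding U_def by (rule add_subgroup_image[where h = coboundary, OF span_on_subgroup coboundary_add])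
  have fin: "finite U" unfolding U_def by (simp add: finite_span_on)
  have "card (U \<union> (+) twist ` U) * card W \<le> 2 ^ card edges"
  proof (rule card_orthogonal_le[OF _ add_subgroup_extend[OF U]])
    have tw: "twist \<in> span_on edges"
      by (intro span_onI) (simp add: twist_def span_on_0[OF end_sum_span])
    have U_sub: "U \<subseteq> span_on edges"
      unfolding U_def coboundary_def using end_sum_span by (intro image_subsetI)
    show "U \<union> (+) twist ` U \<subseteq> span_on edges"
      using U_sub add_subgroup_add[OF span_on_subgroup tw] by blast
    show "W \<subseteq> span_on edges" unfolding W_def using end_sum_span by (intro image_subsetI)
    fix u w assume u: "u \<in> U \<union> (+) twist ` U" and "w \<in> W"
    then obtain \<phi> where w: "\<phi> \<in> faces" "w = end_sum \<phi>" unfolding W_def by blast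
    have 0: "(\<Sum>e\<in>edges. v e * w e) = 0" if "v \<in> U" for v
      using that coboundary_orthogonal[OF w(1)] unfolding U_def w(2) by blast
    from u show "(\<Sum>e\<in>edges. u e * w e) = 0"
    proof
      assume "u \<in> (+) twist ` U"
      then obtain v where "v \<in> U" "u = twist + v" by blast
      then show ?thesis
        using 0 twist_orthogonal[OF w(1)] by (simp add: w(2) distrib_right sum.distrib)
    qed (rule 0)
  qed (use finite_darts in simp)
  then have le: "2 * card U * card W \<le> 2 ^ (2 * n)"
    by (simp only: card_extend[OF U fin notin] card_edges)
  have "(2::nat) ^ (1 + 2 * n + 2 * n_comp) = 2 * (2 ^ n * 2 ^ n_face)"
    by (simp only: planar_count flip: power_add power_Suc) (simp add: algebra_simps)
  also have "\<dots> \<le> 2 * ((card U * 2 ^ n_comp) * (card W * 2 ^ n_comp))"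
    unfolding U_def W_def
    by (intro mult_left_mono mult_mono card_coboundaries card_face_boundaries) simp_all
  also have "\<dots> = (2 * card U * card W) * (2 ^ n_comp * 2 ^ n_comp)"
    by (simp only: mult_ac)
  also have "\<dots> \<le> 2 ^ (2 * n) * (2 ^ n_comp * 2 ^ n_comp)" using le by (rule mult_right_mono) simp
  also have "\<dots> = 2 ^ (2 * n + 2 * n_comp)"
    by (simp only: mult_2 flip: power_add)
  finally show False by simp
qed

text \<open>
  The sign of the dart \<open>(r, p)\<close> is the truth value of \<open>\<epsilon> r \<longleftrightarrow> odd p\<close>. Odd positions are
  the ends of the over-strand.
\<close>

lemma source_sink_orientation:
  obtains \<epsilon> :: "nat \<Rightarrow> bool" where
    "\<And>d d'. d \<in> darts D \<Longrightarrow> d' \<in> darts D \<Longrightarrow> d \<noteq> d' \<Longrightarrow> arc d = arc d' \<Longrightarrow>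
      (\<epsilon> (fst d) \<longleftrightarrow> odd (snd d)) \<longleftrightarrow> \<not> (\<epsilon> (fst d') \<longleftrightarrow> odd (snd d'))"
proof -
  obtain \<epsilon> where \<epsilon>: "twist = coboundary \<epsilon>" using twist_is_coboundary by auto
  show thesis
  proof (rule that[of "\<lambda>r. \<epsilon> r = 1"])
    fix d d' assume d: "d \<in> darts D" "d' \<in> darts D" "d \<noteq> d'" "arc d = arc d'"
    have "opp d = d'" using d by (intro opp_eq) auto
    then have "of_nat (snd d) + of_nat (snd d') + 1 = \<epsilon> (fst d) + \<epsilon> (fst d')"
      using fun_cong[OF \<epsilon>, of "arc d"] d(1)
      by (simp add: coboundary_arc twist_def end_sum_arc[OF d(1)])
    moreover have "of_nat k = (of_bool (odd k) :: bit)" for k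
      by (induction k) auto
    ultimately show "(\<epsilon> (fst d) = 1 \<longleftrightarrow> odd (snd d)) \<longleftrightarrow> \<not> (\<epsilon> (fst d') = 1 \<longleftrightarrow> odd (snd d'))"
      by (cases "\<epsilon> (fst d)"; cases "\<epsilon> (fst d')") (auto split: if_splits simp: of_bool_def)
  qed
qed

end

section \<open>Surgery on circles\<close>

definition splits_to :: "'a set \<Rightarrow> 'a set \<Rightarrow> bool" where
  "splits_to S S' \<longleftrightarrow> (\<exists>a b c. a \<noteq> b \<and> S - S' = {c} \<and> S' - S = {a, b})"

lemma generated_classes_cong:
  "R \<union> R\<inverse> = R' \<union> R'\<inverse> \<Longrightarrow> generated_classes A R = generated_classes A R'"
  by (simp add: generated_classes_def)

lemma eqcl_mono: "R \<subseteq> R' \<Longrightarrow> eqcl R \<subseteq> eqcl R'"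
  by (rule rtrancl_mono) auto

lemma eqcl_insert:
  assumes "x \<in> eqcl R `` {a} \<union> eqcl R `` {b}"
  shows "eqcl (insert (a, b) R) `` {x} = eqcl R `` {a} \<union> eqcl R `` {b}"
    (is "_ = ?Q")
proof
  have "y \<in> ?Q" if "(x, y) \<in> eqcl (insert (a, b) R)" for y
    using that
  proof induction
    case (step y z)
    have a: "a \<in> ?Q" and b: "b \<in> ?Q" by auto
    from step(2) consider "(y, z) \<in> R \<union> R\<inverse>" | "z = a" | "z = b" by auto
    then show ?case
    proof cases
      case 1
      then have "(y, z) \<in> eqcl R" by auto
      then show ?thesis using step.IH by (auto intro: eqcl_trans)
    qed (use a b in auto)
  qed (rule assms)
  then show "eqcl (insert (a, b) R) `` {x} \<subseteq> ?Q" by auto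
next
  let ?R = "insert (a, b) R"
  have sub: "eqcl R \<subseteq> eqcl ?R" by (rule eqcl_mono) auto
  have ab: "(a, b) \<in> eqcl ?R" by auto
  have from_a: "(a, y) \<in> eqcl ?R" if "y \<in> ?Q" for y
    using that sub eqcl_trans[OF ab] by auto
  show "?Q \<subseteq> eqcl ?R `` {x}"
  proof
    fix y assume "y \<in> ?Q"
    then have "(x, y) \<in> eqcl ?R"
      using eqcl_trans[OF eqcl_sym[OF from_a[OF assms]] from_a] by blast
    then show "y \<in> eqcl ?R `` {x}" by simp
  qed
qed

lemma eqcl_insert_other:
  assumes "x \<notin> eqcl R `` {a} \<union> eqcl R `` {b}"
  shows "eqcl (insert (a, b) R) `` {x} = eqcl R `` {x}"
proof
  have "(x, y) \<in> eqcl R" if "(x, y) \<in> eqcl (insert (a, b) R)" for y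
    using that
  proof induction
    case (step y z)
    from step(2) consider "(y, z) \<in> R \<union> R\<inverse>" | "y = a" | "y = b" by auto
    then show ?case
    proof cases
      case 1
      then have "(y, z) \<in> eqcl R" by auto
      then show ?thesis using step.IH by (auto intro: eqcl_trans)
    next
      case 2
      then show ?thesis using eqcl_sym[OF step.IH] assms by simp
    next
      case 3
      then show ?thesis using eqcl_sym[OF step.IH] assms by simp
    qed
  qed simp
  then show "eqcl (insert (a, b) R) `` {x} \<subseteq> eqcl R `` {x}" by auto
  have "eqcl R \<subseteq> eqcl (insert (a, b) R)" by (rule eqcl_mono) auto
  then show "eqcl R `` {x} \<subseteq> eqcl (insert (a, b) R) `` {x}" by auto
qed

text \<open>
  A new pair unites the classes of its two members and leaves all others alone; the equation holds
  also when the two classes coincide.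
\<close>

lemma generated_classes_insert:
  assumes "a \<in> A" "b \<in> A"
  shows "generated_classes A (insert (a, b) R) =
    insert (eqcl R `` {a} \<union> eqcl R `` {b})
      (generated_classes A R - {eqcl R `` {a}, eqcl R `` {b}})"
    (is "?L = insert ?Q (?K - _)")
proof -
  have other: "eqcl R `` {x} \<noteq> eqcl R `` {c}"
    if "x \<notin> eqcl R `` {c}" for x c
    using that by auto
  have same: "eqcl R `` {x} \<in> {eqcl R `` {a}, eqcl R `` {b}}" if "x \<in> ?Q" for x
    using that eqcl_class_eq[of a x R] eqcl_class_eq[of b x R] by auto
  show ?thesis
  proof (intro equalityI subsetI)
    fix Y assume "Y \<in> ?L"
    then obtain x where x: "x \<in> A" "Y = eqcl (insert (a, b) R) `` {x}"
      by (auto simp: generated_classes_eq)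
    show "Y \<in> insert ?Q (?K - {eqcl R `` {a}, eqcl R `` {b}})"
    proof (cases "x \<in> ?Q")
      case True
      then show ?thesis unfolding x(2) eqcl_insert[OF True] by simp
    next
      case False
      then show ?thesis
        unfolding x(2) eqcl_insert_other[OF False] using x(1) other[of x]
        by (auto simp: generated_classes_eq)
    qed
  next
    fix Y assume Y: "Y \<in> insert ?Q (?K - {eqcl R `` {a}, eqcl R `` {b}})"
    show "Y \<in> ?L"
    proof (cases "Y = ?Q")
      case True
      have "eqcl (insert (a, b) R) `` {a} = ?Q" by (rule eqcl_insert) auto
      then show ?thesis using True assms by (auto simp: generated_classes_eq)
    next
      case False
      then obtain x where x: "x \<in> A" "Y = eqcl R `` {x}"
        "Y \<notin> {eqcl R `` {a}, eqcl R `` {b}}"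
        using Y by (auto simp: generated_classes_eq)
      then have "x \<notin> ?Q" using same by blast
      then have "Y = eqcl (insert (a, b) R) `` {x}"
        using eqcl_insert_other[of x R a b] x(2) by simp
      then show ?thesis unfolding generated_classes_eq using x(1) by (rule image_eqI)
    qed
  qed
qed

lemma generated_classes_insert_related:
  assumes "a \<in> A" "b \<in> A" "(a, b) \<in> eqcl R"
  shows "generated_classes A (insert (a, b) R) = generated_classes A R"
proof -
  have "eqcl R `` {a} \<in> generated_classes A R"
    unfolding generated_classes_eq using assms(1) by (rule imageI)
  then show ?thesis
    unfolding generated_classes_insert[OF assms(1,2)] eqcl_class_eq[OF assms(3), symmetric]
    by (simp add: insert_absorb)
qed

text \<open>
  If \<open>G\<close> is a partial injection, a step backwards from a point which is reached from the initial
  point \<open>x\<close> of a path retraces the last step forwards.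
\<close>

lemma path_class:
  assumes "single_valued (G\<inverse>)" "x \<notin> Range G" "(x, y) \<in> eqcl G"
  shows "(x, y) \<in> G\<^sup>*"
  using assms(3)
proof induction
  case (step y z)
  show ?case
  proof (cases "(y, z) \<in> G")
    case False
    then have zy: "(z, y) \<in> G" using step(2) by auto
    from step.IH show ?thesis
    proof (cases rule: rtranclE)
      case base
      then show ?thesis using zy assms(2) by blast
    next
      case (step w)
      then have "w = z" using zy assms(1) by (auto simp: single_valued_def)
      then show ?thesis using step by simp
    qed
  next
    case True
    with step.IH show ?thesis by (rule rtrancl_into_rtrancl)
  qed
qed simp

lemma path_starts_unrelated:
  assumes "single_valued (G\<inverse>)" "x \<notin> Range G" "y \<notin> Range G" "(x, y) \<in> eqcl G"
  shows "x = y"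
  using path_class[OF assms(1,2,4)] assms(3) by (auto elim: rtranclE)

text \<open>
  Otherwise \<open>G\<close> would be an injective map from the finite set of points reachable from \<open>x\<close> to
  itself, hence onto, although \<open>x\<close> has no preimage.
\<close>

lemma path_end:
  assumes sv: "single_valued G" "single_valued (G\<inverse>)" and G: "finite G" and x: "x \<notin> Range G"
  obtains z where "z \<notin> Domain G" "(x, z) \<in> G\<^sup>*"
proof (rule ccontr)
  assume no: "\<not> thesis"
  let ?P = "G\<^sup>* `` {x}"
  have dom: "?P \<subseteq> Domain G" using no that by blast
  define f where "f y = (SOME z. (y, z) \<in> G)" for y
  have f: "(y, f y) \<in> G" if "y \<in> ?P" for y
    using dom that someI_ex[of "\<lambda>z. (y, z) \<in> G"] unfolding f_def by blast
  have "f ` ?P \<subseteq> ?P" using f by (auto intro: rtrancl_into_rtrancl)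
  moreover have "inj_on f ?P"
  proof (rule inj_onI)
    fix u v assume uv: "u \<in> ?P" "v \<in> ?P" "f u = f v"
    have "(f u, u) \<in> G\<inverse>" "(f u, v) \<in> G\<inverse>" using f[OF uv(1)] f[OF uv(2)] uv(3) by auto
    then show "u = v" using sv(2) unfolding single_valued_def by blast
  qed
  moreover have "finite ?P" using dom G by (meson finite_Domain finite_subset)
  ultimately have "f ` ?P = ?P" by (simp add: endo_inj_surj)
  moreover have "x \<in> ?P" by simp
  ultimately have "x \<in> f ` ?P" by (simp only:)
  then obtain y where "y \<in> ?P" "f y = x" by (rule imageE) simp
  then show False using f x by blast
qed

lemma splits_to_insert:
  assumes A: "e1 \<in> A" "e2 \<in> A" "g1 \<in> A" "g2 \<in> A"
    and rel: "(e1, g1) \<in> eqcl G" "(e2, g2) \<in> eqcl G" "(g1, g2) \<notin> eqcl G"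
  shows "splits_to (generated_classes A ({(e1, g2), (e2, g1)} \<union> G))
    (generated_classes A ({(e1, g1), (e2, g2)} \<union> G))"
proof -
  let ?K = "generated_classes A G" and ?P = "eqcl G `` {g1}" and ?Q = "eqcl G `` {g2}"
  have classes: "eqcl G `` {e1} = ?P" "eqcl G `` {e2} = ?Q"
    using rel by (simp_all add: eqcl_class_eq)
  have "(e1, g1) \<in> eqcl (insert (e2, g2) G)"
    using rel(1) eqcl_mono[of G "insert (e2, g2) G"] by auto
  then have S0: "generated_classes A ({(e1, g1), (e2, g2)} \<union> G) = ?K"
    using A rel by (simp add: generated_classes_insert_related)
  let ?I = "insert (e2, g1) G"
  have mem: "e1 \<in> ?P" "g1 \<in> ?P" "g2 \<in> ?Q" using rel(1) by (auto intro: eqcl_sym)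
  have "eqcl ?I `` {e1} = ?Q \<union> ?P"
    using eqcl_insert[of e1 G e2 g1] mem by (simp add: classes)
  then have "(e1, g2) \<in> eqcl ?I" using mem by blast
  then have S1: "generated_classes A ({(e1, g2), (e2, g1)} \<union> G) = insert (?Q \<union> ?P) (?K - {?Q, ?P})"
    using A generated_classes_insert[of e2 A g1 G]
    by (simp add: generated_classes_insert_related classes)
  have K: "?P \<in> ?K" "?Q \<in> ?K" using A by (auto simp: generated_classes_eq)
  have PQ: "g2 \<notin> ?P" "g1 \<notin> ?Q" using rel(3) eqcl_sym[of g2 g1 G] by auto
  have "?Q \<union> ?P \<notin> ?K"
  proof
    assume "?Q \<union> ?P \<in> ?K"
    then obtain x where "?Q \<union> ?P = eqcl G `` {x}" by (auto simp: generated_classes_eq)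
    then have "(x, g1) \<in> eqcl G" "(x, g2) \<in> eqcl G" using mem by blast+
    then show False using rel(3) eqcl_sym eqcl_trans by metis
  qed
  then have "insert (?Q \<union> ?P) (?K - {?Q, ?P}) - ?K = {?Q \<union> ?P}"
    "?K - insert (?Q \<union> ?P) (?K - {?Q, ?P}) = {?P, ?Q}"
    using K PQ mem by auto
  moreover have "?P \<noteq> ?Q" using PQ mem by blast
  ultimately show ?thesis unfolding splits_to_def S0 S1 by metis
qed

text \<open>
  The partial injection \<open>G\<close> consists of cycles and of two paths, possibly of length zero, which
  start at \<open>g1\<close> and \<open>g2\<close> and end at \<open>e1\<close> and \<open>e2\<close> in some order; other elements of
  \<open>A\<close> are classes by themselves. Of the two ways to join ends to starts, one closes each path
  separately, and the other one links them to a single cycle.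
\<close>

lemma surgery:
  assumes A: "finite A" "e1 \<in> A" "e2 \<in> A" "g1 \<in> A" "g2 \<in> A" "G \<subseteq> A \<times> A"
    and sv: "single_valued G" "single_valued (G\<inverse>)"
    and ne: "g1 \<noteq> g2" "e1 \<noteq> e2"
    and ends: "Domain G \<union> {e1, e2} = Range G \<union> {g1, g2}"
    and notin: "e1 \<notin> Domain G" "e2 \<notin> Domain G" "g1 \<notin> Range G" "g2 \<notin> Range G"
  defines "S \<equiv> generated_classes A ({(e1, g1), (e2, g2)} \<union> G)"
    and "S' \<equiv> generated_classes A ({(e1, g2), (e2, g1)} \<union> G)"
  shows "splits_to S S' \<or> splits_to S' S"
proof -
  have G: "finite G" using A by (meson finite_SigmaI finite_subset)
  have reach: "(g, e1) \<in> eqcl G \<or> (g, e2) \<in> eqcl G" if g: "g \<in> {g1, g2}" for g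
  proof -
    have "g \<notin> Range G" using g notin by auto
    then obtain z where z: "z \<notin> Domain G" "(g, z) \<in> G\<^sup>*" using path_end[OF sv G] by blast
    have "z = g \<or> z \<in> Range G" using z(2) by (auto elim: rtranclE)
    then have "z \<in> {e1, e2}" using z(1) g ends by blast
    moreover have "(g, z) \<in> eqcl G" using z(2) rtrancl_mono[of G "G \<union> G\<inverse>"] by auto
    ultimately show ?thesis by auto
  qed
  have g: "(g1, g2) \<notin> eqcl G" "(g2, g1) \<notin> eqcl G"
    using path_starts_unrelated[OF sv(2)] notin ne by blast+
  have not_both: "\<not> ((g1, e) \<in> eqcl G \<and> (g2, e) \<in> eqcl G)" for e
    using g eqcl_sym eqcl_trans by metis
  from reach[of g1] reach[of g2] not_both
  consider "(g1, e1) \<in> eqcl G" "(g2, e2) \<in> eqcl G"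
    | "(g1, e2) \<in> eqcl G" "(g2, e1) \<in> eqcl G" by blast
  then show ?thesis
  proof cases
    case 1
    then show ?thesis
      using splits_to_insert[OF A(2-5)] g(1) eqcl_sym unfolding S_def S'_def by metis
  next
    case 2
    then show ?thesis
      using splits_to_insert[OF A(2,3,5,4)] g(2) eqcl_sym unfolding S_def S'_def by metis
  qed
qed

lemma splits_to_card:
  assumes "finite S" "finite S'" "splits_to S S'"
  shows "card S' = Suc (card S)"
proof -
  obtain a b c where "a \<noteq> b" "S - S' = {c}" "S' - S = {a, b}"
    using assms(3) by (auto simp: splits_to_def)
  then have "card (S - S') = 1" "card (S' - S) = 2" by auto
  moreover have "card S = card (S \<inter> S') + card (S - S')" "card S' = card (S \<inter> S') + card (S' - S)"
    using card_Int_Diff[OF assms(1), of S'] card_Int_Diff[OF assms(2), of S] by (simp_all add: Int_commute)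
  ultimately show ?thesis by simp
qed

lemma finite_generated_classes: "finite A \<Longrightarrow> finite (generated_classes A R)"
  by (simp add: generated_classes_eq)

section \<open>Resolutions of oriented strands\<close>

text \<open>
  Two strands pass through each of \<open>n\<close> places; they arrive at place \<open>r\<close> along \<open>e1 r\<close> and
  \<open>e2 r\<close> and leave along \<open>g1 r\<close> and \<open>g2 r\<close>. Every arc that arrives somewhere also leaves
  somewhere, so each choice of the connections at all places makes the arcs into closed loops. The
  orientation of the link and a source-sink orientation both give rise to such a system of strands.
\<close>

locale strands =
  fixes A :: "'a set" and n :: nat and e1 e2 g1 g2 :: "nat \<Rightarrow> 'a"
  assumes A: "finite A"
    and e_eq: "r < n \<Longrightarrow> s < n \<Longrightarrow> e1 r = e1 s \<longleftrightarrow> r = s" "r < n \<Longrightarrow> s < n \<Longrightarrow> e2 r = e2 s \<longleftrightarrow> r = s"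
      "r < n \<Longrightarrow> s < n \<Longrightarrow> e1 r \<noteq> e2 s"
    and g_eq: "r < n \<Longrightarrow> s < n \<Longrightarrow> g1 r = g1 s \<longleftrightarrow> r = s" "r < n \<Longrightarrow> s < n \<Longrightarrow> g2 r = g2 s \<longleftrightarrow> r = s"
      "r < n \<Longrightarrow> s < n \<Longrightarrow> g1 r \<noteq> g2 s"
    and ends: "(\<Union>r<n. {e1 r, e2 r}) = (\<Union>r<n. {g1 r, g2 r})" "(\<Union>r<n. {e1 r, e2 r}) \<subseteq> A"
begin

definition joins :: "bool \<Rightarrow> nat \<Rightarrow> ('a \<times> 'a) set" where
  "joins b r = (if b then {(e1 r, g1 r), (e2 r, g2 r)} else {(e1 r, g2 r), (e2 r, g1 r)})"

definition loops :: "(nat \<Rightarrow> bool) \<Rightarrow> 'a set set" where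
  "loops \<beta> = generated_classes A (\<Union>r<n. joins (\<beta> r) r)"

lemma ends_in_A: "r < n \<Longrightarrow> e1 r \<in> A \<and> e2 r \<in> A \<and> g1 r \<in> A \<and> g2 r \<in> A"
  using ends by blast

lemma joins_subset: "r < n \<Longrightarrow> joins b r \<subseteq> A \<times> A"
  using ends_in_A[of r] by (auto simp: joins_def)

lemma Domain_joins: "Domain (joins b r) = {e1 r, e2 r}"
  by (auto simp: joins_def)

lemma Range_joins: "Range (joins b r) = {g1 r, g2 r}"
  by (auto simp: joins_def)

lemma joins_cases:
  assumes "(x, y) \<in> joins b r"
  shows "x = e1 r \<and> y = (if b then g1 r else g2 r) \<or> x = e2 r \<and> y = (if b then g2 r else g1 r)"
  using assms by (auto simp: joins_def split: if_splits)

lemma loops_step: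
  assumes r: "r < n"
  shows "splits_to (loops (\<beta>(r := True))) (loops (\<beta>(r := False))) \<or>
    splits_to (loops (\<beta>(r := False))) (loops (\<beta>(r := True)))"
proof -
  \<comment> \<open>Removing the connections at the place \<open>r\<close> leaves a partial injection.\<close>
  define I where "I = {..<n} - {r}"
  define G where "G = (\<Union>s\<in>I. joins (\<beta> s) s)"
  have n: "{..<n} = insert r I" "r \<notin> I" using r by (auto simp: I_def)
  have I: "s < n" "s \<noteq> r" if "s \<in> I" for s using that by (auto simp: I_def)
  have rel: "(\<Union>s<n. joins ((\<beta>(r := b)) s) s) = joins b r \<union> G" for b
  proof -
    have "(\<Union>s\<in>I. joins ((\<beta>(r := b)) s) s) = G"
      unfolding G_def using I(2) by (intro SUP_cong refl) simp
    then show ?thesis by (simp add: n)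
  qed
  have sv: "single_valued G"
  proof (rule single_valuedI)
    fix x y z assume "(x, y) \<in> G" "(x, z) \<in> G"
    then obtain s t where st: "s \<in> I" "t \<in> I" "(x, y) \<in> joins (\<beta> s) s" "(x, z) \<in> joins (\<beta> t) t"
      by (auto simp: G_def)
    show "y = z"
      using joins_cases[OF st(3)] joins_cases[OF st(4)] e_eq[OF I(1)[OF st(1)] I(1)[OF st(2)]]
        e_eq(3)[OF I(1)[OF st(2)] I(1)[OF st(1)]] by auto
  qed
  have sv': "single_valued (G\<inverse>)"
  proof (rule single_valuedI)
    fix x y z assume "(x, y) \<in> G\<inverse>" "(x, z) \<in> G\<inverse>"
    then obtain s t where st: "s \<in> I" "t \<in> I" "(y, x) \<in> joins (\<beta> s) s" "(z, x) \<in> joins (\<beta> t) t"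
      by (auto simp: G_def)
    show "y = z"
      using joins_cases[OF st(3)] joins_cases[OF st(4)] g_eq[OF I(1)[OF st(1)] I(1)[OF st(2)]]
        g_eq(3)[OF I(1)[OF st(2)] I(1)[OF st(1)]] by (auto split: if_splits)
  qed
  have dom: "Domain G = (\<Union>s\<in>I. {e1 s, e2 s})" "Range G = (\<Union>s\<in>I. {g1 s, g2 s})"
    by (simp_all add: G_def Domain_Union Range_Union Domain_joins Range_joins)
  have 1: "Domain G \<union> {e1 r, e2 r} = Range G \<union> {g1 r, g2 r}"
    using ends(1) unfolding dom n by (simp only: UN_insert Un_commute)
  have "e1 r \<noteq> e1 s \<and> e1 r \<noteq> e2 s \<and> e2 r \<noteq> e1 s \<and> e2 r \<noteq> e2 s" if "s \<in> I" for s
    using e_eq[OF r I(1)[OF that]] e_eq(3)[OF I(1)[OF that] r] I(2)[OF that] by auto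
  then have "e1 r \<notin> Domain G" "e2 r \<notin> Domain G" unfolding dom by blast+
  moreover have "g1 r \<noteq> g1 s \<and> g1 r \<noteq> g2 s \<and> g2 r \<noteq> g1 s \<and> g2 r \<noteq> g2 s"
    if "s \<in> I" for s
    using g_eq[OF r I(1)[OF that]] g_eq(3)[OF I(1)[OF that] r] I(2)[OF that] by auto
  then have "g1 r \<notin> Range G" "g2 r \<notin> Range G" unfolding dom by blast+
  moreover have "G \<subseteq> A \<times> A" using joins_subset I(1) unfolding G_def by blast
  moreover note ends_in_A[OF r] A sv sv' 1 e_eq(3)[OF r r] g_eq(3)[OF r r]
  ultimately have "splits_to (generated_classes A ({(e1 r, g1 r), (e2 r, g2 r)} \<union> G))
      (generated_classes A ({(e1 r, g2 r), (e2 r, g1 r)} \<union> G)) \<or>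
     splits_to (generated_classes A ({(e1 r, g2 r), (e2 r, g1 r)} \<union> G))
      (generated_classes A ({(e1 r, g1 r), (e2 r, g2 r)} \<union> G))"
    by (intro surgery) auto
  then show ?thesis unfolding loops_def rel by (simp add: joins_def)
qed

text \<open>
  Each change of a connection changes the number of loops by one.
\<close>

lemma loops_parity:
  "even (card (loops \<beta>) + card {r. r < n \<and> \<beta> r}) \<longleftrightarrow> even (card (loops (\<lambda>_. False)))"
proof (induction "card {r. r < n \<and> \<beta> r}" arbitrary: \<beta>)
  case 0
  then have empty: "{r. r < n \<and> \<beta> r} = {}" by simp
  then have "\<not> \<beta> r" if "r < n" for r using that by blast
  then have "loops \<beta> = loops (\<lambda>_. False)" by (simp add: loops_def)
  then show ?case unfolding empty by simp
next
  case (Suc k)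
  then have "{r. r < n \<and> \<beta> r} \<noteq> {}" by (intro notI) simp
  then obtain r where r: "r < n" "\<beta> r" by blast
  define \<beta>' where "\<beta>' = \<beta>(r := False)"
  have "{s. s < n \<and> \<beta> s} = insert r {s. s < n \<and> \<beta>' s}" "\<not> \<beta>' r" using r by (auto simp: \<beta>'_def)
  then have card: "card {s. s < n \<and> \<beta> s} = Suc (card {s. s < n \<and> \<beta>' s})" by simp
  have fin: "finite (loops \<beta>)" for \<beta> by (simp add: loops_def finite_generated_classes A)
  have "\<beta>(r := True) = \<beta>" using r(2) by (simp add: fun_eq_iff)
  then have "card (loops \<beta>) = Suc (card (loops \<beta>')) \<or> card (loops \<beta>') = Suc (card (loops \<beta>))"
    using loops_step[OF r(1), of \<beta>] splits_to_card[OF fin fin] unfolding \<beta>'_def by metis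
  moreover have "even (card (loops \<beta>') + card {s. s < n \<and> \<beta>' s}) \<longleftrightarrow> even (card (loops (\<lambda>_. False)))"
    using Suc(1)[of \<beta>'] Suc(2) card by simp
  ultimately show ?case unfolding card by presburger
qed

end

section \<open>Circles of the resolutions\<close>

lemma even_card_xor:
  assumes "finite I"
  shows "even (card {r \<in> I. a r \<noteq> b r} + card {r \<in> I. a r} + card {r \<in> I. b r})"
proof -
  have "card {r \<in> I. P r} = (\<Sum>r\<in>I. of_bool (P r))" for P
    using assms by (simp add: of_bool_def sum.If_cases Int_def)
  then have "card {r \<in> I. a r \<noteq> b r} + card {r \<in> I. a r} + card {r \<in> I. b r} =
      (\<Sum>r\<in>I. of_bool (a r \<noteq> b r) + of_bool (a r) + of_bool (b r))"
    by (simp add: sum.distrib)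
  also have "even \<dots>" by (rule dvd_sum) auto
  finally show ?thesis .
qed

context link_diag
begin

interpretation comp: strands "arcs D" n "\<lambda>r. under_in (X r)" "\<lambda>r. over_in (X r)"
  "\<lambda>r. under_out (X r)" "\<lambda>r. over_out (X r)"
proof
  show "(\<Union>r<n. {under_in (X r), over_in (X r)}) = (\<Union>r<n. {under_out (X r), over_out (X r)})"
    using ins_outs unfolding set_ins set_outs .
  show "(\<Union>r<n. {under_in (X r), over_in (X r)}) \<subseteq> arcs D"
    using ins_arcs unfolding set_ins .
qed (use finite_arcs ins_eq outs_eq in auto)

lemma components_eq: "components D = comp.loops (\<lambda>_. True)"
proof -
  have "(\<Union>x\<in>set (crossings D). {(under_in x, under_out x), (over_in x, over_out x)}) =
      (\<Union>r<n. {(under_in (X r), under_out (X r)), (over_in (X r), over_out (X r))})"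
  proof -
    have "set (crossings D) = X ` {..<n}" by (auto simp: set_conv_nth)
    then show ?thesis by simp
  qed
  then show ?thesis by (simp add: components_def comp.loops_def comp.joins_def)
qed

definition over_in_dart where "over_in_dart r = (r, if positive (X r) then 3 else Suc 0)"
definition over_out_dart where "over_out_dart r = (r, if positive (X r) then Suc 0 else 3)"

lemma arc_over_darts: "arc (over_in_dart r) = over_in (X r)" "arc (over_out_dart r) = over_out (X r)"
  by (simp_all add: over_in_dart_def over_out_dart_def arc_simps)

abbreviation alternating :: "(nat \<Rightarrow> bool) \<Rightarrow> bool" where
  "alternating \<epsilon> \<equiv> strands (arcs D) n
    (\<lambda>r. if \<epsilon> r then over_in (X r) else under_in (X r))
    (\<lambda>r. if \<epsilon> r then over_out (X r) else under_out (X r))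
    (\<lambda>r. if \<epsilon> r then under_out (X r) else over_out (X r))
    (\<lambda>r. if \<epsilon> r then under_in (X r) else over_in (X r))"

text \<open>
  In a source-sink orientation either both ends of the over-strand point towards the crossing and
  both ends of the under-strand away from it, or the other way round. Since each smoothing joins ends
  of the over-strand to ends of the under-strand, it joins arriving arcs to leaving arcs.
\<close>

lemma exists_strands:
  obtains \<epsilon> where "alternating \<epsilon>"
proof -
  obtain \<epsilon> where \<epsilon>: "\<And>d d'. d \<in> darts D \<Longrightarrow> d' \<in> darts D \<Longrightarrow> d \<noteq> d' \<Longrightarrow> arc d = arc d' \<Longrightarrow>
      (\<epsilon> (fst d) \<longleftrightarrow> odd (snd d)) \<longleftrightarrow> \<not> (\<epsilon> (fst d') \<longleftrightarrow> odd (snd d'))"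
    using source_sink_orientation by blast
  define sgn where "sgn d \<longleftrightarrow> (\<epsilon> (fst d) \<longleftrightarrow> odd (snd d))" for d :: "nat \<times> nat"
  have inj: "arc d = arc d' \<longleftrightarrow> d = d'" if "d \<in> darts D" "d' \<in> darts D" "sgn d = sgn d'" for d d'
    using \<epsilon>[OF that(1,2)] that(3) by (auto simp: sgn_def)
  define E1 where "E1 r = (if \<epsilon> r then over_in_dart r else (r, 0))" for r
  define E2 where "E2 r = (if \<epsilon> r then over_out_dart r else (r, 2))" for r
  define G1 where "G1 r = (if \<epsilon> r then (r, 2) else over_out_dart r)" for r
  define G2 where "G2 r = (if \<epsilon> r then (r, 0) else over_in_dart r)" for r
  note defs = E1_def E2_def G1_def G2_def over_in_dart_def over_out_dart_def
  have dart: "E1 r \<in> darts D" "E2 r \<in> darts D" "G1 r \<in> darts D" "G2 r \<in> darts D" if "r < n" for r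
    using that by (auto simp: defs darts_def)
  have sgn: "sgn (E1 r)" "sgn (E2 r)" "\<not> sgn (G1 r)" "\<not> sgn (G2 r)" for r
    by (auto simp: defs sgn_def)
  have arcs: "arc (E1 r) = (if \<epsilon> r then over_in (X r) else under_in (X r))"
    "arc (E2 r) = (if \<epsilon> r then over_out (X r) else under_out (X r))"
    "arc (G1 r) = (if \<epsilon> r then under_out (X r) else over_out (X r))"
    "arc (G2 r) = (if \<epsilon> r then under_in (X r) else over_in (X r))" for r
    by (simp_all add: E1_def E2_def G1_def G2_def arc_over_darts arc_simps)
  have ne: "E1 r = E1 s \<longleftrightarrow> r = s" "E2 r = E2 s \<longleftrightarrow> r = s" "E1 r \<noteq> E2 s"
    "G1 r = G1 s \<longleftrightarrow> r = s" "G2 r = G2 s \<longleftrightarrow> r = s" "G1 r \<noteq> G2 s" for r s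
    by (auto simp: defs split: if_splits)
  have pos: "(\<Union>r<n. {E1 r, E2 r}) = {d \<in> darts D. sgn d}"
    by (auto simp: defs darts_def sgn_def split: if_splits dest!: less_4_cases)
  have neg: "(\<Union>r<n. {G1 r, G2 r}) = {d \<in> darts D. \<not> sgn d}"
    by (auto simp: defs darts_def sgn_def split: if_splits dest!: less_4_cases)
  have opp_sgn: "sgn (opp d) \<longleftrightarrow> \<not> sgn d" if "d \<in> darts D" for d
    using \<epsilon>[of "opp d" d] opp[OF that] that by (auto simp: sgn_def)
  have "arc ` {d \<in> darts D. sgn d = b} \<subseteq> arc ` {d \<in> darts D. sgn d = (\<not> b)}" for b
  proof (rule image_subsetI)
    fix d assume "d \<in> {d \<in> darts D. sgn d = b}"
    then show "arc d \<in> arc ` {d \<in> darts D. sgn d = (\<not> b)}"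
      using opp[of d] opp_sgn[of d] by (intro image_eqI[of _ _ "opp d"]) auto
  qed
  from this[of True] this[of False]
  have img: "arc ` {d \<in> darts D. sgn d} = arc ` {d \<in> darts D. \<not> sgn d}" by auto
  have "arc ` darts D = arc ` {d \<in> darts D. incoming d} \<union> arc ` {d \<in> darts D. \<not> incoming d}" by auto
  then have arcs_sub: "arc ` darts D \<subseteq> arcs D"
    unfolding arc_incoming_image arc_outgoing_image using ins_outs ins_arcs by auto
  have UE: "(\<Union>r<n. {arc (E1 r), arc (E2 r)}) = arc ` {d \<in> darts D. sgn d}"
    unfolding pos[symmetric] by auto
  have UG: "(\<Union>r<n. {arc (G1 r), arc (G2 r)}) = arc ` {d \<in> darts D. \<not> sgn d}"
    unfolding neg[symmetric] by auto
  have "strands (arcs D) n (\<lambda>r. arc (E1 r)) (\<lambda>r. arc (E2 r)) (\<lambda>r. arc (G1 r)) (\<lambda>r. arc (G2 r))"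
  proof
    show "(\<Union>r<n. {arc (E1 r), arc (E2 r)}) = (\<Union>r<n. {arc (G1 r), arc (G2 r)})"
      unfolding UE UG by (rule img)
    show "(\<Union>r<n. {arc (E1 r), arc (E2 r)}) \<subseteq> arcs D"
      unfolding UE using arcs_sub by blast
  qed (use finite_arcs in \<open>simp_all add: inj dart sgn ne\<close>)
  then show thesis using that[of \<epsilon>] unfolding arcs by blast
qed

abbreviation turned :: "bool list \<Rightarrow> nat \<Rightarrow> bool" where
  "turned \<alpha> r \<equiv> \<alpha> ! r \<longleftrightarrow> \<not> positive (X r)"

lemma finite_circles: "finite (circles D \<alpha>)"
  by (simp add: circles_def finite_generated_classes finite_arcs)

text \<open>
  The oriented resolution appears twice: with the orientation of the link its circles are obtained
  from the components by changing all connections, and with the source-sink orientation it is one of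
  the vertices of the cube.
\<close>

lemma circles_strands:
  obtains e1 e2 g1 g2 where "strands (arcs D) n e1 e2 g1 g2"
    "\<And>\<alpha>. circles D \<alpha> = strands.loops (arcs D) n e1 e2 g1 g2 (turned \<alpha>)"
    "comp.loops (\<lambda>_. False) = strands.loops (arcs D) n e1 e2 g1 g2 (\<lambda>_. True)"
proof -
  obtain \<epsilon> where \<epsilon>: "alternating \<epsilon>" using exists_strands by blast
  interpret st: strands "arcs D" n
    "\<lambda>r. if \<epsilon> r then over_in (X r) else under_in (X r)"
    "\<lambda>r. if \<epsilon> r then over_out (X r) else under_out (X r)"
    "\<lambda>r. if \<epsilon> r then under_out (X r) else over_out (X r)"
    "\<lambda>r. if \<epsilon> r then under_in (X r) else over_in (X r)" by (rule \<epsilon>)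
  have eq: "(\<Union>r<n. P r) \<union> (\<Union>r<n. P r)\<inverse> = (\<Union>r<n. Q r) \<union> (\<Union>r<n. Q r)\<inverse>"
    if "\<And>r. P r \<union> (P r)\<inverse> = Q r \<union> (Q r)\<inverse>" for P Q :: "nat \<Rightarrow> (nat \<times> nat) set"
  proof -
    have *: "(\<Union>r<n. P r) \<union> (\<Union>r<n. P r)\<inverse> = (\<Union>r<n. P r \<union> (P r)\<inverse>)"
      for P :: "nat \<Rightarrow> (nat \<times> nat) set" by blast
    show ?thesis unfolding * that ..
  qed
  have 1: "smoothing b (X r) \<union> (smoothing b (X r))\<inverse> =
      st.joins (b \<longleftrightarrow> \<not> positive (X r)) r \<union> (st.joins (b \<longleftrightarrow> \<not> positive (X r)) r)\<inverse>" for b r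
    unfolding smoothing_def st.joins_def by auto
  have 2: "comp.joins False r \<union> (comp.joins False r)\<inverse> = st.joins True r \<union> (st.joins True r)\<inverse>" for r
    unfolding comp.joins_def st.joins_def by auto
  show thesis
  proof (rule that[OF \<epsilon>])
    show "circles D \<alpha> = st.loops (turned \<alpha>)" for \<alpha>
      unfolding circles_def st.loops_def by (intro generated_classes_cong eq 1)
    show "comp.loops (\<lambda>_. False) = st.loops (\<lambda>_. True)"
      unfolding comp.loops_def st.loops_def by (intro generated_classes_cong eq 2)
  qed
qed

lemma circles_step:
  assumes "length \<alpha> = n" "cube_edge \<alpha> \<alpha>'"
  shows "splits_to (circles D \<alpha>) (circles D \<alpha>') \<or> splits_to (circles D \<alpha>') (circles D \<alpha>)"
proof -
  obtain r where r: "r < n" "\<not> \<alpha> ! r" "\<alpha>' = \<alpha>[r := True]"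
    using assms by (auto simp: cube_edge_def)
  obtain e1 e2 g1 g2 where st: "strands (arcs D) n e1 e2 g1 g2"
    and circ: "\<And>\<alpha>. circles D \<alpha> = strands.loops (arcs D) n e1 e2 g1 g2 (turned \<alpha>)"
    and "comp.loops (\<lambda>_. False) = strands.loops (arcs D) n e1 e2 g1 g2 (\<lambda>_. True)"
    by (rule circles_strands) (rule that)
  interpret strands "arcs D" n e1 e2 g1 g2 by (rule st)
  define t where "t = turned \<alpha>"
  have t': "turned \<alpha>' = t(r := \<not> t r)"
    using r assms(1) by (auto simp: t_def fun_eq_iff nth_list_update)
  have "t(r := t r) = t" by (rule fun_upd_triv)
  then show ?thesis
    using loops_step[OF r(1), of t] unfolding circ t' t_def[symmetric] by (cases "t r") auto
qed

text \<open>
  The vertex \<open>\<alpha>\<close> differs from the oriented resolution at a number of places congruent to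
  \<open>n + weight \<alpha> + n_plus D\<close> modulo 2, and the oriented resolution differs from the components
  at all \<open>n\<close> places.
\<close>

lemma circles_parity:
  assumes "length \<alpha> = n"
  shows "even (card (circles D \<alpha>) + weight \<alpha> + n_plus D) \<longleftrightarrow> even (card (components D))"
proof -
  obtain e1 e2 g1 g2 where st: "strands (arcs D) n e1 e2 g1 g2"
    and circ: "\<And>\<alpha>. circles D \<alpha> = strands.loops (arcs D) n e1 e2 g1 g2 (turned \<alpha>)"
    and seif: "comp.loops (\<lambda>_. False) = strands.loops (arcs D) n e1 e2 g1 g2 (\<lambda>_. True)"
    by (rule circles_strands) (rule that)
  interpret strands "arcs D" n e1 e2 g1 g2 by (rule st)
  have all: "{r. r < n \<and> True} = {..<n}" by auto
  have w: "weight \<alpha> = card {r \<in> {..<n}. \<alpha> ! r}"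
    using assms by (simp add: weight_def length_filter_conv_card)
  have p: "n_plus D = card {r \<in> {..<n}. positive (X r)}"
    by (simp add: n_plus_def length_filter_conv_card)
  have t: "{r. r < n \<and> turned \<alpha> r} = {r \<in> {..<n}. \<alpha> ! r \<noteq> positive (X r)}" by auto
  define m where "m = card {r. r < n \<and> turned \<alpha> r}"
  have "even (card (circles D \<alpha>) + m) \<longleftrightarrow> even (card (comp.loops (\<lambda>_. False)) + n)"
    using loops_parity[of "turned \<alpha>"] loops_parity[of "\<lambda>_. True"]
    unfolding circ seif all m_def by (simp only: card_lessThan)
  moreover have "even (card (components D) + n) \<longleftrightarrow> even (card (comp.loops (\<lambda>_. False)))"
    using comp.loops_parity[of "\<lambda>_. True"] unfolding components_eq all by (simp only: card_lessThan)
  moreover have "even (m + weight \<alpha> + n_plus D)"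
    unfolding m_def t w p by (rule even_card_xor) simp
  ultimately show ?thesis by presburger
qed

end

section \<open>Merge and split maps on idempotents\<close>

abbreviation m_BN :: merge_map where "m_BN \<equiv> m_Kh + m_tilde"
abbreviation \<Delta>_BN :: split_map where "\<Delta>_BN \<equiv> \<Delta>_Kh + \<Delta>_tilde"
abbreviation coeff_BN where "coeff_BN \<equiv> cube_coeff m_BN \<Delta>_BN"

lemma UNIV_gen: "(UNIV :: gen set) = {One_A, X_A}"
  using gen.exhaust by auto

lemma finite_gen: "finite (UNIV :: gen set)"
  by (simp add: UNIV_gen)

lemma gen_cases: "g = One_A \<or> g = X_A"
  by (cases g) auto

lemma UNIV_gen_pair: "(UNIV :: (gen \<times> gen) set) = {(One_A, One_A), (One_A, X_A), (X_A, One_A), (X_A, X_A)}"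
  using gen_cases by auto

lemma sum_gen: "(\<Sum>g\<in>UNIV. h g) = h One_A + (h X_A :: bit)"
  by (simp add: UNIV_gen)

lemma sum_gen_pair: "(\<Sum>p\<in>UNIV. h p) =
    h (One_A, One_A) + h (One_A, X_A) + h (X_A, One_A) + (h (X_A, X_A) :: bit)"
  by (simp add: UNIV_gen_pair add.assoc)

text \<open>
  An idempotent is encoded by a truth value \<open>p\<close>, with \<open>True\<close> for \<open>x\<close> and \<open>False\<close> for
  \<open>1 + x\<close>. As \<open>1 = x + (1 + x)\<close>, the basis element \<open>a\<close> has coefficient 1 at \<open>p\<close> exactly
  if \<open>a = X_A \<longrightarrow> p\<close>. So the equation says that the merge map is the pointwise product of
  coefficients: distinct idempotents are orthogonal.
\<close>

lemma merge_idempotent: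
  "(\<Sum>g\<in>UNIV. of_bool (g = X_A \<longrightarrow> p) * m_BN a b g) =
    of_bool ((a = X_A \<longrightarrow> p) \<and> (b = X_A \<longrightarrow> p))"
  by (cases a; cases b; cases p) (simp_all add: sum_gen basis_def)

text \<open>
  The split map doubles each idempotent.
\<close>

lemma split_idempotent:
  "(\<Sum>(g, h)\<in>UNIV. of_bool ((g = X_A \<longrightarrow> p) \<and> (h = X_A \<longrightarrow> q)) * \<Delta>_BN a (g, h)) =
    of_bool (p = q \<and> (a = X_A \<longrightarrow> p))"
  by (cases a; cases p; cases q) (simp_all add: sum_gen_pair basis_def)

lemma m_BN_commute: "m_BN a b g = m_BN b a g"
  by (cases a; cases b) simp_all

lemma \<Delta>_BN_commute: "\<Delta>_BN a (g, h) = \<Delta>_BN a (h, g)"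
  by (cases a; cases g; cases h) (simp_all add: basis_def)

lemma sum_filtered_reindex:
  fixes H :: "'b \<Rightarrow> bit"
  assumes "finite A" "bij_betw \<phi> I {x \<in> A. Q x}"
  shows "(\<Sum>x\<in>A. of_bool (Q x) * H x) = (\<Sum>i\<in>I. H (\<phi> i))"
proof -
  have "(\<Sum>x\<in>A. of_bool (Q x) * H x) = (\<Sum>x | x \<in> A \<and> Q x. H x)"
    by (rule sum.mono_neutral_cong_right) (use assms(1) in auto)
  also have "\<dots> = (\<Sum>i\<in>I. H (\<phi> i))"
    by (rule sum.reindex_bij_betw[OF assms(2), symmetric])
  finally show ?thesis .
qed

lemma bij_betw_extend_one:
  assumes "c \<notin> K"
  shows "bij_betw (\<lambda>g. (restrict v K)(c := g)) UNIV
    {w \<in> insert c K \<rightarrow>\<^sub>E UNIV. \<forall>k\<in>K. w k = v k}"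
proof (rule bij_betw_byWitness[where f' = "\<lambda>w. w c"])
  show "\<forall>w\<in>{w \<in> insert c K \<rightarrow>\<^sub>E UNIV. \<forall>k\<in>K. w k = v k}. (restrict v K)(c := w c) = w"
    by (auto simp: fun_eq_iff PiE_def extensional_def)
qed (use assms in \<open>auto split: if_splits\<close>)

lemma bij_betw_extend_two:
  assumes "b \<notin> K" "c \<notin> K" "b \<noteq> c"
  shows "bij_betw (\<lambda>(g, h). (restrict v K)(b := g, c := h)) UNIV
    {w \<in> insert b (insert c K) \<rightarrow>\<^sub>E UNIV. \<forall>k\<in>K. w k = v k}"
proof (rule bij_betw_byWitness[where f' = "\<lambda>w. (w b, w c)"])
  show "\<forall>w\<in>{w \<in> insert b (insert c K) \<rightarrow>\<^sub>E UNIV. \<forall>k\<in>K. w k = v k}.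
      (case (w b, w c) of (g, h) \<Rightarrow> (restrict v K)(b := g, c := h)) = w"
    by (auto simp: fun_eq_iff PiE_def extensional_def)
qed (use assms in \<open>auto split: if_splits\<close>)

lemma cube_coeff_merge:
  assumes "cube_edge \<alpha> \<alpha>'" "a \<noteq> b"
    and S: "circles D \<alpha> - circles D \<alpha>' = {a, b}" "circles D \<alpha>' - circles D \<alpha> = {c}"
  shows "coeff_BN D (\<alpha>, v) (\<alpha>', v') =
    of_bool (\<forall>k\<in>circles D \<alpha> \<inter> circles D \<alpha>'. v' k = v k) * m_BN (v a) (v b) (v' c)"
proof -
  have "(\<exists>a' b' c'. a' \<noteq> b' \<and> {a, b} = {a', b'} \<and> {c} = {c'} \<and> m_BN (v a') (v b') (v' c') = 1) \<longleftrightarrow>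
      m_BN (v a) (v b) (v' c) = 1"
    using assms(2) m_BN_commute[of "v a" "v b" "v' c"]
    by (auto simp: doubleton_eq_iff)
  moreover have "\<not> (\<exists>a' b' c'. b' \<noteq> c' \<and> {a, b} = {a'} \<and> {c} = {b', c'} \<and> \<Delta>_BN (v a') (v' b', v' c') = 1)"
    using assms(2) by auto
  ultimately show ?thesis
    unfolding cube_coeff_def Let_def prod.case S using assms(1)
    by (cases "m_BN (v a) (v b) (v' c)") auto
qed

lemma cube_coeff_split:
  assumes "cube_edge \<alpha> \<alpha>'" "b \<noteq> c"
    and S: "circles D \<alpha> - circles D \<alpha>' = {a}" "circles D \<alpha>' - circles D \<alpha> = {b, c}"
  shows "coeff_BN D (\<alpha>, v) (\<alpha>', v') =
    of_bool (\<forall>k\<in>circles D \<alpha> \<inter> circles D \<alpha>'. v' k = v k) * \<Delta>_BN (v a) (v' b, v' c)"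
proof -
  have "(\<exists>a' b' c'. b' \<noteq> c' \<and> {a} = {a'} \<and> {b, c} = {b', c'} \<and> \<Delta>_BN (v a') (v' b', v' c') = 1) \<longleftrightarrow>
      \<Delta>_BN (v a) (v' b, v' c) = 1"
    using assms(2) \<Delta>_BN_commute[of "v a" "v' b" "v' c"]
    by (auto simp: doubleton_eq_iff)
  moreover have "\<not> (\<exists>a' b' c'. a' \<noteq> b' \<and> {a} = {a', b'} \<and> {b, c} = {c'} \<and> m_BN (v a') (v b') (v' c') = 1)"
    using assms(2) by auto
  ultimately show ?thesis
    unfolding cube_coeff_def Let_def prod.case S using assms(1)
    by (cases "\<Delta>_BN (v a) (v' b, v' c)") auto
qed

lemma cube_coeff_no_edge: "\<not> cube_edge \<alpha> \<alpha>' \<Longrightarrow> cube_coeff m \<Delta> D (\<alpha>, v) (\<alpha>', v') = 0"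
  by (simp add: cube_coeff_def Let_def)

lemma cube_edge_length: "cube_edge \<alpha> \<alpha>' \<Longrightarrow> length \<alpha>' = length \<alpha>"
  by (auto simp: cube_edge_def)

section \<open>Circles and labellings\<close>

context link_diag
begin

abbreviation labellings :: "bool list \<Rightarrow> (nat set \<Rightarrow> gen) set" where
  "labellings \<alpha> \<equiv> circles D \<alpha> \<rightarrow>\<^sub>E UNIV"

lemma finite_labellings: "finite (labellings \<alpha>)"
  by (simp add: finite_PiE finite_circles finite_gen)

lemma states_eq: "states D = Sigma {\<alpha>. length \<alpha> = n} labellings"
  by (auto simp: states_def)

lemma finite_vertices: "finite {\<alpha> :: bool list. length \<alpha> = n}"
  using finite_lists_length_eq[of "UNIV :: bool set" n] by simp

lemma finite_states: "finite (states D)"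
  unfolding states_eq by (rule finite_SigmaI[OF finite_vertices finite_labellings])

abbreviation smoothings :: "bool list \<Rightarrow> (nat \<times> nat) set" where
  "smoothings \<alpha> \<equiv> \<Union>r<n. smoothing (\<alpha> ! r) (X r)"

lemma crossing_arcs: "r < n \<Longrightarrow> {under_in (X r), over_in (X r), under_out (X r), over_out (X r)} \<subseteq> arcs D"
proof -
  assume r: "r < n"
  have "{under_in (X r), over_in (X r)} \<subseteq> set ins" unfolding set_ins using r by blast
  moreover have "{under_out (X r), over_out (X r)} \<subseteq> set ins" unfolding ins_outs set_outs using r by blast
  ultimately show ?thesis using ins_arcs by blast
qed

lemma smoothings_subset: "smoothings \<alpha> \<subseteq> arcs D \<times> arcs D"
proof (rule UN_least)
  fix r assume "r \<in> {..<n}"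
  then show "smoothing (\<alpha> ! r) (X r) \<subseteq> arcs D \<times> arcs D"
    using crossing_arcs[of r] by (auto simp: smoothing_def)
qed

lemma circles_eq: "circles D \<alpha> = (\<lambda>x. eqcl (smoothings \<alpha>) `` {x}) ` arcs D"
  by (simp add: circles_def generated_classes_eq)

lemma circle_subset:
  assumes "k \<in> circles D \<alpha>" shows "k \<subseteq> arcs D"
proof -
  obtain x where x: "x \<in> arcs D" "k = eqcl (smoothings \<alpha>) `` {x}"
    using assms by (auto simp: circles_eq)
  then show ?thesis using eqcl_subset[OF smoothings_subset] by blast
qed

lemma circles_cover: "\<Union> (circles D \<alpha>) = arcs D"
proof
  show "\<Union> (circles D \<alpha>) \<subseteq> arcs D" using circle_subset by blast
  show "arcs D \<subseteq> \<Union> (circles D \<alpha>)"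
  proof
    fix x assume "x \<in> arcs D"
    moreover have "x \<in> eqcl (smoothings \<alpha>) `` {x}" by simp
    ultimately show "x \<in> \<Union> (circles D \<alpha>)" unfolding circles_eq by blast
  qed
qed

lemma circle_nonempty: "k \<in> circles D \<alpha> \<Longrightarrow> k \<noteq> {}"
  by (auto simp: circles_eq)

lemma circle_class:
  assumes "k \<in> circles D \<alpha>" "x \<in> k" shows "k = eqcl (smoothings \<alpha>) `` {x}"
proof -
  obtain y where y: "k = eqcl (smoothings \<alpha>) `` {y}" using assms by (auto simp: circles_eq)
  then have "(y, x) \<in> eqcl (smoothings \<alpha>)" using assms(2) by blast
  then show ?thesis unfolding y by (rule eqcl_class_eq)
qed

lemma circles_disjoint:
  assumes "k \<in> circles D \<alpha>" "k' \<in> circles D \<alpha>" "x \<in> k" "x \<in> k'"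
  shows "k = k'"
  by (rule trans[OF circle_class[OF assms(1,3)] circle_class[OF assms(2,4), symmetric]])

text \<open>
  Compatibility with a resolution is a condition on each crossing separately. This makes it easy to
  compare the vertices of a square of the cube; by \<open>compatible_iff\<close> it means that \<open>f\<close> is constant
  on circles.
\<close>

definition compatible :: "(nat \<Rightarrow> bool) \<Rightarrow> bool list \<Rightarrow> bool" where
  "compatible f \<alpha> \<longleftrightarrow> (\<forall>r<n. \<forall>(x, y)\<in>smoothing (\<alpha> ! r) (X r). f x = f y)"

lemma compatible_iff: "compatible f \<alpha> \<longleftrightarrow> (\<forall>k\<in>circles D \<alpha>. \<forall>x\<in>k. \<forall>y\<in>k. f x = f y)"
proof
  assume f: "compatible f \<alpha>"
  show "\<forall>k\<in>circles D \<alpha>. \<forall>x\<in>k. \<forall>y\<in>k. f x = f y"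
  proof (intro ballI)
    fix k x y assume "k \<in> circles D \<alpha>" "x \<in> k" "y \<in> k"
    then have "(x, y) \<in> eqcl (smoothings \<alpha>)" using circle_class[of k \<alpha> x] by auto
    then show "f x = f y"
      by (rule eqcl_const) (use f in \<open>auto simp: compatible_def\<close>)
  qed
next
  assume f: "\<forall>k\<in>circles D \<alpha>. \<forall>x\<in>k. \<forall>y\<in>k. f x = f y"
  have "f x = f y" if r: "r < n" and xy: "(x, y) \<in> smoothing (\<alpha> ! r) (X r)" for r x y
  proof -
    have mem: "(x, y) \<in> smoothings \<alpha>" using r xy by blast
    then have "x \<in> arcs D" using smoothings_subset by blast
    then have "eqcl (smoothings \<alpha>) `` {x} \<in> circles D \<alpha>" unfolding circles_eq by (rule imageI)
    moreover have "(x, y) \<in> eqcl (smoothings \<alpha>)" using mem by (intro r_into_rtrancl UnI1)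
    ultimately show ?thesis using f by blast
  qed
  then show "compatible f \<alpha>" by (auto simp: compatible_def)
qed

section \<open>The Bar-Natan differential in the idempotent basis\<close>

definition full :: "(nat \<Rightarrow> bool) \<Rightarrow> nat set \<Rightarrow> bool" where
  "full f k \<longleftrightarrow> (\<forall>x\<in>k. f x)"

lemma full_iff: "compatible f \<alpha> \<Longrightarrow> k \<in> circles D \<alpha> \<Longrightarrow> x \<in> k \<Longrightarrow> full f k \<longleftrightarrow> f x"
  unfolding compatible_iff full_def by blast

definition below :: "(nat \<Rightarrow> bool) \<Rightarrow> bool list \<Rightarrow> (nat set \<Rightarrow> gen) \<Rightarrow> bool" where
  "below f \<alpha> v \<longleftrightarrow> (\<forall>k\<in>circles D \<alpha>. v k = X_A \<longrightarrow> full f k)"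

lemma circles_difference_union:
  "\<Union> (circles D \<alpha> - circles D \<alpha>') = \<Union> (circles D \<alpha>' - circles D \<alpha>)"
proof -
  have sub: "\<Union> (circles D \<alpha> - circles D \<alpha>') \<subseteq> \<Union> (circles D \<alpha>' - circles D \<alpha>)" for \<alpha> \<alpha>'
  proof
    fix x assume "x \<in> \<Union> (circles D \<alpha> - circles D \<alpha>')"
    then obtain k where k: "k \<in> circles D \<alpha>" "k \<notin> circles D \<alpha>'" "x \<in> k" by blast
    then have "x \<in> \<Union> (circles D \<alpha>')" using circles_cover by blast
    then obtain k' where k': "k' \<in> circles D \<alpha>'" "x \<in> k'" by blast
    then have "k' \<notin> circles D \<alpha>" using circles_disjoint[of k \<alpha> k' x] k by metis
    then show "x \<in> \<Union> (circles D \<alpha>' - circles D \<alpha>)" using k' by blast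
  qed
  show ?thesis using sub by (intro equalityI)
qed

lemma compatible_common:
  assumes "compatible f \<alpha>'"
  shows "compatible f \<alpha> \<longleftrightarrow> (\<forall>k\<in>circles D \<alpha> - circles D \<alpha>'. \<forall>x\<in>k. \<forall>y\<in>k. f x = f y)"
  using assms unfolding compatible_iff by blast

lemma merge_sum:
  assumes edge: "cube_edge \<alpha> \<alpha>'" and ab: "a \<noteq> b"
    and S: "circles D \<alpha> - circles D \<alpha>' = {a, b}" "circles D \<alpha>' - circles D \<alpha> = {c}"
    and f: "compatible f \<alpha>'"
  shows "(\<Sum>w\<in>labellings \<alpha>'. of_bool (below f \<alpha>' w) * coeff_BN D (\<alpha>, v) (\<alpha>', w)) =
    of_bool (compatible f \<alpha> \<and> below f \<alpha> v)"
proof -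
  define K where "K = circles D \<alpha> \<inter> circles D \<alpha>'"
  have c: "c \<in> circles D \<alpha>'" "c \<notin> K" using S by (auto simp: K_def)
  have S': "circles D \<alpha>' = insert c K" using S by (auto simp: K_def)
  have S0: "circles D \<alpha> = insert a (insert b K)" using S by (auto simp: K_def)
  have cab: "c = a \<union> b" using circles_difference_union[of \<alpha> \<alpha>'] by (simp add: S)
  obtain x y where xy: "x \<in> a" "y \<in> b"
    using circle_nonempty[of a \<alpha>] circle_nonempty[of b \<alpha>] S0 by blast
  have const: "\<forall>x\<in>c. \<forall>y\<in>c. f x = f y" using f c(1) unfolding compatible_iff by blast
  then have fa: "compatible f \<alpha>" unfolding compatible_common[OF f] S(1) cab by blast
  have lab: "full f a = full f c" "full f b = full f c" using const xy unfolding full_def cab by blast+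
  define P where "P \<longleftrightarrow> (\<forall>k\<in>K. v k = X_A \<longrightarrow> full f k)"
  define H where "H w = of_bool (below f \<alpha>' w) * m_BN (v a) (v b) (w c)" for w
  have "(\<Sum>w\<in>labellings \<alpha>'. of_bool (below f \<alpha>' w) * coeff_BN D (\<alpha>, v) (\<alpha>', w)) =
      (\<Sum>w\<in>labellings \<alpha>'. of_bool (\<forall>k\<in>K. w k = v k) * H w)"
    unfolding cube_coeff_merge[OF edge ab S] K_def[symmetric] H_def by (simp only: mult.left_commute)
  also have "\<dots> = (\<Sum>g\<in>UNIV. H ((restrict v K)(c := g)))"
    using finite_labellings[of \<alpha>'] bij_betw_extend_one[OF c(2), of v] unfolding S'
    by (rule sum_filtered_reindex)
  also have "\<dots> = (\<Sum>g\<in>UNIV. of_bool P * (of_bool (g = X_A \<longrightarrow> full f c) * m_BN (v a) (v b) g))"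
  proof (rule sum.cong[OF refl])
    fix g
    have "((restrict v K)(c := g)) k = v k" if "k \<in> K" for k using that c by auto
    then have "below f \<alpha>' ((restrict v K)(c := g)) \<longleftrightarrow> P \<and> (g = X_A \<longrightarrow> full f c)"
      unfolding below_def S' P_def by auto
    then show "H ((restrict v K)(c := g)) =
        of_bool P * (of_bool (g = X_A \<longrightarrow> full f c) * m_BN (v a) (v b) g)"
      unfolding H_def by (simp only: of_bool_conj fun_upd_same mult.assoc)
  qed
  also have "\<dots> = of_bool P * of_bool ((v a = X_A \<longrightarrow> full f c) \<and> (v b = X_A \<longrightarrow> full f c))"
    unfolding sum_distrib_left[symmetric] merge_idempotent ..
  also have "\<dots> = of_bool (compatible f \<alpha> \<and> below f \<alpha> v)"
  proof -
    have "below f \<alpha> v \<longleftrightarrow> P \<and> (v a = X_A \<longrightarrow> full f c) \<and> (v b = X_A \<longrightarrow> full f c)"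
      unfolding below_def S0 P_def using lab by auto
    then show ?thesis using fa by (simp only: of_bool_conj[symmetric] simp_thms)
  qed
  finally show ?thesis .
qed

lemma split_sum:
  assumes edge: "cube_edge \<alpha> \<alpha>'" and bc: "b \<noteq> c"
    and S: "circles D \<alpha> - circles D \<alpha>' = {a}" "circles D \<alpha>' - circles D \<alpha> = {b, c}"
    and f: "compatible f \<alpha>'"
  shows "(\<Sum>w\<in>labellings \<alpha>'. of_bool (below f \<alpha>' w) * coeff_BN D (\<alpha>, v) (\<alpha>', w)) =
    of_bool (compatible f \<alpha> \<and> below f \<alpha> v)"
proof -
  define K where "K = circles D \<alpha> \<inter> circles D \<alpha>'"
  have c: "b \<in> circles D \<alpha>'" "c \<in> circles D \<alpha>'" "b \<notin> K" "c \<notin> K" using S by (auto simp: K_def)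
  have S': "circles D \<alpha>' = insert b (insert c K)" using S by (auto simp: K_def)
  have S0: "circles D \<alpha> = insert a K" using S by (auto simp: K_def)
  have abc: "a = b \<union> c" using circles_difference_union[of \<alpha> \<alpha>'] by (simp add: S)
  obtain x y where xy: "x \<in> b" "y \<in> c"
    using circle_nonempty[of b \<alpha>'] circle_nonempty[of c \<alpha>'] c by blast
  have const: "\<forall>x\<in>b. \<forall>y\<in>b. f x = f y" "\<forall>x\<in>c. \<forall>y\<in>c. f x = f y"
    using f c(1,2) unfolding compatible_iff by blast+
  have lab: "full f b = f x" "full f c = f y"
    using full_iff[OF f] c xy by blast+
  have fa: "compatible f \<alpha> \<longleftrightarrow> full f b = full f c"
  proof
    assume "compatible f \<alpha>"
    then have "\<forall>x\<in>a. \<forall>y\<in>a. f x = f y" unfolding compatible_common[OF f] S(1) by blast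
    then show "full f b = full f c" unfolding lab abc using xy by blast
  next
    assume "full f b = full f c"
    then have "f x' = f x" if "x' \<in> a" for x'
      using that const xy unfolding abc lab by blast
    then show "compatible f \<alpha>" unfolding compatible_common[OF f] S(1) by simp
  qed
  have fa': "full f a = full f b" if "full f b = full f c"
    using that unfolding full_def abc by blast
  define P where "P \<longleftrightarrow> (\<forall>k\<in>K. v k = X_A \<longrightarrow> full f k)"
  define H where "H w = of_bool (below f \<alpha>' w) * \<Delta>_BN (v a) (w b, w c)" for w
  have "(\<Sum>w\<in>labellings \<alpha>'. of_bool (below f \<alpha>' w) * coeff_BN D (\<alpha>, v) (\<alpha>', w)) =
      (\<Sum>w\<in>labellings \<alpha>'. of_bool (\<forall>k\<in>K. w k = v k) * H w)"
    unfolding cube_coeff_split[OF edge bc S] K_def[symmetric] H_def by (simp only: mult.left_commute)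
  also have "\<dots> = (\<Sum>p\<in>UNIV. H (case p of (g, h) \<Rightarrow> (restrict v K)(b := g, c := h)))"
    using finite_labellings[of \<alpha>'] bij_betw_extend_two[OF c(3,4) bc, of v] unfolding S'
    by (rule sum_filtered_reindex)
  also have "\<dots> = (\<Sum>p\<in>UNIV. of_bool P * (case p of (g, h) \<Rightarrow>
      of_bool ((g = X_A \<longrightarrow> full f b) \<and> (h = X_A \<longrightarrow> full f c)) * \<Delta>_BN (v a) (g, h)))"
  proof (rule sum.cong[OF refl])
    fix p :: "gen \<times> gen"
    obtain g h where p: "p = (g, h)" by (cases p)
    have w: "((restrict v K)(b := g, c := h)) b = g" "((restrict v K)(b := g, c := h)) c = h"
      using bc by auto
    have "((restrict v K)(b := g, c := h)) k = v k" if "k \<in> K" for k using that c by auto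
    then have "below f \<alpha>' ((restrict v K)(b := g, c := h)) \<longleftrightarrow>
        P \<and> ((g = X_A \<longrightarrow> full f b) \<and> (h = X_A \<longrightarrow> full f c))"
      unfolding below_def S' P_def using w by auto
    then show "H (case p of (g, h) \<Rightarrow> (restrict v K)(b := g, c := h)) = of_bool P * (case p of (g, h) \<Rightarrow>
        of_bool ((g = X_A \<longrightarrow> full f b) \<and> (h = X_A \<longrightarrow> full f c)) * \<Delta>_BN (v a) (g, h))"
      unfolding H_def p prod.case w by (simp only: of_bool_conj mult.assoc)
  qed
  also have "\<dots> = of_bool P * of_bool (full f b = full f c \<and> (v a = X_A \<longrightarrow> full f b))"
    unfolding sum_distrib_left[symmetric] split_idempotent ..
  also have "\<dots> = of_bool (compatible f \<alpha> \<and> below f \<alpha> v)"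
  proof -
    have "compatible f \<alpha> \<and> below f \<alpha> v \<longleftrightarrow>
        P \<and> (full f b = full f c \<and> (v a = X_A \<longrightarrow> full f b))"
      unfolding below_def S0 P_def fa using fa' by auto
    then show ?thesis by (simp only: of_bool_conj[symmetric])
  qed
  finally show ?thesis .
qed

text \<open>
  An edge of the cube sends the tensor product of idempotents given by \<open>f\<close> at \<open>\<alpha>\<close> to the one
  given by \<open>f\<close> at \<open>\<alpha>'\<close>, provided \<open>f\<close> is constant on the circles of both; all other
  coefficients between idempotents vanish. The circles that change contribute \<open>merge_idempotent\<close>
  or \<open>split_idempotent\<close>, and the others agree. A third case, with one circle replaced by another
  one, is excluded by \<open>circles_step\<close>; the cube map would vanish there, and the equation would fail.
\<close>

lemma edge_sum:
  assumes "length \<alpha> = n" "cube_edge \<alpha> \<alpha>'" "compatible f \<alpha>'"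
  shows "(\<Sum>w\<in>labellings \<alpha>'. of_bool (below f \<alpha>' w) * coeff_BN D (\<alpha>, v) (\<alpha>', w)) =
    of_bool (compatible f \<alpha> \<and> below f \<alpha> v)"
proof -
  consider (split) "splits_to (circles D \<alpha>) (circles D \<alpha>')"
    | (merge) "splits_to (circles D \<alpha>') (circles D \<alpha>)"
    using circles_step[OF assms(1,2)] by (elim disjE)
  then show ?thesis
  proof cases
    case split
    then obtain b c a where "b \<noteq> c" "circles D \<alpha> - circles D \<alpha>' = {a}"
      "circles D \<alpha>' - circles D \<alpha> = {b, c}"
      unfolding splits_to_def by (elim exE conjE) (rule that)
    then show ?thesis by (rule split_sum[OF assms(2) _ _ _ assms(3)])
  next
    case merge
    then obtain a b c where "a \<noteq> b" "circles D \<alpha>' - circles D \<alpha> = {c}"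
      "circles D \<alpha> - circles D \<alpha>' = {a, b}"
      unfolding splits_to_def by (elim exE conjE) (rule that)
    then show ?thesis using merge_sum[OF assms(2) _ _ _ assms(3), of a b c v] by simp
  qed
qed

abbreviation under :: "(nat \<Rightarrow> bool) \<Rightarrow> state \<Rightarrow> bool" where
  "under f s \<equiv> below f (fst s) (snd s)"

text \<open>
  The coefficient of \<open>c\<close> at the tensor product of idempotents which has \<open>x\<close> on the circles of
  \<open>\<alpha>\<close> where \<open>f\<close> is true, and \<open>1 + x\<close> on the others.
\<close>

definition coord :: "chain \<Rightarrow> bool list \<Rightarrow> (nat \<Rightarrow> bool) \<Rightarrow> bit" where
  "coord c \<alpha> f = (\<Sum>s\<in>states D. of_bool (fst s = \<alpha> \<and> under f s) * c s)"

lemma sum_states_over: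
  fixes H :: "state \<Rightarrow> bit"
  assumes "length \<alpha> = n"
  shows "(\<Sum>t\<in>states D. of_bool (fst t = \<alpha> \<and> Q t) * H t) =
    (\<Sum>w\<in>labellings \<alpha>. of_bool (Q (\<alpha>, w)) * H (\<alpha>, w))"
proof -
  have "(\<Sum>t\<in>states D. of_bool (fst t = \<alpha> \<and> Q t) * H t) =
      (\<Sum>t\<in>states D. of_bool (fst t = \<alpha>) * (of_bool (Q t) * H t))"
    by (simp only: of_bool_conj mult.assoc)
  also have "\<dots> = (\<Sum>w\<in>labellings \<alpha>. of_bool (Q (\<alpha>, w)) * H (\<alpha>, w))"
  proof (rule sum_filtered_reindex[OF finite_states])
    show "bij_betw (Pair \<alpha>) (labellings \<alpha>) {t \<in> states D. fst t = \<alpha>}"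
      by (rule bij_betw_byWitness[where f' = snd]) (use assms in \<open>auto simp: states_eq\<close>)
  qed
  finally show ?thesis .
qed

lemma d_BN_state:
  "t \<in> states D \<Longrightarrow> d_BN D c t = (\<Sum>s\<in>states D. c s * coeff_BN D s t)"
  by (simp add: d_BN_def cube_map_def)

lemma coord_d_BN:
  assumes \<alpha>: "length \<alpha> = n" and f: "compatible f \<alpha>"
  shows "coord (d_BN D c) \<alpha> f =
    (\<Sum>s\<in>states D. of_bool (cube_edge (fst s) \<alpha> \<and> compatible f (fst s) \<and> under f s) * c s)"
proof -
  have "coord (d_BN D c) \<alpha> f =
      (\<Sum>t\<in>states D. \<Sum>s\<in>states D. of_bool (fst t = \<alpha> \<and> under f t) *
        (c s * coeff_BN D s t))"
    unfolding coord_def by (intro sum.cong refl) (simp only: d_BN_state sum_distrib_left)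
  also have "\<dots> = (\<Sum>s\<in>states D. \<Sum>t\<in>states D. of_bool (fst t = \<alpha> \<and> under f t) *
        (c s * coeff_BN D s t))"
    by (rule sum.swap)
  also have "\<dots> = (\<Sum>s\<in>states D.
      of_bool (cube_edge (fst s) \<alpha> \<and> compatible f (fst s) \<and> under f s) * c s)"
  proof (rule sum.cong[OF refl])
    fix s assume s: "s \<in> states D"
    obtain \<alpha>' v where sv: "s = (\<alpha>', v)" by (cases s)
    have len: "length \<alpha>' = n" using s sv by (simp add: states_def)
    have "(\<Sum>t\<in>states D. of_bool (fst t = \<alpha> \<and> under f t) *
          (c s * coeff_BN D s t)) =
        (\<Sum>w\<in>labellings \<alpha>. of_bool (below f \<alpha> w) * (c s * coeff_BN D s (\<alpha>, w)))"
      using sum_states_over[OF \<alpha>, of "\<lambda>t. under f t"] by (simp only: fst_conv snd_conv)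
    also have "\<dots> = c s * (\<Sum>w\<in>labellings \<alpha>.
        of_bool (below f \<alpha> w) * coeff_BN D (\<alpha>', v) (\<alpha>, w))"
      unfolding sum_distrib_left sv by (intro sum.cong refl) (simp only: mult.left_commute)
    also have "\<dots> = c s * of_bool (cube_edge \<alpha>' \<alpha> \<and> compatible f \<alpha>' \<and> below f \<alpha>' v)"
    proof (cases "cube_edge \<alpha>' \<alpha>")
      case True
      then show ?thesis using edge_sum[OF len True f, of v] by (simp only: simp_thms)
    next
      case False
      then show ?thesis by (simp add: cube_coeff_no_edge)
    qed
    finally show "(\<Sum>t\<in>states D. of_bool (fst t = \<alpha> \<and> under f t) *
          (c s * coeff_BN D s t)) =
        of_bool (cube_edge (fst s) \<alpha> \<and> compatible f (fst s) \<and> under f s) * c s"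
      unfolding sv fst_conv snd_conv by (simp only: mult.commute)
  qed
  finally show ?thesis .
qed

text \<open>
  If \<open>f\<close> is compatible with two opposite vertices of a square, it is compatible with all four,
  since each crossing has the same smoothing at \<open>\<alpha>'\<close> as at \<open>\<alpha>\<close> or at \<open>\<alpha>''\<close>. So the
  number of paths is 2 or 0.
\<close>

lemma even_paths:
  assumes len: "length \<alpha> = n" and f: "compatible f \<alpha>" "compatible f \<alpha>''"
  shows "even (card {\<alpha>'. cube_edge \<alpha> \<alpha>' \<and> cube_edge \<alpha>' \<alpha>'' \<and> compatible f \<alpha>'})" (is "even (card ?P)")
proof (cases "?P = {}")
  case False
  then obtain \<alpha>' where "cube_edge \<alpha> \<alpha>'" "cube_edge \<alpha>' \<alpha>''" by blast
  then obtain r s where r: "r < n" "\<not> \<alpha> ! r" "\<alpha>' = \<alpha>[r := True]"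
    and s: "s < n" "\<not> \<alpha>' ! s" "\<alpha>'' = \<alpha>'[s := True]"
    using len by (auto simp: cube_edge_def)
  have rs: "r \<noteq> s" using r s len by auto
  then have ns: "\<not> \<alpha> ! s" using r s len by simp
  have comp: "compatible f (\<alpha>[t := True])" if t: "\<alpha>'' ! t" "t < n" for t
    unfolding compatible_def
  proof (intro allI impI)
    fix q assume "q < n"
    then show "\<forall>(x, y)\<in>smoothing (\<alpha>[t := True] ! q) (X q). f x = f y"
      using f t len by (cases "q = t") (auto simp: compatible_def)
  qed
  have "?P = {\<alpha>[r := True], \<alpha>[s := True]}"
  proof (intro equalityI subsetI)
    fix \<beta> assume "\<beta> \<in> ?P"
    then obtain t u where t: "t < n" "\<not> \<alpha> ! t" "\<beta> = \<alpha>[t := True]" and u: "\<alpha>'' = \<beta>[u := True]"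
      using len by (auto simp: cube_edge_def)
    have "\<alpha>'' ! t" using t u len by (cases "t = u") auto
    then have "t = r \<or> t = s" using r s t len by (auto simp: nth_list_update split: if_splits)
    then show "\<beta> \<in> {\<alpha>[r := True], \<alpha>[s := True]}" using t by auto
  next
    fix \<beta> assume \<beta>: "\<beta> \<in> {\<alpha>[r := True], \<alpha>[s := True]}"
    have "\<alpha>'' ! r" "\<alpha>'' ! s" using r s rs len by auto
    then have "compatible f \<beta>" using \<beta> comp r(1) s(1) by blast
    moreover have "cube_edge \<alpha> \<beta>" using \<beta> r s ns len by (auto simp: cube_edge_def)
    moreover have "cube_edge \<beta> \<alpha>''"
    proof -
      have "\<alpha>'' = (\<alpha>[s := True])[r := True]" using r s rs by (simp add: list_update_swap)
      then show ?thesis using \<beta> r s rs ns len by (auto simp: cube_edge_def)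
    qed
    ultimately show "\<beta> \<in> ?P" by blast
  qed
  moreover have "\<alpha>[r := True] \<noteq> \<alpha>[s := True]"
    using r(1,2) rs len by (metis nth_list_update_eq nth_list_update_neq)
  ultimately show ?thesis by simp
next
  case True
  show ?thesis unfolding True by simp
qed

lemma of_nat_bit: "of_nat k = (of_bool (odd k) :: bit)"
  by (induction k) auto

lemma coord_d_BN_d_BN:
  assumes \<alpha>: "length \<alpha> = n" and f: "compatible f \<alpha>"
  shows "coord (d_BN D (d_BN D c)) \<alpha> f = 0"
proof -
  define P where "P = {\<alpha>'. length \<alpha>' = n \<and> cube_edge \<alpha>' \<alpha> \<and> compatible f \<alpha>'}"
  have finP: "finite P" unfolding P_def by (rule finite_subset[OF _ finite_vertices]) auto
  let ?Q = "\<lambda>s. compatible f (fst s) \<and> under f s"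
  have "coord (d_BN D (d_BN D c)) \<alpha> f =
      (\<Sum>t\<in>states D. of_bool (cube_edge (fst t) \<alpha> \<and> ?Q t) * d_BN D c t)"
    by (rule coord_d_BN[OF \<alpha> f])
  also have "\<dots> = (\<Sum>t\<in>states D. \<Sum>\<alpha>'\<in>P. of_bool (fst t = \<alpha>' \<and> under f t) * d_BN D c t)"
  proof (rule sum.cong[OF refl])
    fix t assume "t \<in> states D"
    then have "length (fst t) = n" by (auto simp: states_def)
    then have mem: "fst t \<in> P \<longleftrightarrow> cube_edge (fst t) \<alpha> \<and> compatible f (fst t)" by (simp add: P_def)
    have "(\<Sum>\<alpha>'\<in>P. of_bool (fst t = \<alpha>' \<and> under f t) * d_BN D c t) =
        (\<Sum>\<alpha>'\<in>P. if fst t = \<alpha>' then of_bool (under f t) * d_BN D c t else 0)"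
      by (intro sum.cong refl) simp
    also have "\<dots> = (if fst t \<in> P then of_bool (under f t) * d_BN D c t else 0)"
      by (rule sum.delta'[OF finP])
    also have "\<dots> = of_bool (cube_edge (fst t) \<alpha> \<and> ?Q t) * d_BN D c t"
      unfolding mem by (cases "cube_edge (fst t) \<alpha>"; cases "compatible f (fst t)") simp_all
    finally show "of_bool (cube_edge (fst t) \<alpha> \<and> ?Q t) * d_BN D c t =
      (\<Sum>\<alpha>'\<in>P. of_bool (fst t = \<alpha>' \<and> under f t) * d_BN D c t)" ..
  qed
  also have "\<dots> = (\<Sum>\<alpha>'\<in>P. coord (d_BN D c) \<alpha>' f)"
    unfolding coord_def by (rule sum.swap)
  also have "\<dots> = (\<Sum>\<alpha>'\<in>P. \<Sum>s\<in>states D. of_bool (cube_edge (fst s) \<alpha>' \<and> ?Q s) * c s)"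
    by (intro sum.cong refl coord_d_BN) (auto simp: P_def)
  also have "\<dots> = (\<Sum>s\<in>states D. \<Sum>\<alpha>'\<in>P. of_bool (cube_edge (fst s) \<alpha>' \<and> ?Q s) * c s)"
    by (rule sum.swap)
  also have "\<dots> = (\<Sum>s\<in>states D. 0)"
  proof (rule sum.cong[OF refl])
    fix s assume "s \<in> states D"
    then have len: "length (fst s) = n" by (auto simp: states_def)
    show "(\<Sum>\<alpha>'\<in>P. of_bool (cube_edge (fst s) \<alpha>' \<and> ?Q s) * c s) = 0"
    proof (cases "?Q s")
      case True
      have "{\<alpha>' \<in> P. cube_edge (fst s) \<alpha>'} =
          {\<alpha>'. cube_edge (fst s) \<alpha>' \<and> cube_edge \<alpha>' \<alpha> \<and> compatible f \<alpha>'}"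
        unfolding P_def using cube_edge_length[of "fst s"] len by auto
      then have "even (card {\<alpha>' \<in> P. cube_edge (fst s) \<alpha>'})"
        using even_paths[OF len _ f] True by simp
      moreover have "(\<Sum>\<alpha>'\<in>P. of_bool (cube_edge (fst s) \<alpha>')) =
          (of_nat (card {\<alpha>' \<in> P. cube_edge (fst s) \<alpha>'}) :: bit)"
        using finP by (simp add: Int_def)
      ultimately have "(\<Sum>\<alpha>'\<in>P. of_bool (cube_edge (fst s) \<alpha>')) = (0::bit)"
        by (simp only: of_nat_bit of_bool_eq simp_thms)
      moreover have "(\<Sum>\<alpha>'\<in>P. of_bool (cube_edge (fst s) \<alpha>' \<and> ?Q s) * c s) =
          (\<Sum>\<alpha>'\<in>P. of_bool (cube_edge (fst s) \<alpha>')) * c s"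
        unfolding sum_distrib_right using True by (intro sum.cong refl) (simp only: simp_thms)
      ultimately show ?thesis by (simp only: mult_zero_left)
    next
      case False
      then show ?thesis by (intro sum.neutral ballI) auto
    qed
  qed
  finally show ?thesis by simp
qed

text \<open>
  The transition to the idempotent basis is unitriangular for the inclusion order on the sets of
  circles labelled \<open>x\<close>.
\<close>

lemma coord_injective:
  assumes c: "\<And>\<alpha> f. length \<alpha> = n \<Longrightarrow> compatible f \<alpha> \<Longrightarrow> coord c \<alpha> f = 0"
    and \<alpha>: "length \<alpha> = n"
  shows "v \<in> labellings \<alpha> \<Longrightarrow> c (\<alpha>, v) = 0"
proof (induction "card {k \<in> circles D \<alpha>. v k = X_A}" arbitrary: v rule: less_induct)
  case less
  define f where "f x \<longleftrightarrow> (\<exists>k\<in>circles D \<alpha>. v k = X_A \<and> x \<in> k)" for x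
  have f_iff: "f x \<longleftrightarrow> v k = X_A" if "k \<in> circles D \<alpha>" "x \<in> k" for k x
    using that circles_disjoint[OF that(1)] unfolding f_def by blast
  have comp: "compatible f \<alpha>" unfolding compatible_iff using f_iff by blast
  have full: "full f k \<longleftrightarrow> v k = X_A" if "k \<in> circles D \<alpha>" for k
    using circle_nonempty[OF that] f_iff[OF that] unfolding full_def by blast
  let ?t = "\<lambda>s. of_bool (fst s = \<alpha> \<and> under f s) * c s"
  have mem: "(\<alpha>, v) \<in> states D" using \<alpha> less.prems by (simp add: states_def)
  have "?t s = 0" if s: "s \<in> states D - {(\<alpha>, v)}" for s
  proof (cases "fst s = \<alpha> \<and> under f s")
    case True
    then obtain w where w: "s = (\<alpha>, w)" "below f \<alpha> w" "w \<in> labellings \<alpha>" "w \<noteq> v"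
      using s by (cases s) (auto simp: states_def)
    have sub: "{k \<in> circles D \<alpha>. w k = X_A} \<subseteq> {k \<in> circles D \<alpha>. v k = X_A}"
      using w(2) full unfolding below_def by blast
    have "{k \<in> circles D \<alpha>. w k = X_A} \<noteq> {k \<in> circles D \<alpha>. v k = X_A}"
    proof
      assume eq: "{k \<in> circles D \<alpha>. w k = X_A} = {k \<in> circles D \<alpha>. v k = X_A}"
      have "w k = v k" if "k \<in> circles D \<alpha>" for k
      proof -
        have "w k = X_A \<longleftrightarrow> v k = X_A" using eq that by blast
        then show ?thesis by (cases "w k"; cases "v k") simp_all
      qed
      then have "w = v" using w(3) less.prems by (intro PiE_ext)
      then show False using w(4) by contradiction
    qed
    then have "card {k \<in> circles D \<alpha>. w k = X_A} < card {k \<in> circles D \<alpha>. v k = X_A}"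
      using sub finite_circles[of \<alpha>] by (intro psubset_card_mono) auto
    then have "c (\<alpha>, w) = 0" using less.hyps w(3) by blast
    then show ?thesis by (simp add: w(1))
  next
    case False
    then show ?thesis by (simp only: of_bool_eq mult_zero_left)
  qed
  then have "(\<Sum>s\<in>states D - {(\<alpha>, v)}. ?t s) = 0" by (intro sum.neutral ballI)
  moreover have "below f \<alpha> v" unfolding below_def using full by blast
  ultimately have "coord c \<alpha> f = c (\<alpha>, v)"
    unfolding coord_def sum.remove[OF finite_states mem] by simp
  then show ?case using c[OF \<alpha> comp] by simp
qed

lemma d_BN_outside: "s \<notin> states D \<Longrightarrow> d_BN D c s = 0"
  by (simp add: d_BN_def cube_map_def)

lemma d_BN_d_BN: "d_BN D (d_BN D c) = 0"
proof (rule ext)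
  fix s
  show "d_BN D (d_BN D c) s = 0 s"
  proof (cases "s \<in> states D")
    case True
    obtain \<alpha> v where s: "s = (\<alpha>, v)" by (cases s)
    have "d_BN D (d_BN D c) (\<alpha>, v) = 0"
      by (rule coord_injective) (use coord_d_BN_d_BN True s in \<open>auto simp: states_def\<close>)
    then show ?thesis by (simp add: s)
  next
    case False
    then show ?thesis by (simp add: d_BN_outside)
  qed
qed

end

section \<open>Quantum gradings\<close>

abbreviation coeff_Kh where "coeff_Kh \<equiv> cube_coeff m_Kh \<Delta>_Kh"
abbreviation coeff_tilde where "coeff_tilde \<equiv> cube_coeff m_tilde \<Delta>_tilde"

lemma m_Kh_deg: "m_Kh a b g = 1 \<Longrightarrow> deg g = deg a + deg b - 1"
  by (cases a; cases b; cases g) (simp_all add: basis_def)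

lemma \<Delta>_Kh_deg: "\<Delta>_Kh a (g, h) = 1 \<Longrightarrow> deg g + deg h = deg a - 1"
  by (cases a; cases g; cases h) (simp_all add: basis_def)

lemma m_tilde_deg: "m_tilde a b g = 1 \<Longrightarrow> deg g = deg a + deg b + 1"
  by (cases a; cases b; cases g) (simp_all add: basis_def)

lemma \<Delta>_tilde_deg: "\<Delta>_tilde a (g, h) = 1 \<Longrightarrow> deg g + deg h = deg a + 1"
  by (cases a; cases g; cases h) (simp_all add: basis_def)

lemma m_BN_eq_1: "m_BN a b g = 1 \<longleftrightarrow> m_Kh a b g = 1 \<or> m_tilde a b g = 1"
  by (cases a; cases b; cases g) (simp_all add: basis_def)

lemma \<Delta>_BN_eq_1: "\<Delta>_BN a p = 1 \<longleftrightarrow> \<Delta>_Kh a p = 1 \<or> \<Delta>_tilde a p = 1"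
  by (cases a; cases p; cases "fst p"; cases "snd p") (simp_all add: basis_def)

lemma weight_edge:
  assumes "cube_edge \<alpha> \<alpha>'" shows "weight \<alpha>' = Suc (weight \<alpha>)"
proof -
  obtain r where r: "r < length \<alpha>" "\<not> \<alpha> ! r" "\<alpha>' = \<alpha>[r := True]"
    using assms by (auto simp: cube_edge_def)
  have "{i. i < length \<alpha>' \<and> \<alpha>' ! i} = insert r {i. i < length \<alpha> \<and> \<alpha> ! i}"
    using r by (auto simp: nth_list_update)
  then show ?thesis
    using r(2) by (simp add: weight_def length_filter_conv_card)
qed

lemma hdeg_edge: "cube_edge \<alpha> \<alpha>' \<Longrightarrow> hdeg D (\<alpha>', v') = hdeg D (\<alpha>, v) + 1"
  by (simp add: hdeg_def weight_edge)

lemma cube_coeff_cases: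
  assumes "cube_coeff m \<Delta> D (\<alpha>, v) (\<alpha>', v') = 1"
  obtains (edge) "cube_edge \<alpha> \<alpha>'" and "\<And>k. k \<in> circles D \<alpha> \<inter> circles D \<alpha>' \<Longrightarrow> v' k = v k"
    and "(\<exists>a b c. a \<noteq> b \<and> circles D \<alpha> - circles D \<alpha>' = {a, b} \<and> circles D \<alpha>' - circles D \<alpha> = {c} \<and>
        m (v a) (v b) (v' c) = 1) \<or>
      (\<exists>a b c. b \<noteq> c \<and> circles D \<alpha> - circles D \<alpha>' = {a} \<and> circles D \<alpha>' - circles D \<alpha> = {b, c} \<and>
        \<Delta> (v a) (v' b, v' c) = 1)"
  using assms unfolding cube_coeff_def Let_def prod.case of_bool_eq_1_iff by blast

context link_diag
begin

lemma cube_coeff_qdeg: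
  assumes m: "\<And>a b g. m a b g = 1 \<Longrightarrow> deg g = deg a + deg b - 1 + w"
    and \<Delta>: "\<And>a g h. \<Delta> a (g, h) = 1 \<Longrightarrow> deg g + deg h = deg a - 1 + w"
    and c: "cube_coeff m \<Delta> D s t = 1"
  shows "hdeg D t = hdeg D s + 1" "qdeg D t = qdeg D s + w"
proof -
  obtain \<alpha> v \<alpha>' v' where st: "s = (\<alpha>, v)" "t = (\<alpha>', v')" by (cases s; cases t)
  let ?S = "circles D \<alpha>" and ?S' = "circles D \<alpha>'"
  have "hdeg D (\<alpha>', v') = hdeg D (\<alpha>, v) + 1 \<and> qdeg D (\<alpha>', v') = qdeg D (\<alpha>, v) + w"
    using c[unfolded st]
  proof (cases rule: cube_coeff_cases)
    case edge
    have S: "(\<Sum>k\<in>?S. deg (v k)) = (\<Sum>k\<in>?S \<inter> ?S'. deg (v k)) + (\<Sum>k\<in>?S - ?S'. deg (v k))"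
      by (rule sum.Int_Diff[OF finite_circles])
    have S': "(\<Sum>k\<in>?S'. deg (v' k)) = (\<Sum>k\<in>?S \<inter> ?S'. deg (v' k)) + (\<Sum>k\<in>?S' - ?S. deg (v' k))"
      using sum.Int_Diff[OF finite_circles, of "\<lambda>k. deg (v' k)" \<alpha>' ?S] by (simp only: Int_commute)
    have common: "(\<Sum>k\<in>?S \<inter> ?S'. deg (v' k)) = (\<Sum>k\<in>?S \<inter> ?S'. deg (v k))"
      using edge(2) by (intro sum.cong refl) simp
    have diff: "(\<Sum>k\<in>?S' - ?S. deg (v' k)) = (\<Sum>k\<in>?S - ?S'. deg (v k)) - 1 + w"
      using edge(3)
    proof (elim disjE exE conjE)
      fix a b c assume "a \<noteq> b" "?S - ?S' = {a, b}" "?S' - ?S = {c}" "m (v a) (v b) (v' c) = 1"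
      then show ?thesis using m[of "v a" "v b" "v' c"] by simp
    next
      fix a b c assume "b \<noteq> c" "?S - ?S' = {a}" "?S' - ?S = {b, c}" "\<Delta> (v a) (v' b, v' c) = 1"
      then show ?thesis using \<Delta>[of "v a" "v' b" "v' c"] by simp
    qed
    have hd: "hdeg D (\<alpha>', v') = hdeg D (\<alpha>, v) + 1" by (rule hdeg_edge[OF edge(1)])
    then show ?thesis using S S' common diff by (simp add: qdeg_def)
  qed
  then show "hdeg D t = hdeg D s + 1" "qdeg D t = qdeg D s + w" by (simp_all only: st)
qed

lemma Kh_coeff_deg:
  assumes "coeff_Kh D s t = 1"
  shows "hdeg D t = hdeg D s + 1" "qdeg D t = qdeg D s"
  using cube_coeff_qdeg[where m = m_Kh and \<Delta> = \<Delta>_Kh and w = 0 and s = s and t = t]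
    m_Kh_deg \<Delta>_Kh_deg assms by simp_all

lemma tilde_coeff_deg:
  assumes "coeff_tilde D s t = 1"
  shows "hdeg D t = hdeg D s + 1" "qdeg D t = qdeg D s + 2"
  using cube_coeff_qdeg[where m = m_tilde and \<Delta> = \<Delta>_tilde and w = 2 and s = s and t = t]
    m_tilde_deg \<Delta>_tilde_deg assms by simp_all

text \<open>
  The two summands are never both 1, since they belong to different changes of the \<open>q\<close>-grading; a
  disjunction of the existential conditions in \<open>cube_coeff\<close> is therefore the sum.
\<close>

lemma cube_coeff_BN:
  "coeff_BN D s t = coeff_Kh D s t + coeff_tilde D s t"
proof -
  obtain \<alpha> v \<alpha>' v' where st: "s = (\<alpha>, v)" "t = (\<alpha>', v')" by (cases s; cases t)
  have or: "coeff_BN D s t = 1 \<longleftrightarrow>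
      coeff_Kh D s t = 1 \<or> coeff_tilde D s t = 1"
    unfolding st cube_coeff_def Let_def prod.case of_bool_eq_1_iff m_BN_eq_1 \<Delta>_BN_eq_1
      conj_disj_distribL ex_disj_distrib by argo
  have "\<not> (coeff_Kh D s t = 1 \<and> coeff_tilde D s t = 1)"
  proof
    assume "coeff_Kh D s t = 1 \<and> coeff_tilde D s t = 1"
    then have "qdeg D t = qdeg D s" "qdeg D t = qdeg D s + 2"
      using Kh_coeff_deg(2) tilde_coeff_deg(2) by blast+
    then show False by simp
  qed
  then show ?thesis
    using or
    by (cases "coeff_BN D s t"; cases "coeff_Kh D s t";
        cases "coeff_tilde D s t") simp_all
qed

lemma d_BN_eq: "d_BN D c = d_Kh D c + beta D c"
  unfolding d_BN_def d_Kh_def beta_def cube_map_def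
  by (simp add: fun_eq_iff cube_coeff_BN distrib_left sum.distrib)

lemma cube_map_add: "cube_map m \<Delta> D (x + y) = cube_map m \<Delta> D x + cube_map m \<Delta> D y"
  by (simp add: fun_eq_iff cube_map_def distrib_right sum.distrib)

lemma cube_map_span_on:
  assumes "\<And>s t. s \<in> P \<Longrightarrow> t \<in> states D \<Longrightarrow> cube_coeff m \<Delta> D s t = 1 \<Longrightarrow> t \<in> Q"
    and c: "c \<in> span_on P"
  shows "cube_map m \<Delta> D c \<in> span_on Q"
proof (rule span_onI)
  fix t assume t: "t \<notin> Q"
  have "c s * cube_coeff m \<Delta> D s t = 0" if "t \<in> states D" for s
  proof (cases "s \<in> P")
    case True
    then have "cube_coeff m \<Delta> D s t \<noteq> 1" using assms(1) that t by blast
    then have "cube_coeff m \<Delta> D s t = 0" by (cases "cube_coeff m \<Delta> D s t") simp_all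
    then show ?thesis by simp
  next
    case False
    then show ?thesis using span_on_0[OF c] by simp
  qed
  then have "(\<Sum>s\<in>states D. c s * cube_coeff m \<Delta> D s t) = 0" if "t \<in> states D"
    using that by (intro sum.neutral ballI) blast
  then show "cube_map m \<Delta> D c t = 0" by (simp add: cube_map_def)
qed

lemma d_Kh_Cq: "c \<in> Cq D i j \<Longrightarrow> d_Kh D c \<in> Cq D (i + 1) j"
  unfolding Cq_def d_Kh_def by (erule cube_map_span_on[rotated]) (simp add: Kh_coeff_deg)

lemma beta_Cq: "c \<in> Cq D i j \<Longrightarrow> beta D c \<in> Cq D (i + 1) (j + 2)"
  unfolding Cq_def beta_def by (erule cube_map_span_on[rotated]) (simp add: tilde_coeff_deg)

lemma BN_coeff_deg:
  assumes "coeff_BN D s t = 1"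
  shows "hdeg D t = hdeg D s + 1" "qdeg D s \<le> qdeg D t"
proof -
  have "coeff_Kh D s t = 1 \<or> coeff_tilde D s t = 1"
    using assms unfolding cube_coeff_BN
    by (cases "coeff_Kh D s t"; cases "coeff_tilde D s t") simp_all
  then show "hdeg D t = hdeg D s + 1" "qdeg D s \<le> qdeg D t"
    using Kh_coeff_deg[of s t] tilde_coeff_deg[of s t] by auto
qed

lemma d_BN_filt: "c \<in> filt D k i \<Longrightarrow> d_BN D c \<in> filt D k (i + 1)"
  unfolding filt_def d_BN_def
proof (erule cube_map_span_on[rotated])
  fix s t assume "s \<in> {s \<in> states D. hdeg D s = i \<and> 2 * k + gamma D \<le> qdeg D s}"
    "t \<in> states D" "coeff_BN D s t = 1"
  then show "t \<in> {s \<in> states D. hdeg D s = i + 1 \<and> 2 * k + gamma D \<le> qdeg D s}"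
    using BN_coeff_deg[of s t] by auto
qed

lemma sum_deg_parity: "finite S \<Longrightarrow> even ((\<Sum>k\<in>S. deg (v k)) - int (card S))"
proof (induction rule: finite_induct)
  case (insert k S)
  then show ?case by (cases "v k") auto
qed simp

lemma qdeg_parity:
  assumes "s \<in> states D" shows "even (qdeg D s - gamma D)"
proof -
  obtain \<alpha> v where s: "s = (\<alpha>, v)" by (cases s)
  have len: "length \<alpha> = n" using assms s by (simp add: states_def)
  have 1: "even ((\<Sum>k\<in>circles D \<alpha>. deg (v k)) - int (card (circles D \<alpha>)))"
    by (rule sum_deg_parity[OF finite_circles])
  have "even (int (card (circles D \<alpha>)) + int (weight \<alpha>) + int (n_plus D) - int (card (components D)))"
    using circles_parity[OF len] by (simp flip: of_nat_add)
  moreover have "even (int (card (components D)) - gamma D)"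
    unfolding gamma_def by (simp add: of_nat_mod flip: minus_mod_eq_mult_div)
  moreover have "qdeg D s = (\<Sum>k\<in>circles D \<alpha>. deg (v k)) + int (weight \<alpha>) + int (n_plus D) - 2 * int (n_minus D)"
    unfolding s qdeg_def hdeg_def prod.case by simp
  ultimately show ?thesis using 1 by presburger
qed

lemma qdeg_bounded: "\<exists>N. \<forall>s\<in>states D. \<bar>qdeg D s\<bar> \<le> N"
proof (rule exI[of _ "\<Sum>s\<in>states D. \<bar>qdeg D s\<bar>"], rule ballI)
  fix s assume "s \<in> states D"
  then show "\<bar>qdeg D s\<bar> \<le> (\<Sum>s\<in>states D. \<bar>qdeg D s\<bar>)"
    by (rule member_le_sum[OF _ _ finite_states]) simp
qed

lemma span_on_mono: "P \<subseteq> Q \<Longrightarrow> span_on P \<subseteq> span_on Q"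
  unfolding span_on_def by blast

lemma span_on_empty: "span_on {} = {0}"
  by (auto simp: span_on_def fun_eq_iff)

text \<open>
  By parity no state has \<open>q\<close>-grading \<open>2 * k + 1 + gamma D\<close>, so what remains after removal of the
  part of \<open>q\<close>-grading \<open>2 * k + gamma D\<close> lies in the next filtration step.
\<close>

lemma filt_split:
  assumes c: "c \<in> filt D k i"
  shows "\<exists>q\<in>Cq D i (2 * k + gamma D). c - q \<in> filt D (k + 1) i"
proof (intro bexI)
  let ?q = "\<lambda>s. if qdeg D s = 2 * k + gamma D then c s else 0"
  have c0: "c s = 0" if "s \<notin> {s \<in> states D. hdeg D s = i \<and> 2 * k + gamma D \<le> qdeg D s}" for s
    using c that unfolding filt_def by (rule span_on_0)
  show "?q \<in> Cq D i (2 * k + gamma D)"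
    unfolding Cq_def by (rule span_onI) (use c0 in auto)
  have gap: "2 * (k + 1) + gamma D \<le> qdeg D s"
    if "s \<in> states D" "2 * k + gamma D \<le> qdeg D s" "qdeg D s \<noteq> 2 * k + gamma D" for s
    using qdeg_parity[OF that(1)] that(2,3) by presburger
  show "c - ?q \<in> filt D (k + 1) i"
    unfolding filt_def
  proof (rule span_onI)
    fix s assume s: "s \<notin> {s \<in> states D. hdeg D s = i \<and> 2 * (k + 1) + gamma D \<le> qdeg D s}"
    show "(c - ?q) s = 0"
    proof (cases "qdeg D s = 2 * k + gamma D")
      case False
      then have "c s = 0" using c0[of s] gap[of s] s by blast
      then show ?thesis by simp
    qed simp
  qed
qed

lemma Cq_filt_disjoint:
  assumes "c \<in> Cq D i (2 * k + gamma D)" "c \<in> filt D (k + 1) i" shows "c = 0"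
proof (rule ext)
  fix s
  show "c s = 0 s"
  proof (cases "qdeg D s = 2 * k + gamma D")
    case True
    then have "s \<notin> {s \<in> states D. hdeg D s = i \<and> 2 * (k + 1) + gamma D \<le> qdeg D s}" by simp
    then have "c s = 0" using assms(2) unfolding filt_def by (intro span_on_0)
    then show ?thesis by simp
  next
    case False
    then have "s \<notin> {s \<in> states D. hdeg D s = i \<and> qdeg D s = 2 * k + gamma D}" by simp
    then have "c s = 0" using assms(1) unfolding Cq_def by (intro span_on_0)
    then show ?thesis by simp
  qed
qed

lemma filt_filtered_complex: "filtered_complex (filt D) (d_BN D)"
proof
  show "d_BN D (x + y) = d_BN D x + d_BN D y" for x y
    unfolding d_BN_def by (rule cube_map_add)
  show "add_subgroup (filt D k i)" for k i
    unfolding filt_def by (rule span_on_subgroup)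
  show "filt D (k + 1) i \<subseteq> filt D k i" for k i
    unfolding filt_def by (rule span_on_mono) auto
qed (use d_BN_filt d_BN_d_BN bit_fun_add_self in auto)

lemma filt_split_filtered_complex:
  "split_filtered_complex (filt D) (d_BN D) (\<lambda>k i. Cq D i (2 * k + gamma D)) (d_Kh D) (beta D)"
proof -
  interpret fc: filtered_complex "filt D" "d_BN D" by (rule filt_filtered_complex)
  show ?thesis
  proof
    show "add_subgroup (Cq D i (2 * k + gamma D))" for k i
      unfolding Cq_def by (rule span_on_subgroup)
    show "Cq D i (2 * k + gamma D) \<subseteq> filt D k i" for k i
      unfolding Cq_def filt_def by (rule span_on_mono) auto
    show "d_Kh D (x + y) = d_Kh D x + d_Kh D y" for x y
      unfolding d_Kh_def by (rule cube_map_add)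
    show "beta D x \<in> Cq D (i + 1) (2 * (k + 1) + gamma D)"
      if "x \<in> Cq D i (2 * k + gamma D)" for x k i
      using beta_Cq[OF that] by (simp add: algebra_simps)
  qed (use filt_split Cq_filt_disjoint d_BN_eq d_Kh_Cq in auto)
qed

lemma filt_bounded_filtered_complex:
  obtains lo hi where "bounded_filtered_complex (filt D) (d_BN D) (C D) lo hi"
proof -
  interpret fc: filtered_complex "filt D" "d_BN D" by (rule filt_filtered_complex)
  obtain N where N: "\<And>s. s \<in> states D \<Longrightarrow> \<bar>qdeg D s\<bar> \<le> N" using qdeg_bounded by blast
  define M where "M = \<bar>N\<bar> + 1"
  have \<gamma>: "0 \<le> gamma D" "gamma D \<le> 1" by (auto simp: gamma_def)
  have "bounded_filtered_complex (filt D) (d_BN D) (C D) (- M) M"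
  proof
    fix k i assume "k \<le> - M"
    then have "2 * k + gamma D \<le> qdeg D s" if "s \<in> states D" for s
      using N[OF that] \<gamma> unfolding M_def by linarith
    then have "{s \<in> states D. hdeg D s = i \<and> 2 * k + gamma D \<le> qdeg D s} = {s \<in> states D. hdeg D s = i}"
      by blast
    then show "filt D k i = C D i" by (simp only: filt_def C_def)
  next
    fix k i assume "M \<le> k"
    then have "\<not> 2 * k + gamma D \<le> qdeg D s" if "s \<in> states D" for s
      using N[OF that] \<gamma> unfolding M_def by linarith
    then have "{s \<in> states D. hdeg D s = i \<and> 2 * k + gamma D \<le> qdeg D s} = {}"
      by blast
    then show "filt D k i = {0}" by (simp only: filt_def span_on_empty)
  qed
  then show thesis by (rule that)
qed

end

theorem theorem3p2:
  fixes D :: diagram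
  assumes "link_diagram D"
  shows "\<exists>E \<delta>. spectral_sequence E \<delta> \<and>
    arises_from E \<delta> (filt D) (d_BN D) \<and>
    (\<forall>k l. E 1 k l \<cong> KH D (k + l) (2 * k + gamma D)) \<and>
    converges_to E \<delta> (BN D) (BN_filt D) \<and>
    (\<forall>k l. E 2 k l \<cong> secondary D (k + l) (2 * k + gamma D))"
proof -
  interpret link_diag D by unfold_locales (rule assms)
  obtain lo hi where bounded: "bounded_filtered_complex (filt D) (d_BN D) (C D) lo hi"
    by (rule filt_bounded_filtered_complex)
  interpret b: bounded_filtered_complex "filt D" "d_BN D" "C D" lo hi by (rule bounded)
  interpret s: split_filtered_complex "filt D" "d_BN D" "\<lambda>k i. Cq D i (2 * k + gamma D)" "d_Kh D" "beta D"
    by (rule filt_split_filtered_complex)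
  have KH: "s.K k i = KH D i (2 * k + gamma D)" for k i
    by (simp only: s.K_def KH_def)
  have j: "2 * (k - 1) + gamma D = 2 * k + gamma D - 2" "2 * (k + 1) + gamma D = 2 * k + gamma D + 2" for k
    by simp_all
  have star: "s.b_star k i = beta_star D i (2 * k + gamma D)" for k i
    by (simp only: s.b_star_def[abs_def] beta_star_def[abs_def] j)
  have K2: "s.K2 k i = secondary D i (2 * k + gamma D)" for k i
    by (simp only: s.K2_def secondary_def KH star j)
  have H: "b.H = BN D" by (simp only: fun_eq_iff b.H_def BN_def simp_thms)
  have H_filt: "b.H_filt = BN_filt D" by (simp only: fun_eq_iff b.H_filt_def BN_filt_def simp_thms)
  have "spectral_sequence b.E b.\<delta>" by (rule b.spectral_sequence_E)
  moreover have "arises_from b.E b.\<delta> (filt D) (d_BN D)" by (rule b.arises_from_E)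
  moreover have "\<forall>k l. b.E 1 k l \<cong> KH D (k + l) (2 * k + gamma D)"
    using s.E1_iso unfolding KH by blast
  moreover have "converges_to b.E b.\<delta> (BN D) (BN_filt D)"
    using b.converges_to_H unfolding H H_filt .
  moreover have "\<forall>k l. b.E 2 k l \<cong> secondary D (k + l) (2 * k + gamma D)"
    using s.E2_iso unfolding K2 by blast
  ultimately show ?thesis by blast
qed

end
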